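(* Let $S$ be a closed oriented surface with one marked point $x_0$, let $\Sigma=S\setminus\{x_0\}$ carry a complete hyperbolic metric with one cusp (at $x_0$), and let $H$ be an embedded horosphere (horocycle) around the cusp. For an ideal triangulation $T$ of $\Sigma$ and an oriented edge $e$ of $T$ put $$\Phi(T,e)=\frac12\,\frac{\operatorname{length}(I(e))}{\operatorname{length}(H)} .$$ Then the form $\Phi$ is harmonic: $$\Phi(\mathcal R(T,e))+\Phi(\mathcal L(T,e))=\Phi(T,e).$$ Moreover $\partial\Phi=1$.
   Context: An ideal triangulation of $\Sigma$ is a triangulation $T$ of $S$, up to isotopy, whose only vertex is $x_0$; it is realized as an ideal hyperbolic triangulation, with edges complete geodesics from the cusp to itself. For an oriented edge $e$ of $T$, $s(e)$ is the oriented edge whose origin is the end point of $e$ and such that $e$, $s(e)$ are both on the boundary of the triangle on the right of $e$. $\mathfrak F(T,e)=(\widehat T,\widehat e)$, where $\widehat T$ is $T$ flipped at $e$ and $\widehat e$ is the new edge, oriented so that $(e,\widehat e)$ is positively oriented. $\mathcal R(T,e)=\mathfrak F(T,s(e))$, and $\mathcal L$ is defined in the same way after reversing the orientation of $\Sigma$. Every oriented edge $e$ of $T$ defines a point $e_H\in H$: the first intersection of $H$ with the oriented geodesic associated to $e$. Let $K\subset H$ be the collection of these points, for all oriented edges of $T$. Given $e_H\in K$, let $e_H^+\in K$ be the point immediately on the right and $e_H^-\in K$ the point immediately on the left of $e_H$ (for some auxiliary orientation of $H$), and let $I(e)$ be the interval of $H$ with extremities $e_H^{\pm}$ containing $e_H$.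 Fix an ideal triangulation $T_0$. The function $\Phi$ is regarded as a 1-form on a rooted planar tree (trivalent except at the root) whose edges are labelled by pairs $(T,e)$: the edges at the root are labelled by the pairs $\mathfrak F(T_0,e)$, $e$ running over the oriented edges of $T_0$, and an edge labelled $(T,e)$ is followed on the right by the edge labelled $\mathcal R(T,e)$ and on the left by the edge labelled $\mathcal L(T,e)$. The value of $\Phi$ on a tree edge, oriented away from the root, is the value of $\Phi$ on its label, and $\partial\Phi$ denotes the sum of the values of $\Phi$ over the edges at the root.
   Formalization: With root edges labelled by the flips F(T0,e), the sum ∂Φ is always 1/2, not 1 (modular torus: six terms, each 1/12); the theorem proves ∂Φ = 1/2, and that the sum of Φ(T0,e) over the oriented edges e of T0 equals 1. *)

theory Defs
  imports "HOL-Analysis.Analysis"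
begin

section \<open>The hyperbolic plane\<close>

definition upper_half_plane :: "complex set" where
  "upper_half_plane = {z. 0 < Im z}"

definition hyp_dist :: "complex \<Rightarrow> complex \<Rightarrow> real" where
  "hyp_dist z w = arcosh (1 + (cmod (z - w))\<^sup>2 / (2 * Im z * Im w))"

text \<open>Orientation preserving isometries of the upper half plane. Only the values on the half
  plane matter; values elsewhere are unconstrained, so that the set is closed under composition
  in spite of the convention \<open>x / 0 = 0\<close>.\<close>

definition hyp_isometries :: "(complex \<Rightarrow> complex) set" where
  "hyp_isometries = {g. \<exists>a b c d :: real. 0 < a * d - b * c \<and>
     (\<forall>z\<in>upper_half_plane. g z = (of_real a * z + of_real b) / (of_real c * z + of_real d))}"

text \<open>The unit speed geodesic from \<open>0\<close> to \<open>\<infinity>\<close>. Every oriented unit speed geodesic of the half plane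
  is \<open>g \<circ> imag_axis\<close> for an orientation preserving isometry \<open>g\<close>.\<close>

definition imag_axis :: "real \<Rightarrow> complex" where
  "imag_axis t = \<i> * of_real (exp t)"

text \<open>The open ideal triangle with vertices \<open>0\<close>, \<open>1\<close>, \<open>\<infinity>\<close>, which lies on the right of \<open>imag_axis\<close>. The rotation
  \<open>tri_rot\<close> preserves it and sends \<open>0 \<mapsto> \<infinity> \<mapsto> 1 \<mapsto> 0\<close>; so its sides, each having the triangle on its
  right, are \<open>imag_axis\<close> (from \<open>0\<close> to \<open>\<infinity>\<close>), \<open>tri_rot \<circ> imag_axis\<close> (from \<open>\<infinity>\<close> to \<open>1\<close>) and
  \<open>tri_rot \<circ> tri_rot \<circ> imag_axis\<close> (from \<open>1\<close> to \<open>0\<close>).\<close>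

definition std_triangle :: "complex set" where
  "std_triangle = {z. 0 < Im z \<and> 0 < Re z \<and> Re z < 1 \<and> 1 / 2 < cmod (z - 1 / 2)}"

definition tri_rot :: "complex \<Rightarrow> complex" where
  "tri_rot z = (z - 1) / z"


section \<open>Closed surfaces and cusped hyperbolic metrics\<close>

definition closed_surface :: "'a::t2_space set \<Rightarrow> bool" where
  "closed_surface S \<longleftrightarrow> compact S \<and> connected S \<and>
     (\<forall>x\<in>S. \<exists>U. openin (top_of_set S) U \<and> x \<in> U \<and> U homeomorphic (ball 0 1 :: complex set))"

definition complete_hyperbolic_metric :: "'a::t2_space set \<Rightarrow> ('a \<Rightarrow> 'a \<Rightarrow> real) \<Rightarrow> bool" where
  "complete_hyperbolic_metric M d \<longleftrightarrow>
     Metric_space M d \<and> Metric_space.mtopology M d = top_of_set M \<and> Metric_space.mcomplete M d \<and>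
     (\<forall>x\<in>M. \<exists>r>0. \<exists>f. \<exists>z\<in>upper_half_plane.
        f ` {w \<in> upper_half_plane. hyp_dist z w < r} = Metric_space.mball M d x r \<and>
        (\<forall>u\<in>upper_half_plane. \<forall>v\<in>upper_half_plane.
           hyp_dist z u < r \<longrightarrow> hyp_dist z v < r \<longrightarrow> d (f u) (f v) = hyp_dist u v))"

text \<open>\<open>p\<close> identifies the universal cover of the complete hyperbolic surface \<open>(M, d)\<close> with the half
  plane. Its deck transformations preserve the orientation of the half plane, and \<open>M\<close> is oriented
  by \<open>p\<close>.\<close>

definition hyperbolic_universal_cover ::
  "'a::t2_space set \<Rightarrow> ('a \<Rightarrow> 'a \<Rightarrow> real) \<Rightarrow> (complex \<Rightarrow> 'a) \<Rightarrow> bool" where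
  "hyperbolic_universal_cover M d p \<longleftrightarrow>
     covering_space upper_half_plane p M \<and>
     (\<forall>z\<in>upper_half_plane. \<exists>r>0. \<forall>u\<in>upper_half_plane. \<forall>v\<in>upper_half_plane.
        hyp_dist z u < r \<longrightarrow> hyp_dist z v < r \<longrightarrow> d (p u) (p v) = hyp_dist u v) \<and>
     (\<forall>z\<in>upper_half_plane. \<forall>w\<in>upper_half_plane. p z = p w \<longrightarrow>
        (\<exists>g\<in>hyp_isometries. g z = w \<and> (\<forall>u\<in>upper_half_plane. p (g u) = p u)))"

text \<open>The puncture \<open>x0\<close> is a cusp. The universal cover is normalised so that \<open>\<infinity>\<close> lies over the
  cusp: a translation is a deck transformation and \<open>p z\<close> tends to \<open>x0\<close> as \<open>z\<close> moves into the
  horoballs based at \<open>\<infinity>\<close>.\<close>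

locale cusped_hyperbolic_surface =
  fixes S :: "'a::t2_space set" and x0 :: 'a
    and d :: "'a \<Rightarrow> 'a \<Rightarrow> real" and p :: "complex \<Rightarrow> 'a"
  assumes surface: "closed_surface S"
    and marked_point: "x0 \<in> S"
    and metric: "complete_hyperbolic_metric (S - {x0}) d"
    and cover: "hyperbolic_universal_cover (S - {x0}) d p"
    and cusp_translation: "\<exists>t>0. \<forall>z\<in>upper_half_plane. p (z + of_real t) = p z"
    and cusp_limit: "(p \<longlongrightarrow> x0) (filtercomap Im at_top)"

text \<open>The length of a curve in a metric space, as the supremum over all subdivisions.\<close>

definition curve_length :: "('a \<Rightarrow> 'a \<Rightarrow> real) \<Rightarrow> (real \<Rightarrow> 'a) \<Rightarrow> real \<Rightarrow> real \<Rightarrow> real" where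
  "curve_length d c a b =
     Sup {\<Sum>i<n. d (c (u i)) (c (u (Suc i))) | n (u :: nat \<Rightarrow> real).
            u 0 = a \<and> u n = b \<and> (\<forall>i<n. u i \<le> u (Suc i))}"


section \<open>Ideal triangulations\<close>

definition cusp_geodesic :: "(complex \<Rightarrow> 'a::t2_space) \<Rightarrow> 'a \<Rightarrow> (real \<Rightarrow> 'a) \<Rightarrow> bool" where
  "cusp_geodesic p x0 c \<longleftrightarrow> (\<exists>g\<in>hyp_isometries. c = p \<circ> g \<circ> imag_axis) \<and> inj c \<and>
     (c \<longlongrightarrow> x0) at_bot \<and> (c \<longlongrightarrow> x0) at_top"

text \<open>An oriented geodesic is represented by the set of all its unit speed parametrizations.\<close>

definition oriented_class :: "(real \<Rightarrow> 'a) \<Rightarrow> (real \<Rightarrow> 'a) set" where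
  "oriented_class c = {\<lambda>t. c (t + s) | s. True}"

definition edge_support :: "(real \<Rightarrow> 'a) set \<Rightarrow> 'a set" where
  "edge_support e = (\<Union>c\<in>e. range c)"

text \<open>The (unoriented) edges of an ideal triangulation are point sets in the surface. They cut it
  into embedded open ideal triangles.\<close>

definition ideal_triangulation ::
  "(complex \<Rightarrow> 'a::t2_space) \<Rightarrow> 'a set \<Rightarrow> 'a \<Rightarrow> 'a set set \<Rightarrow> bool" where
  "ideal_triangulation p S x0 T \<longleftrightarrow>
     finite T \<and>
     (\<forall>E\<in>T. \<exists>c. cusp_geodesic p x0 c \<and> E = range c) \<and>
     pairwise disjnt T \<and>
     (\<forall>C\<in>components (S - {x0} - \<Union>T). \<exists>g\<in>hyp_isometries.
        inj_on p (g ` std_triangle) \<and> C = p ` g ` std_triangle \<and>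
        range (p \<circ> g \<circ> imag_axis) \<in> T \<and>
        range (p \<circ> g \<circ> tri_rot \<circ> imag_axis) \<in> T \<and>
        range (p \<circ> g \<circ> tri_rot \<circ> tri_rot \<circ> imag_axis) \<in> T)"

definition oriented_edges ::
  "(complex \<Rightarrow> 'a::t2_space) \<Rightarrow> 'a \<Rightarrow> 'a set set \<Rightarrow> (real \<Rightarrow> 'a) set set" where
  "oriented_edges p x0 T = {oriented_class c | c. cusp_geodesic p x0 c \<and> range c \<in> T}"

text \<open>\<open>g \<circ> imag_axis\<close> is a lift of the oriented edge \<open>e\<close> and \<open>g ` std_triangle\<close> is a lift of the
  triangle of \<open>T\<close> on the right of \<open>e\<close>.\<close>

definition right_frame ::
  "(complex \<Rightarrow> 'a::t2_space) \<Rightarrow> 'a set \<Rightarrow> 'a \<Rightarrow> 'a set set \<Rightarrow> (real \<Rightarrow> 'a) set \<Rightarrow> (complex \<Rightarrow> complex) \<Rightarrow> bool"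
  where
  "right_frame p S x0 T e g \<longleftrightarrow> g \<in> hyp_isometries \<and> p \<circ> g \<circ> imag_axis \<in> e \<and>
     p ` g ` std_triangle \<in> components (S - {x0} - \<Union>T)"

text \<open>The oriented edge \<open>s(e)\<close>, following \<open>e\<close> on the boundary of the triangle on its right.\<close>

definition next_edge ::
  "(complex \<Rightarrow> 'a::t2_space) \<Rightarrow> 'a set \<Rightarrow> 'a \<Rightarrow> 'a set set \<Rightarrow> (real \<Rightarrow> 'a) set \<Rightarrow> (real \<Rightarrow> 'a) set" where
  "next_edge p S x0 T e =
     (THE f. \<exists>g. right_frame p S x0 T e g \<and> f = oriented_class (p \<circ> g \<circ> tri_rot \<circ> imag_axis))"

text \<open>In the coordinates given by \<open>g\<close>, the edge \<open>e\<close> lifts to the geodesic from \<open>0\<close> to \<open>\<infinity>\<close>, the triangle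
  on its right to the one with third vertex \<open>1\<close> and the triangle on its left to the one with third
  vertex \<open>-l\<close>, the image of \<open>std_triangle\<close> under \<open>z \<mapsto> -l / z\<close>. The map \<open>z \<mapsto> (l z + 1) / (1 - z)\<close> sends
  \<open>0\<close> to \<open>1\<close> and \<open>\<infinity>\<close> to \<open>-l\<close>; so the new diagonal is oriented from the right of \<open>e\<close> to its left.\<close>

definition flip_edge ::
  "(complex \<Rightarrow> 'a::t2_space) \<Rightarrow> 'a set \<Rightarrow> 'a \<Rightarrow> 'a set set \<Rightarrow> (real \<Rightarrow> 'a) set \<Rightarrow> (real \<Rightarrow> 'a) set" where
  "flip_edge p S x0 T e =
     (THE f. \<exists>g l. right_frame p S x0 T e g \<and> 0 < l \<and>
        p ` g ` (\<lambda>z. - of_real l / z) ` std_triangle \<in> components (S - {x0} - \<Union>T) \<and>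
        f = oriented_class (p \<circ> g \<circ> (\<lambda>z. (of_real l * z + 1) / (1 - z)) \<circ> imag_axis))"

definition flip ::
  "(complex \<Rightarrow> 'a::t2_space) \<Rightarrow> 'a set \<Rightarrow> 'a \<Rightarrow> 'a set set \<Rightarrow> (real \<Rightarrow> 'a) set
     \<Rightarrow> 'a set set \<times> (real \<Rightarrow> 'a) set" where
  "flip p S x0 T e =
     (insert (edge_support (flip_edge p S x0 T e)) (T - {edge_support e}), flip_edge p S x0 T e)"

definition right_move ::
  "(complex \<Rightarrow> 'a::t2_space) \<Rightarrow> 'a set \<Rightarrow> 'a \<Rightarrow> 'a set set \<Rightarrow> (real \<Rightarrow> 'a) set
     \<Rightarrow> 'a set set \<times> (real \<Rightarrow> 'a) set" where
  "right_move p S x0 T e = flip p S x0 T (next_edge p S x0 T e)"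

text \<open>Reversing the orientation of the surface amounts to precomposing \<open>p\<close> with the reflection
  \<open>z \<mapsto> - cnj z\<close>.\<close>

definition left_move ::
  "(complex \<Rightarrow> 'a::t2_space) \<Rightarrow> 'a set \<Rightarrow> 'a \<Rightarrow> 'a set set \<Rightarrow> (real \<Rightarrow> 'a) set
     \<Rightarrow> 'a set set \<times> (real \<Rightarrow> 'a) set" where
  "left_move p = right_move (\<lambda>z. p (- cnj z))"


section \<open>Horocycles and the form\<close>

text \<open>The closed horocycle at height \<open>h\<close> around the cusp, parametrized by the real line.\<close>

definition horocycle :: "(complex \<Rightarrow> 'a) \<Rightarrow> real \<Rightarrow> real \<Rightarrow> 'a" where
  "horocycle p h x = p (Complex x h)"

definition embedded_horocycle :: "(complex \<Rightarrow> 'a) \<Rightarrow> real \<Rightarrow> real \<Rightarrow> bool" where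
  "embedded_horocycle p h t \<longleftrightarrow> 0 < h \<and> 0 < t \<and>
     (\<forall>x. horocycle p h (x + t) = horocycle p h x) \<and> inj_on (horocycle p h) {0..<t}"

text \<open>The point \<open>e\<^sub>H\<close>: the first intersection of the horocycle with the oriented geodesic \<open>e\<close>.\<close>

definition edge_point :: "(complex \<Rightarrow> 'a) \<Rightarrow> real \<Rightarrow> (real \<Rightarrow> 'a) set \<Rightarrow> 'a" where
  "edge_point p h e =
     (THE y. \<exists>c\<in>e. \<exists>s. y = c s \<and> c s \<in> range (horocycle p h) \<and>
               (\<forall>r<s. c r \<notin> range (horocycle p h)))"

definition edge_points ::
  "(complex \<Rightarrow> 'a::t2_space) \<Rightarrow> 'a \<Rightarrow> real \<Rightarrow> 'a set set \<Rightarrow> 'a set" where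
  "edge_points p x0 h T = edge_point p h ` oriented_edges p x0 T"

text \<open>\<open>edge_points p x0 h T\<close> is the set \<open>K\<close>, and \<open>I(e)\<close> is the arc of the horocycle between the points of
  \<open>K\<close> immediately before and immediately after \<open>e\<^sub>H\<close>. The choice of the preimage \<open>x\<close> of \<open>e\<^sub>H\<close> is
  immaterial, since the parametrization is periodic.\<close>

definition interval_length ::
  "(complex \<Rightarrow> 'a::t2_space) \<Rightarrow> ('a \<Rightarrow> 'a \<Rightarrow> real) \<Rightarrow> 'a \<Rightarrow> real
     \<Rightarrow> 'a set set \<times> (real \<Rightarrow> 'a) set \<Rightarrow> real" where
  "interval_length p d x0 h = (\<lambda>(T, e).
     let x = (SOME x. horocycle p h x = edge_point p h e);
         x_minus = Sup {y. y < x \<and> horocycle p h y \<in> edge_points p x0 h T};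
         x_plus = Inf {y. x < y \<and> horocycle p h y \<in> edge_points p x0 h T}
     in curve_length d (horocycle p h) x_minus x_plus)"

text \<open>Intended for \<open>embedded_horocycle p h t\<close>, when \<open>t\<close> is the least period of the parametrization and
  the denominator is the length of the closed horocycle.\<close>

definition Phi ::
  "(complex \<Rightarrow> 'a::t2_space) \<Rightarrow> ('a \<Rightarrow> 'a \<Rightarrow> real) \<Rightarrow> 'a \<Rightarrow> real \<Rightarrow> real
     \<Rightarrow> 'a set set \<times> (real \<Rightarrow> 'a) set \<Rightarrow> real" where
  "Phi p d x0 h t \<tau> =
     1 / 2 * (interval_length p d x0 h \<tau> / curve_length d (horocycle p h) 0 t)"

text \<open>The sum of the form over the edges at the root of the tree of triangulations of \<open>T0\<close>: these
  are indexed by the oriented edges \<open>e\<close> of \<open>T0\<close>, and labelled by the flips of \<open>T0\<close> at \<open>e\<close>.\<close>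

definition boundary_Phi ::
  "(complex \<Rightarrow> 'a::t2_space) \<Rightarrow> 'a set \<Rightarrow> ('a \<Rightarrow> 'a \<Rightarrow> real) \<Rightarrow> 'a \<Rightarrow> real \<Rightarrow> real
     \<Rightarrow> 'a set set \<Rightarrow> real" where
  "boundary_Phi p S d x0 h t T0 =
     (\<Sum>e\<in>oriented_edges p x0 T0. Phi p d x0 h t (flip p S x0 T0 e))"

end

theory Submission
  imports Defs "HOL-Real_Asymp.Real_Asymp"
begin

text \<open>In the half plane model with the cusp at \<open>\<infinity>\<close>, every oriented edge has a lift that descends
  vertically from \<open>\<infinity>\<close>, and it meets the horocycle at the foot \<open>x\<close> of this lift, modulo the period
  \<open>t\<close>. The triangle on the right of the edge lifts to the ideal triangle with vertices \<open>\<infinity>\<close>, \<open>x\<close> and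
  \<open>x - k\<close>, where \<open>x - k\<close> is the neighbouring point of \<open>K\<close>. Flipping the side opposite to \<open>\<infinity>\<close> adds a
  single new point strictly between \<open>x - k\<close> and \<open>x\<close>, and its neighbours are \<open>x - k\<close> and \<open>x\<close>; hence the
  right move has the value \<open>k / (2 t)\<close>. The reflection \<open>z \<mapsto> - cnj z\<close> gives the same for the left move
  and the gap on the other side, and harmonicity follows. The gaps \<open>k\<close> of all oriented edges add up to
  the period \<open>t\<close>; since \<open>s\<close> permutes the oriented edges, this gives the value \<open>1 / 2\<close> of the sum over
  the flips, while over the edges themselves both gaps count and the sum is \<open>1\<close>.\<close>

section \<open>Isometries of the half plane\<close>

text \<open>Two obstacles shape the proof. First, only one horocycle is assumed embedded, and
  \<open>p\<close> is only assumed to tend to \<open>x0\<close> high up. That the horoball above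
  misses the horocycle comes from a dichotomy for deck transformations; that a geodesic ending at
  \<open>x0\<close> really enters the horoball comes from the topology of \<open>S\<close>, since a
  small punctured disc around \<open>x0\<close> is connected. Second, the definition of a
  triangulation does not explicitly forbid that two sides of a triangle are the same edge, or that
  the new diagonal returns to the same triangle. If the flipped side were also a vertical side, the
  flip would remove an end of the gap. Both are excluded by the embeddedness of triangles and edges:
  folding two adjacent sides together would leave a single point on the horocycle, whereas every
  edge has two ends. Triangles are handled through isometries carrying \<open>std_triangle\<close>
  to a lift; an oriented edge determines them up to deck transformations, which gives the definite
  descriptions in \<open>next_edge\<close> and \<open>flip_edge\<close> their values.\<close>

lemma moebius_denominator_nonzero:
  fixes a b c d :: real
  assumes "0 < a * d - b * c" "0 < Im z"
  shows "of_real c * z + of_real d \<noteq> 0"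
proof
  assume "of_real c * z + of_real d = 0"
  then have "c * Im z = 0" "c * Re z + d = 0"
    by (auto simp: complex_eq_iff)
  with assms(2) have "c = 0" "d = 0" by auto
  with assms(1) show False by simp
qed

lemma Im_moebius:
  fixes a b c d :: real
  assumes "0 < a * d - b * c" "0 < Im z"
  shows "Im ((of_real a * z + of_real b) / (of_real c * z + of_real d)) =
    (a * d - b * c) * Im z / (cmod (of_real c * z + of_real d))\<^sup>2"
proof -
  have "Im ((of_real a * z + of_real b) / (of_real c * z + of_real d)) =
     Im ((of_real a * z + of_real b) * cnj (of_real c * z + of_real d)) / (cmod (of_real c * z + of_real d))\<^sup>2"
    by (subst complex_div_cnj) (simp flip: of_real_power)
  also have "Im ((of_real a * z + of_real b) * cnj (of_real c * z + of_real d)) = (a * d - b * c) * Im z"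
    by (simp add: algebra_simps)
  finally show ?thesis .
qed

lemma mem_upper_half_plane [simp]: "z \<in> upper_half_plane \<longleftrightarrow> 0 < Im z"
  by (simp add: upper_half_plane_def)

lemma hyp_isometryE:
  assumes "g \<in> hyp_isometries"
  obtains a b c d :: real where "0 < a * d - b * c"
    "\<And>z. 0 < Im z \<Longrightarrow> g z = (of_real a * z + of_real b) / (of_real c * z + of_real d)"
    "\<And>z. 0 < Im z \<Longrightarrow> of_real c * z + of_real d \<noteq> 0"
  using assms moebius_denominator_nonzero unfolding hyp_isometries_def by fastforce

lemma hyp_isometryI:
  fixes a b c d :: real
  assumes "0 < a * d - b * c"
    "\<And>z. 0 < Im z \<Longrightarrow> g z = (of_real a * z + of_real b) / (of_real c * z + of_real d)"
  shows "g \<in> hyp_isometries"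
  using assms unfolding hyp_isometries_def by auto

lemma hyp_isometry_Im_pos:
  assumes "g \<in> hyp_isometries" "0 < Im z"
  shows "0 < Im (g z)"
proof -
  obtain a b c d :: real where g: "0 < a * d - b * c"
    "\<And>z. 0 < Im z \<Longrightarrow> g z = (of_real a * z + of_real b) / (of_real c * z + of_real d)"
    "\<And>z. 0 < Im z \<Longrightarrow> of_real c * z + of_real d \<noteq> 0"
    using assms(1) by (rule hyp_isometryE) blast
  have "0 < (cmod (of_real c * z + of_real d))\<^sup>2" using g(3)[OF assms(2)] by simp
  then show ?thesis
    unfolding g(2)[OF assms(2)] Im_moebius[OF g(1) assms(2)] using g(1) assms(2) by simp
qed

lemma continuous_on_hyp_isometry:
  assumes "g \<in> hyp_isometries"
  shows "continuous_on upper_half_plane g"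
proof -
  obtain a b c d :: real where g: "0 < a * d - b * c"
    "\<And>z. 0 < Im z \<Longrightarrow> g z = (of_real a * z + of_real b) / (of_real c * z + of_real d)"
    "\<And>z. 0 < Im z \<Longrightarrow> of_real c * z + of_real d \<noteq> 0"
    using assms(1) by (rule hyp_isometryE) blast
  have "continuous_on upper_half_plane (\<lambda>z. (of_real a * z + of_real b) / (of_real c * z + of_real d))"
    by (intro continuous_intros) (use g(3) in auto)
  then show ?thesis by (rule continuous_on_eq) (use g(2) in auto)
qed

lemma hyp_isometry_cong:
  assumes "g \<in> hyp_isometries" "\<And>z. 0 < Im z \<Longrightarrow> f z = g z"
  shows "f \<in> hyp_isometries"
  using assms unfolding hyp_isometries_def by auto

lemma hyp_isometry_comp:
  assumes "f \<in> hyp_isometries" "g \<in> hyp_isometries"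
  shows "f \<circ> g \<in> hyp_isometries"
proof -
  obtain a b c d :: real where f: "0 < a * d - b * c"
    "\<And>z. 0 < Im z \<Longrightarrow> f z = (of_real a * z + of_real b) / (of_real c * z + of_real d)"
    "\<And>z. 0 < Im z \<Longrightarrow> of_real c * z + of_real d \<noteq> 0"
    using assms(1) by (rule hyp_isometryE) blast
  obtain a' b' c' d' :: real where g: "0 < a' * d' - b' * c'"
    "\<And>z. 0 < Im z \<Longrightarrow> g z = (of_real a' * z + of_real b') / (of_real c' * z + of_real d')"
    "\<And>z. 0 < Im z \<Longrightarrow> of_real c' * z + of_real d' \<noteq> 0"
    using assms(2) by (rule hyp_isometryE) blast
  show ?thesis
  proof (rule hyp_isometryI)
    have "0 < (a * d - b * c) * (a' * d' - b' * c')" using f(1) g(1) by simp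
    then show "0 < (a * a' + b * c') * (c * b' + d * d') - (a * b' + b * d') * (c * a' + d * c')"
      by (simp add: algebra_simps)
    fix z assume z: "0 < Im z"
    let ?n = "of_real a' * z + of_real b'" and ?e = "of_real c' * z + of_real d'"
    have e: "?e \<noteq> 0" using g(3)[OF z] .
    have "(f \<circ> g) z = (of_real a * (?n / ?e) + of_real b) / (of_real c * (?n / ?e) + of_real d)"
      using f(2)[OF hyp_isometry_Im_pos[OF assms(2) z]] g(2)[OF z] by simp
    also have "\<dots> = ((of_real a * (?n / ?e) + of_real b) * ?e) / ((of_real c * (?n / ?e) + of_real d) * ?e)"
      using e by simp
    also have "\<dots> = (of_real a * ?n + of_real b * ?e) / (of_real c * ?n + of_real d * ?e)"
      using e by (simp add: distrib_right)
    finally show "(f \<circ> g) z = (of_real (a * a' + b * c') * z + of_real (a * b' + b * d')) /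
        (of_real (c * a' + d * c') * z + of_real (c * b' + d * d'))"
      by (simp add: algebra_simps)
  qed
qed

lemma hyp_isometry_inverse:
  assumes "g \<in> hyp_isometries"
  obtains f where "f \<in> hyp_isometries" "\<And>z. 0 < Im z \<Longrightarrow> f (g z) = z" "\<And>z. 0 < Im z \<Longrightarrow> g (f z) = z"
proof -
  obtain a b c d :: real where g: "0 < a * d - b * c"
    "\<And>z. 0 < Im z \<Longrightarrow> g z = (of_real a * z + of_real b) / (of_real c * z + of_real d)"
    "\<And>z. 0 < Im z \<Longrightarrow> of_real c * z + of_real d \<noteq> 0"
    using assms(1) by (rule hyp_isometryE) blast
  define f :: "complex \<Rightarrow> complex" where
    "f z = (of_real d * z + of_real (- b)) / (of_real (- c) * z + of_real a)" for z
  have pos: "0 < d * a - (- b) * (- c)" using g(1) by (simp add: algebra_simps)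
  have f: "f \<in> hyp_isometries" by (rule hyp_isometryI[OF pos]) (simp add: f_def)
  have nz: "of_real (- c) * z + of_real a \<noteq> 0" if "0 < Im z" for z
    using moebius_denominator_nonzero[OF pos that] .
  have D: "complex_of_real (a * d - b * c) \<noteq> 0" using g(1) unfolding of_real_eq_0_iff by simp
  have "f (g z) = z" if z: "0 < Im z" for z
  proof -
    let ?n = "of_real a * z + of_real b" and ?e = "of_real c * z + of_real d"
    have e: "?e \<noteq> 0" using g(3)[OF z] .
    have "f (g z) = ((of_real d * (?n / ?e) + of_real (- b)) * ?e) / ((of_real (- c) * (?n / ?e) + of_real a) * ?e)"
      using e g(2)[OF z] f_def by simp
    also have "\<dots> = (of_real d * ?n - of_real b * ?e) / (of_real a * ?e - of_real c * ?n)"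
      using e by (simp add: left_diff_distrib)
    also have "\<dots> = (of_real (a * d - b * c) * z) / of_real (a * d - b * c)"
      by (simp add: algebra_simps)
    also have "\<dots> = z" using D by (metis nonzero_mult_div_cancel_left)
    finally show ?thesis .
  qed
  moreover have "g (f z) = z" if z: "0 < Im z" for z
  proof -
    let ?n = "of_real d * z + of_real (- b)" and ?e = "of_real (- c) * z + of_real a"
    have e: "?e \<noteq> 0" using nz[OF z] .
    have "g (f z) = ((of_real a * (?n / ?e) + of_real b) * ?e) / ((of_real c * (?n / ?e) + of_real d) * ?e)"
      using e g(2)[OF hyp_isometry_Im_pos[OF f z]] f_def by simp
    also have "\<dots> = (of_real a * ?n + of_real b * ?e) / (of_real d * ?e + of_real c * ?n)"
      using e by (simp add: distrib_right)
    also have "\<dots> = (of_real (a * d - b * c) * z) / of_real (a * d - b * c)"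
      by (simp add: algebra_simps)
    also have "\<dots> = z" using D by (metis nonzero_mult_div_cancel_left)
    finally show ?thesis .
  qed
  ultimately show ?thesis using that f by blast
qed

text \<open>Non-real roots of a real quadratic come in conjugate pairs, so a nonzero one has at most
  one root in the half plane.\<close>

lemma real_quadratic_two_roots:
  fixes a b c :: real
  assumes "of_real a * z\<^sup>2 + of_real b * z + of_real c = 0" "of_real a * w\<^sup>2 + of_real b * w + of_real c = 0"
    "0 < Im z" "0 < Im w" "z \<noteq> w"
  shows "a = 0 \<and> b = 0 \<and> c = 0"
proof -
  have "(z - w) * (of_real a * (z + w) + of_real b) = 0"
    using assms(1,2) by (simp add: algebra_simps power2_eq_square) (metis add_diff_cancel_left' add_right_cancel)
  then have "of_real a * (z + w) + of_real b = 0" using assms(5) by simp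
  then have "Im (of_real a * (z + w) + of_real b) = 0" by simp
  then have "a * (Im z + Im w) = 0" by simp
  then have a: "a = 0" using assms(3,4) by simp
  with assms(1) have "b * Im z = 0" "b * Re z + c = 0" by (auto simp: complex_eq_iff)
  then show ?thesis using a assms(3) by simp
qed

text \<open>After clearing denominators, \<open>f z = g z\<close> is a real quadratic equation in
  \<open>z\<close>; two solutions in the half plane make it trivial.\<close>

lemma hyp_isometry_eqI:
  assumes "f \<in> hyp_isometries" "g \<in> hyp_isometries" "f z = g z" "f w = g w"
    "0 < Im z" "0 < Im w" "z \<noteq> w" "0 < Im u"
  shows "f u = g u"
proof -
  obtain a b c d :: real where f: "0 < a * d - b * c"
    "\<And>z. 0 < Im z \<Longrightarrow> f z = (of_real a * z + of_real b) / (of_real c * z + of_real d)"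
    "\<And>z. 0 < Im z \<Longrightarrow> of_real c * z + of_real d \<noteq> 0"
    using assms(1) by (rule hyp_isometryE) blast
  obtain a' b' c' d' :: real where g: "0 < a' * d' - b' * c'"
    "\<And>z. 0 < Im z \<Longrightarrow> g z = (of_real a' * z + of_real b') / (of_real c' * z + of_real d')"
    "\<And>z. 0 < Im z \<Longrightarrow> of_real c' * z + of_real d' \<noteq> 0"
    using assms(2) by (rule hyp_isometryE) blast
  have iff: "f z = g z \<longleftrightarrow>
      of_real (a * c' - a' * c) * z\<^sup>2 + of_real (a * d' + b * c' - a' * d - b' * c) * z + of_real (b * d' - b' * d) = 0"
    if "0 < Im z" for z
    unfolding f(2)[OF that] g(2)[OF that] frac_eq_eq[OF f(3)[OF that] g(3)[OF that]]
    by (simp add: algebra_simps power2_eq_square)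
  have "a * c' - a' * c = 0 \<and> a * d' + b * c' - a' * d - b' * c = 0 \<and> b * d' - b' * d = 0"
    using assms iff by (intro real_quadratic_two_roots[of _ z _ _ w]) auto
  then show ?thesis unfolding iff[OF assms(8)] by simp
qed


lemma hyp_isometry_scale:
  assumes "0 < l" shows "(\<lambda>z. of_real l * z) \<in> hyp_isometries"
  by (rule hyp_isometryI[of l 1 0 0]) (use assms in auto)

lemma hyp_isometry_neg_inverse:
  assumes "0 < l" shows "(\<lambda>z. - of_real l / z) \<in> hyp_isometries"
  by (rule hyp_isometryI[of 0 0 "-l" 1]) (use assms in auto)

lemma hyp_isometry_tri_rot: "tri_rot \<in> hyp_isometries"
  by (rule hyp_isometryI[of 1 0 "-1" 1]) (auto simp: tri_rot_def)

lemma hyp_isometry_translation: "(\<lambda>z. z + of_real x) \<in> hyp_isometries"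
  by (rule hyp_isometryI[of 1 1 x 0]) auto

lemma hyp_isometry_id: "(\<lambda>z. z) \<in> hyp_isometries"
  by (rule hyp_isometryI[of 1 1 0 0]) auto

lemma hyp_isometry_pole_zero:
  assumes "0 < k" shows "(\<lambda>z. of_real x - of_real k / z) \<in> hyp_isometries"
  by (rule hyp_isometryI[of x 0 "-k" 1]) (use assms in \<open>auto simp: divide_simps\<close>)

lemma hyp_isometry_diagonal:
  assumes "0 < l" shows "(\<lambda>z. (of_real l * z + 1) / (1 - z)) \<in> hyp_isometries"
  by (rule hyp_isometryI[of l 1 1 "-1"]) (use assms in auto)

lemma Im_imag_axis [simp]: "Im (imag_axis s) = exp s"
  and Re_imag_axis [simp]: "Re (imag_axis s) = 0"
  by (simp_all add: imag_axis_def)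

lemma imag_axis_eq_iff [simp]: "imag_axis s = imag_axis t \<longleftrightarrow> s = t"
  by (auto simp: imag_axis_def)

lemma continuous_on_imag_axis: "continuous_on A imag_axis"
  unfolding imag_axis_def by (intro continuous_intros)

lemma Re_eq_0_imag_axis: "0 < Im z \<Longrightarrow> Re z = 0 \<Longrightarrow> z = imag_axis (ln (Im z))"
  by (simp add: imag_axis_def complex_eq_iff)

lemma imag_axis_shift: "imag_axis (s + r) = of_real (exp r) * imag_axis s"
  by (simp add: imag_axis_def exp_add mult_ac)

lemma neg_inverse_imag_axis:
  "0 < l \<Longrightarrow> - of_real l / imag_axis s = imag_axis (ln l - s)"
  by (simp add: imag_axis_def exp_diff complex_eq_iff Re_divide Im_divide power2_eq_square)

text \<open>The image of \<open>imag_axis r\<close> has real part zero exactly when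
  \<open>b * d + a * c * (exp r)\<^sup>2 = 0\<close>. Two different values of \<open>r\<close> force
  \<open>a * c = b * d = 0\<close>, so the matrix is diagonal or antidiagonal. The two cases
  preserve and reverse the direction of the axis.\<close>

lemma hyp_isometry_imag_axis_cases:
  assumes m: "m \<in> hyp_isometries" and "Re (m (imag_axis s)) = 0" "Re (m (imag_axis t)) = 0" "s \<noteq> t"
  obtains l where "0 < l" "\<And>z. 0 < Im z \<Longrightarrow> m z = of_real l * z"
    | l where "0 < l" "\<And>z. 0 < Im z \<Longrightarrow> m z = - of_real l / z"
proof -
  obtain a b c d :: real where g: "0 < a * d - b * c"
    "\<And>z. 0 < Im z \<Longrightarrow> m z = (of_real a * z + of_real b) / (of_real c * z + of_real d)"
    "\<And>z. 0 < Im z \<Longrightarrow> of_real c * z + of_real d \<noteq> 0"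
    using m by (rule hyp_isometryE) blast
  have eq: "b * d + a * c * (exp r)\<^sup>2 = 0" if "Re (m (imag_axis r)) = 0" for r
  proof -
    have "of_real c * imag_axis r + of_real d \<noteq> 0" using g(3) by simp
    then have n: "d\<^sup>2 + (c * exp r)\<^sup>2 \<noteq> 0"
      by (auto simp: imag_axis_def complex_eq_iff sum_power2_eq_zero_iff)
    show ?thesis using that n unfolding g(2)[of "imag_axis r", simplified]
      by (simp add: Re_divide imag_axis_def power2_eq_square mult_ac)
  qed
  have "a * c * ((exp s)\<^sup>2 - (exp t)\<^sup>2) = 0"
    unfolding right_diff_distrib using eq[OF assms(2)] eq[OF assms(3)] by linarith
  moreover have "(exp s)\<^sup>2 \<noteq> (exp t)\<^sup>2" using assms(4) by (simp add: power2_eq_iff_nonneg)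
  ultimately have ac: "a * c = 0" by simp
  then have bd: "b * d = 0" using eq[OF assms(2)] by (metis add.right_neutral mult_zero_left)
  show ?thesis
  proof (cases "c = 0")
    case True
    then have "a * d > 0" using g(1) by simp
    then have "b = 0" "0 < a / d" "d \<noteq> 0" using bd by (auto simp: zero_less_mult_iff zero_less_divide_iff)
    then show ?thesis using that(1)[of "a / d"] g(2) True by simp
  next
    case False
    then have "a = 0" using ac by simp
    then have "- (b * c) > 0" using g(1) by simp
    then have "d = 0" "0 < - (b / c)" using bd False
      by (auto simp: zero_less_mult_iff zero_less_divide_iff mult_less_0_iff divide_less_0_iff)
    then show ?thesis using that(2)[of "- (b / c)"] g(2) \<open>a = 0\<close> False
      by (simp add: field_simps)
  qed
qed

text \<open>An isometry which maps \<open>0\<close> to \<open>\<infinity>\<close> is recognized by the fact that it maps the lower end of the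
  imaginary axis into a horoball.\<close>

lemma hyp_isometry_zero_to_infinity:
  assumes m: "m \<in> hyp_isometries" and "0 < h" "\<And>s. s \<le> s1 \<Longrightarrow> h < Im (m (imag_axis s))"
  obtains x k where "0 < k" "\<And>z. 0 < Im z \<Longrightarrow> m z = of_real x - of_real k / z"
proof -
  obtain a b c d :: real where g: "0 < a * d - b * c"
    "\<And>z. 0 < Im z \<Longrightarrow> m z = (of_real a * z + of_real b) / (of_real c * z + of_real d)"
    "\<And>z. 0 < Im z \<Longrightarrow> of_real c * z + of_real d \<noteq> 0"
    using m by (rule hyp_isometryE) blast
  have "d = 0"
  proof (rule ccontr)
    assume d: "d \<noteq> 0"
    define D where "D = a * d - b * c"
    have D: "0 < D" using g(1) D_def by simp
    \<comment> \<open>Here the numerator \<open>D * exp s\<close> of the imaginary part is at most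
      \<open>h * d\<^sup>2\<close>, while the denominator is at least \<open>d\<^sup>2\<close>; so
      the height is at most \<open>h\<close>.\<close>
    define s where "s = min s1 (ln (h * d\<^sup>2 / D))"
    have "exp s \<le> h * d\<^sup>2 / D"
    proof -
      have "exp s \<le> exp (ln (h * d\<^sup>2 / D))" unfolding s_def by simp
      also have "\<dots> = h * d\<^sup>2 / D" using D d assms(2) by simp
      finally show ?thesis .
    qed
    then have le: "D * exp s \<le> h * d\<^sup>2" using D by (simp add: field_simps)
    have "d\<^sup>2 \<le> (cmod (of_real c * imag_axis s + of_real d))\<^sup>2"
      by (simp add: cmod_power2 imag_axis_def)
    then have "h * d\<^sup>2 \<le> h * (cmod (of_real c * imag_axis s + of_real d))\<^sup>2"
      using assms(2) by simp
    with le have "D * exp s \<le> h * (cmod (of_real c * imag_axis s + of_real d))\<^sup>2" by simp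
    moreover have "0 < (cmod (of_real c * imag_axis s + of_real d))\<^sup>2" using g(3) by simp
    ultimately have "Im (m (imag_axis s)) \<le> h"
      unfolding g(2)[of "imag_axis s", simplified] Im_moebius[OF g(1), of "imag_axis s", simplified] D_def[symmetric]
      by (simp add: pos_divide_le_eq)
    with assms(3)[of s] show False by (simp add: s_def)
  qed
  then have "0 < - (b * c)" using g(1) by simp
  then have c: "c \<noteq> 0" "0 < - (b / c)"
    by (auto simp: zero_less_mult_iff zero_less_divide_iff mult_less_0_iff divide_less_0_iff)
  show ?thesis
  proof (rule that[of "- (b / c)" "a / c"])
    show "m z = of_real (a / c) - of_real (- (b / c)) / z" if "0 < Im z" for z
    proof -
      have "z \<noteq> 0" using that by auto
      then show ?thesis using g(2)[OF that] \<open>d = 0\<close> c by (simp add: field_simps)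
    qed
  qed (rule c)
qed

section \<open>The standard ideal triangle\<close>

text \<open>Squaring turns the circle condition into \<open>Re z < (cmod z)\<^sup>2\<close>, the
  form in which \<open>tri_rot\<close> simply permutes the inequalities.\<close>

lemma std_triangle_iff:
  "z \<in> std_triangle \<longleftrightarrow> 0 < Im z \<and> 0 < Re z \<and> Re z < 1 \<and> Re z < (cmod z)\<^sup>2"
proof -
  have "(1 / 2 < cmod (z - 1 / 2)) \<longleftrightarrow> (1 / 2)\<^sup>2 < (cmod (z - 1 / 2))\<^sup>2"
    by (metis norm_ge_zero power_less_imp_less_base power_strict_mono zero_le_divide_1_iff
        zero_le_numeral zero_less_numeral)
  also have "\<dots> \<longleftrightarrow> Re z < (cmod z)\<^sup>2"
    unfolding cmod_power2 by (simp add: power2_eq_square algebra_simps)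
  finally show ?thesis by (simp add: std_triangle_def)
qed

lemma tri_rot_nonzero: "0 < Im z \<Longrightarrow> tri_rot z \<noteq> 0"
  by (auto simp: tri_rot_def)

lemma tri_rot_tri_rot: "0 < Im z \<Longrightarrow> tri_rot (tri_rot z) = 1 / (1 - z)"
proof -
  assume "0 < Im z"
  then have "z \<noteq> 0" "z - 1 \<noteq> 0" "1 - z \<noteq> 0" by (auto simp: complex_eq_iff)
  then show ?thesis by (simp add: tri_rot_def field_simps)
qed

lemma tri_rot_cubed: "0 < Im z \<Longrightarrow> tri_rot (tri_rot (tri_rot z)) = z"
proof -
  assume z: "0 < Im z"
  then have "1 - z \<noteq> 0" by (auto simp: complex_eq_iff)
  moreover have "tri_rot (tri_rot (tri_rot z)) = tri_rot (1 / (1 - z))"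
    using tri_rot_tri_rot[OF z] by simp
  moreover have "tri_rot (1 / (1 - z)) = (1 / (1 - z) - 1) * (1 - z)" by (simp add: tri_rot_def)
  ultimately show ?thesis by (simp add: left_diff_distrib)
qed

lemma Re_tri_rot: "Re (tri_rot z) = (if z = 0 then 0 else 1 - Re z / (cmod z)\<^sup>2)"
proof (cases "z = 0")
  case False
  then have "tri_rot z = 1 - inverse z" by (simp add: tri_rot_def field_simps)
  then show ?thesis using False by (simp add: cmod_power2)
qed (simp add: tri_rot_def)

text \<open>Since \<open>Re (tri_rot z) = 1 - Re z / (cmod z)\<^sup>2\<close>, its bounds 0 and 1
  are the circle inequality and \<open>0 < Re z\<close>; the circle inequality of the image comes
  from \<open>Re z < 1\<close>.\<close>

lemma tri_rot_std_triangle: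
  assumes "z \<in> std_triangle" shows "tri_rot z \<in> std_triangle"
proof -
  have z: "0 < Im z" "0 < Re z" "Re z < 1" "Re z < (cmod z)\<^sup>2"
    using assms by (auto simp: std_triangle_iff)
  then have z0: "z \<noteq> 0" and pos: "0 < (cmod z)\<^sup>2" by auto
  have 1: "0 < Im (tri_rot z)" using hyp_isometry_Im_pos[OF hyp_isometry_tri_rot z(1)] .
  have 2: "0 < Re (tri_rot z)" "Re (tri_rot z) < 1" using z z0 pos by (auto simp: Re_tri_rot)
  have "cmod (tri_rot z) ^ 2 = (cmod (z - 1))\<^sup>2 / (cmod z)\<^sup>2"
    by (simp add: tri_rot_def norm_divide power_divide)
  also have "(cmod (z - 1))\<^sup>2 = (cmod z)\<^sup>2 - 2 * Re z + 1"
    unfolding cmod_power2 by (simp add: power2_eq_square algebra_simps)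
  also have "((cmod z)\<^sup>2 - 2 * Re z + 1) / (cmod z)\<^sup>2 = Re (tri_rot z) + (1 - Re z) / (cmod z)\<^sup>2"
    using z0 by (simp add: Re_tri_rot field_simps)
  finally have "Re (tri_rot z) < cmod (tri_rot z) ^ 2" using z(3) pos by simp
  with 1 2 show ?thesis by (simp add: std_triangle_iff)
qed

lemma tri_rot_image_std_triangle: "tri_rot ` std_triangle = std_triangle"
proof
  show "tri_rot ` std_triangle \<subseteq> std_triangle" using tri_rot_std_triangle by auto
  show "std_triangle \<subseteq> tri_rot ` std_triangle"
  proof
    fix z assume z: "z \<in> std_triangle"
    then have "z = tri_rot (tri_rot (tri_rot z))" by (simp add: tri_rot_cubed std_triangle_iff)
    then show "z \<in> tri_rot ` std_triangle" using tri_rot_std_triangle z by blast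
  qed
qed

lemma std_triangle_subset: "std_triangle \<subseteq> upper_half_plane"
  by (auto simp: std_triangle_iff)

text \<open>The triangle is not convex in the Euclidean sense; it is the region above the semicircle
  \<open>sqrt (x - x\<^sup>2)\<close>, hence a continuous image of a convex product.\<close>

lemma connected_std_triangle: "connected std_triangle"
proof -
  let ?f = "\<lambda>w. Complex (fst w) (sqrt (fst w - (fst w)\<^sup>2) + snd w)"
  have "std_triangle = ?f ` ({0<..<1} \<times> {0<..})"
  proof
    show "?f ` ({0<..<1} \<times> {0<..}) \<subseteq> std_triangle"
    proof (rule image_subsetI)
      fix w :: "real \<times> real" assume "w \<in> {0<..<1} \<times> {0<..}"
      then obtain x y where w: "w = (x, y)" and x: "x \<in> {0<..<1}" and y: "y \<in> {0<..}" by auto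
      let ?r = "sqrt (x - x\<^sup>2)"
      have "x * x \<le> 1 * x" using x by (intro mult_right_mono) auto
      then have xx: "0 \<le> x - x\<^sup>2" by (simp add: power2_eq_square)
      then have "x - x\<^sup>2 = ?r\<^sup>2" by simp
      also have "\<dots> < (?r + y)\<^sup>2" using xx y by (intro power_strict_mono) auto
      finally have "x < x\<^sup>2 + (?r + y)\<^sup>2" by simp
      moreover have "0 < ?r + y" using xx y by (simp add: add_nonneg_pos)
      ultimately show "?f w \<in> std_triangle"
        using x y w by (simp add: std_triangle_iff cmod_power2)
    qed
    show "std_triangle \<subseteq> ?f ` ({0<..<1} \<times> {0<..})"
    proof
      fix z assume "z \<in> std_triangle"
      then have z: "0 < Im z" "0 < Re z" "Re z < 1" "Re z - (Re z)\<^sup>2 < (Im z)\<^sup>2"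
        by (auto simp: std_triangle_iff cmod_power2)
      then have "sqrt (Re z - (Re z)\<^sup>2) < Im z" by (simp add: real_less_lsqrt)
      then show "z \<in> ?f ` ({0<..<1} \<times> {0<..})"
        using z by (intro image_eqI[of _ _ "(Re z, Im z - sqrt (Re z - (Re z)\<^sup>2))"]) auto
    qed
  qed
  moreover have "connected (?f ` ({0<..<1} \<times> {0<..}))"
  proof (rule connected_continuous_image)
    show "continuous_on ({0<..<1} \<times> {0<..}) ?f"
      by (intro continuous_intros)
    show "connected ({0<..<1::real} \<times> {0::real<..})"
      by (intro convex_connected convex_Times) auto
  qed
  ultimately show ?thesis by simp
qed

text \<open>The closure satisfies the three weak inequalities, and equality in one of them means
  lying on a side: the imaginary axis, the semicircle (where \<open>tri_rot z\<close> has real part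
  zero), or the line \<open>Re z = 1\<close> (where \<open>tri_rot (tri_rot z)\<close> has).\<close>

lemma std_triangle_boundary:
  assumes "z \<in> closure std_triangle" "0 < Im z" "z \<notin> std_triangle"
  shows "Re z = 0 \<or> Re (tri_rot z) = 0 \<or> Re (tri_rot (tri_rot z)) = 0"
proof -
  have "closed {z. 0 \<le> Re z \<and> Re z \<le> 1 \<and> Re z \<le> (cmod z)\<^sup>2}"
    by (intro closed_Collect_conj closed_Collect_le continuous_intros)
  then have "closure std_triangle \<subseteq> {z. 0 \<le> Re z \<and> Re z \<le> 1 \<and> Re z \<le> (cmod z)\<^sup>2}"
    by (intro closure_minimal) (auto simp: std_triangle_iff)
  then have "0 \<le> Re z" "Re z \<le> 1" "Re z \<le> (cmod z)\<^sup>2" using assms(1) by auto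
  moreover have "Re (tri_rot (tri_rot z)) = (1 - Re z) / (cmod (1 - z))\<^sup>2"
    using assms(2) by (simp add: tri_rot_tri_rot Re_divide cmod_power2)
  moreover have "z \<noteq> 0" using assms(2) by auto
  ultimately show ?thesis using assms(2,3) by (auto simp: std_triangle_iff Re_tri_rot)
qed

text \<open>A connected set that leaves the triangle meets its frontier, which inside the half plane
  consists of points of the sides.\<close>

lemma connected_subset_std_triangle:
  assumes "connected N" "\<And>z. z \<in> N \<Longrightarrow> 0 < Im z" "N \<inter> std_triangle \<noteq> {}"
    "\<And>z. z \<in> N \<Longrightarrow> Re z \<noteq> 0" "\<And>z. z \<in> N \<Longrightarrow> Re (tri_rot z) \<noteq> 0"
    "\<And>z. z \<in> N \<Longrightarrow> Re (tri_rot (tri_rot z)) \<noteq> 0"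
  shows "N \<subseteq> std_triangle"
proof (rule ccontr)
  assume "\<not> N \<subseteq> std_triangle"
  then have "N \<inter> frontier std_triangle \<noteq> {}"
    using assms(1,3) by (intro connected_Int_frontier) auto
  then obtain z where z: "z \<in> N" "z \<in> frontier std_triangle" by auto
  have "open std_triangle" unfolding std_triangle_def
    by (intro open_Collect_conj open_Collect_less continuous_intros)
  then have "z \<in> closure std_triangle" "z \<notin> std_triangle"
    using z(2) by (auto simp: frontier_def interior_open)
  then show False using std_triangle_boundary assms z(1) by blast
qed

section \<open>The length of a horocycle\<close>

text \<open>The left side is the hyperbolic chord between two points of a horocycle whose arc has
  length \<open>x\<close>. The bound is \<open>cosh x = 1 + 2 * (sinh (x / 2))\<^sup>2\<close>
  together with \<open>x / 2 \<le> sinh (x / 2)\<close>.\<close>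

lemma arcosh_quadratic_le:
  fixes x :: real assumes "0 \<le> x"
  shows "arcosh (1 + x\<^sup>2 / 2) \<le> x"
proof -
  have "1 + x\<^sup>2 / 2 \<le> cosh x"
  proof -
    have "x / 2 \<le> sinh (x / 2)"
      using real_le_x_sinh[of "x / 2"] assms by (simp add: sinh_field_def exp_minus)
    then have "(x / 2)\<^sup>2 \<le> (sinh (x / 2))\<^sup>2" using assms by (intro power_mono) auto
    moreover have "cosh x = 1 + 2 * (sinh (x / 2))\<^sup>2"
      using cosh_double[of "x / 2"] cosh_square_eq[of "x / 2"] by simp
    ultimately show ?thesis by (simp add: power_divide)
  qed
  then have "arcosh (1 + x\<^sup>2 / 2) \<le> arcosh (cosh x)"
    using arcosh_real_strict_mono[of "1 + x\<^sup>2 / 2" "cosh x"] by (auto simp: le_less)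
  then show ?thesis using assms by (simp add: arcosh_cosh_real)
qed

text \<open>Inscribed polygons with \<open>n\<close> equal horocyclic chords exhaust the arc length
  \<open>L\<close>.\<close>

lemma arcosh_quadratic_limit:
  fixes L :: real assumes "0 < L"
  shows "(\<lambda>n. real n * arcosh (1 + (L / real n)\<^sup>2 / 2)) \<longlonglongrightarrow> L"
proof -
  have "arcosh (1 + (L / real n)\<^sup>2 / 2) =
      ln (1 + (L / real n)\<^sup>2 / 2 + sqrt ((1 + (L / real n)\<^sup>2 / 2)\<^sup>2 - 1))" for n
    by (rule arcosh_real_def) simp
  moreover have "(\<lambda>n. real n * ln (1 + (L / real n)\<^sup>2 / 2 + sqrt ((1 + (L / real n)\<^sup>2 / 2)\<^sup>2 - 1))) \<longlonglongrightarrow> L"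
    using assms by real_asymp
  ultimately show ?thesis by simp
qed

text \<open>On the surface, distances along the horocycle are hyperbolic chords only locally,
  because far apart points may have shortcuts. Shortcuts only decrease \<open>F\<close>: fine equal
  subdivisions and the triangle inequality bound every \<open>F (c a) (c b)\<close> by the arc
  length, and the same subdivisions approach that bound.\<close>

lemma curve_length_eq:
  fixes F :: "'a \<Rightarrow> 'a \<Rightarrow> real" and c :: "real \<Rightarrow> 'a"
  assumes h: "0 < h" and "a \<le> b"
    and triangle: "\<And>x y z. F (c x) (c z) \<le> F (c x) (c y) + F (c y) (c z)"
    and refl_zero: "\<And>x. F (c x) (c x) = 0"
    and local: "\<And>x. \<exists>\<delta>>0. \<forall>u v. \<bar>u - x\<bar> < \<delta> \<longrightarrow> \<bar>v - x\<bar> < \<delta> \<longrightarrow>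
       F (c u) (c v) = arcosh (1 + ((u - v) / h)\<^sup>2 / 2)"
  shows "curve_length F c a b = (b - a) / h"
proof -
  have unif: "\<exists>\<delta>>0. \<forall>u\<in>{a..b}. \<forall>v\<in>{a..b}. \<bar>u - v\<bar> < \<delta> \<longrightarrow>
       F (c u) (c v) = arcosh (1 + ((u - v) / h)\<^sup>2 / 2)" for a b
  proof -
    obtain \<delta> where \<delta>: "\<And>x. \<delta> x > 0" "\<And>x u v. \<bar>u - x\<bar> < \<delta> x \<Longrightarrow> \<bar>v - x\<bar> < \<delta> x \<Longrightarrow>
       F (c u) (c v) = arcosh (1 + ((u - v) / h)\<^sup>2 / 2)"
      using local by metis
    \<comment> \<open>A Lebesgue number of the cover makes the local radius uniform on the
      interval.\<close>
    obtain e where e: "0 < e" "\<And>x. x \<in> {a..b} \<Longrightarrow> \<exists>G \<in> (\<lambda>x. ball x (\<delta> x)) ` {a..b}. ball x e \<subseteq> G"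
    proof (rule Heine_Borel_lemma[of "{a..b}" "(\<lambda>x. ball x (\<delta> x)) ` {a..b}"])
      show "{a..b} \<subseteq> \<Union> ((\<lambda>x. ball x (\<delta> x)) ` {a..b})"
        using \<delta>(1) by (meson UN_I centre_in_ball subsetI)
    qed auto
    show ?thesis
    proof (intro exI[of _ e] conjI ballI impI e(1))
      fix u v assume u: "u \<in> {a..b}" and "v \<in> {a..b}" "\<bar>u - v\<bar> < e"
      then have "u \<in> ball u e" "v \<in> ball u e" using e(1) by (auto simp: dist_real_def)
      then obtain x where "u \<in> ball x (\<delta> x)" "v \<in> ball x (\<delta> x)" using e(2)[OF u] by blast
      then show "F (c u) (c v) = arcosh (1 + ((u - v) / h)\<^sup>2 / 2)"
        by (intro \<delta>(2)[of _ x]) (auto simp: dist_real_def abs_minus_commute)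
    qed
  qed
  have steps: "F (c (w 0)) (c (w n)) \<le> (\<Sum>i<n. F (c (w i)) (c (w (Suc i))))" for w :: "nat \<Rightarrow> real" and n
  proof (induction n)
    case (Suc n)
    then show ?case using triangle[of "w 0" "w (Suc n)" "w n"] by simp
  qed (simp add: refl_zero)
  have subdiv: "eventually (\<lambda>n. 0 < n \<and> (\<Sum>i<n. F (c (a + (b - a) * real i / real n)) (c (a + (b - a) * real (Suc i) / real n))) =
      real n * arcosh (1 + ((b - a) / h / real n)\<^sup>2 / 2)) sequentially" if "a < b" for a b
  proof -
    obtain \<delta> where \<delta>: "0 < \<delta>" "\<And>u v. u\<in>{a..b} \<Longrightarrow> v\<in>{a..b} \<Longrightarrow> \<bar>u - v\<bar> < \<delta> \<Longrightarrow>
       F (c u) (c v) = arcosh (1 + ((u - v) / h)\<^sup>2 / 2)"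
      using unif[of a b] by blast
    have "((\<lambda>n. (b - a) / real n) \<longlongrightarrow> 0) sequentially" by real_asymp
    then have "eventually (\<lambda>n. (b - a) / real n < \<delta>) sequentially"
      using \<delta>(1) by (rule order_tendstoD)
    then show ?thesis using eventually_gt_at_top[of 0]
    proof eventually_elim
      case (elim n)
      have "F (c (a + (b - a) * real i / real n)) (c (a + (b - a) * real (Suc i) / real n)) =
          arcosh (1 + ((b - a) / h / real n)\<^sup>2 / 2)" if "i < n" for i
      proof -
        let ?u = "a + (b - a) * real i / real n" and ?v = "a + (b - a) * real (Suc i) / real n"
        have diff: "?v - ?u = (b - a) / real n" by (simp add: right_diff_distrib distrib_left add_divide_distrib diff_divide_distrib algebra_simps)
        have 1: "(b - a) * real j / real n \<le> b - a" "0 \<le> (b - a) * real j / real n" if "j \<le> n" for j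
          using that elim \<open>a < b\<close> by (auto simp: pos_divide_le_eq intro!: mult_left_mono)
        have "F (c ?u) (c ?v) = arcosh (1 + ((?u - ?v) / h)\<^sup>2 / 2)"
        proof (rule \<delta>(2))
          show "?u \<in> {a..b}" "?v \<in> {a..b}" using 1[of i] 1[of "Suc i"] that by auto
          have "0 < (b - a) / real n" using elim \<open>a < b\<close> by simp
          then have "\<bar>?u - ?v\<bar> = (b - a) / real n" using diff by linarith
          then show "\<bar>?u - ?v\<bar> < \<delta>" using elim by simp
        qed
        also have "((?u - ?v) / h)\<^sup>2 = ((?v - ?u) / h)\<^sup>2"
          unfolding power_divide by (simp add: power2_commute)
        finally show ?thesis unfolding diff by (simp add: divide_simps mult_ac)
      qed
      then show ?case using elim by simp
    qed
  qed
  have bound: "F (c a) (c b) \<le> (b - a) / h" if "a \<le> b" for a b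
  proof (cases "a = b")
    case False
    then have ab: "a < b" using that by simp
    obtain n where n: "0 < n" "(\<Sum>i<n. F (c (a + (b - a) * real i / real n)) (c (a + (b - a) * real (Suc i) / real n))) =
      real n * arcosh (1 + ((b - a) / h / real n)\<^sup>2 / 2)"
      using eventually_happens[OF subdiv[OF ab]] by auto
    have "F (c a) (c b) \<le> real n * arcosh (1 + ((b - a) / h / real n)\<^sup>2 / 2)"
      using steps[of "\<lambda>i. a + (b - a) * real i / real n" n] n by simp
    also have "\<dots> \<le> real n * ((b - a) / h / real n)"
      using ab h by (intro mult_left_mono arcosh_quadratic_le) auto
    finally show ?thesis using n by simp
  qed (simp add: refl_zero)
  let ?A = "{\<Sum>i<n. F (c (u i)) (c (u (Suc i))) | n (u :: nat \<Rightarrow> real).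
            u 0 = a \<and> u n = b \<and> (\<forall>i<n. u i \<le> u (Suc i))}"
  have upper: "s \<le> (b - a) / h" if s_mem: "s \<in> ?A" for s
  proof -
    obtain n u where s: "s = (\<Sum>i<n. F (c (u i)) (c (u (Suc i))))" "u 0 = a" "u n = b" "\<forall>i<n. u i \<le> u (Suc i)"
      using s_mem by blast
    have "s \<le> (\<Sum>i<n. (u (Suc i) - u i) / h)" unfolding s(1) using bound s(4) by (intro sum_mono) auto
    also have "\<dots> = (\<Sum>i<n. u (Suc i) - u i) / h" by (simp add: sum_divide_distrib)
    also have "(\<Sum>i<n. u (Suc i) - u i) = b - a" using s(2,3) by (simp add: sum_lessThan_telescope)
    finally show ?thesis .
  qed
  have "Sup ?A = (b - a) / h"
  proof (cases "a = b")
    case True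
    have "0 \<in> ?A" using True by (intro CollectI exI[of _ 0] exI[of _ "\<lambda>_. a"]) auto
    then show ?thesis using upper True by (intro cSup_eq_maximum) auto
  next
    case False
    then have ab: "a < b" using assms(2) by simp
    have mem: "eventually (\<lambda>n. real n * arcosh (1 + ((b - a) / h / real n)\<^sup>2 / 2) \<in> ?A) sequentially"
      using subdiv[OF ab]
    proof eventually_elim
      case (elim n)
      then show ?case using ab
        by (intro CollectI exI[of _ n] exI[of _ "\<lambda>i. a + (b - a) * real i / real n"])
           (auto intro!: divide_right_mono mult_left_mono)
    qed
    have bdd: "bdd_above ?A" using upper by (rule bdd_aboveI)
    have "(b - a) / h \<le> Sup ?A"
    proof (rule tendsto_upperbound)
      show "(\<lambda>n. real n * arcosh (1 + ((b - a) / h / real n)\<^sup>2 / 2)) \<longlonglongrightarrow> (b - a) / h"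
        using ab h by (intro arcosh_quadratic_limit) simp
      show "\<forall>\<^sub>F n in sequentially. real n * arcosh (1 + ((b - a) / h / real n)\<^sup>2 / 2) \<le> Sup ?A"
        using mem by eventually_elim (rule cSup_upper[OF _ bdd])
    qed simp
    moreover have "?A \<noteq> {}" using eventually_happens[OF mem] by auto
    then have "Sup ?A \<le> (b - a) / h" using upper by (rule cSup_least)
    ultimately show ?thesis by simp
  qed
  then show ?thesis by (simp add: curve_length_def)
qed

section \<open>Deck transformations\<close>

context cusped_hyperbolic_surface
begin

text \<open>Values off the half plane are left free, as in \<open>hyp_isometries\<close>; equality
  of deck transformations therefore always means equality on the half plane.\<close>

definition deck :: "(complex \<Rightarrow> complex) \<Rightarrow> bool" where
  "deck g \<longleftrightarrow> g \<in> hyp_isometries \<and> (\<forall>u. 0 < Im u \<longrightarrow> p (g u) = p u)"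

lemma deckD: "deck g \<Longrightarrow> g \<in> hyp_isometries" "deck g \<Longrightarrow> 0 < Im u \<Longrightarrow> p (g u) = p u"
  by (auto simp: deck_def)

lemma deck_Im_pos: "deck g \<Longrightarrow> 0 < Im u \<Longrightarrow> 0 < Im (g u)"
  using deckD(1) hyp_isometry_Im_pos by blast

lemma covering: "covering_space upper_half_plane p (S - {x0})"
  using cover by (simp add: hyperbolic_universal_cover_def)

lemma p_in: "0 < Im z \<Longrightarrow> p z \<in> S - {x0}"
  using covering_space_imp_surjective[OF covering] by auto

lemma continuous_on_p: "continuous_on upper_half_plane p"
  using covering_space_imp_continuous[OF covering] .

lemma continuous_on_p_comp:
  "continuous_on A f \<Longrightarrow> (\<And>x. x \<in> A \<Longrightarrow> 0 < Im (f x)) \<Longrightarrow> continuous_on A (\<lambda>x. p (f x))"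
  by (rule continuous_on_compose2[OF continuous_on_p]) auto

lemma deck_exists:
  assumes "p z = p w" "0 < Im z" "0 < Im w"
  obtains g where "deck g" "g z = w"
  using cover assms unfolding hyperbolic_universal_cover_def deck_def by (metis mem_upper_half_plane)

lemma deck_inverse:
  assumes "deck g"
  obtains f where "deck f" "\<And>z. 0 < Im z \<Longrightarrow> f (g z) = z" "\<And>z. 0 < Im z \<Longrightarrow> g (f z) = z"
proof -
  obtain f where f: "f \<in> hyp_isometries" "\<And>z. 0 < Im z \<Longrightarrow> f (g z) = z" "\<And>z. 0 < Im z \<Longrightarrow> g (f z) = z"
    using hyp_isometry_inverse[OF deckD(1)[OF assms]] by blast
  moreover have "p (f z) = p z" if "0 < Im z" for z
    using deckD(2)[OF assms hyp_isometry_Im_pos[OF f(1) that]] f(3)[OF that] by simp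
  ultimately show ?thesis using that by (auto simp: deck_def)
qed

lemma deck_isometry_comp: "deck f \<Longrightarrow> g \<in> hyp_isometries \<Longrightarrow> (\<lambda>z. f (g z)) \<in> hyp_isometries"
  using hyp_isometry_comp[of f g] by (auto simp: deck_def comp_def)

lemma lift_unique:
  fixes f g :: "'b::topological_space \<Rightarrow> complex"
  assumes "connected A" "continuous_on A f" "continuous_on A g"
    "\<And>x. x \<in> A \<Longrightarrow> 0 < Im (f x)" "\<And>x. x \<in> A \<Longrightarrow> 0 < Im (g x)"
    "\<And>x. x \<in> A \<Longrightarrow> p (f x) = p (g x)" "a \<in> A" "f a = g a" "x \<in> A"
  shows "f x = g x"
proof (rule covering_space_lift_unique[OF covering, of f a g A "\<lambda>x. p (f x)"])
  show "continuous_on A (\<lambda>x. p (f x))" by (rule continuous_on_p_comp) (use assms in auto)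
  show "(\<lambda>x. p (f x)) \<in> A \<rightarrow> S - {x0}" using assms(4) p_in by blast
qed (use assms in auto)

lemma connected_upper_half_plane: "connected upper_half_plane"
  unfolding upper_half_plane_def by (intro convex_connected convex_halfspace_Im_gt)

text \<open>Both maps are lifts of \<open>p\<close> through \<open>p\<close>, so by unique lifting a
  single common value determines them.\<close>

lemma deck_eq:
  assumes "deck f" "deck g" "f z = g z" "0 < Im z" "0 < Im u"
  shows "f u = g u"
  by (rule lift_unique[of upper_half_plane f g z u])
    (use assms in \<open>auto simp: connected_upper_half_plane deck_Im_pos deckD intro: continuous_on_hyp_isometry\<close>)

lemma deck_id: "deck (\<lambda>z. z)"
  by (simp add: deck_def hyp_isometry_id)

lemma deck_fixed_point: "deck g \<Longrightarrow> g z = z \<Longrightarrow> 0 < Im z \<Longrightarrow> 0 < Im u \<Longrightarrow> g u = u"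
  using deck_eq[OF _ deck_id] by blast

lemma locally_injective:
  assumes "0 < Im z"
  obtains U where "open U" "z \<in> U" "\<And>u. u \<in> U \<Longrightarrow> 0 < Im u" "inj_on p U"
proof -
  obtain T u q where T: "z \<in> T" "openin (top_of_set upper_half_plane) T" "homeomorphism T u p q"
    using covering_space_local_homeomorphism[OF covering] assms by (metis mem_upper_half_plane)
  have "open upper_half_plane"
    unfolding upper_half_plane_def by (rule open_halfspace_Im_gt)
  then have "open T" using T(2) by (simp add: openin_open_eq)
  moreover have "inj_on p T" using T(3) by (metis homeomorphism_apply1 inj_onI)
  ultimately show ?thesis using that[of T] T(1,2) openin_imp_subset by fastforce
qed

lemma open_map:
  assumes "open U" "\<And>u. u \<in> U \<Longrightarrow> 0 < Im u"
  shows "openin (top_of_set (S - {x0})) (p ` U)"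
proof (subst openin_subopen, clarify)
  fix z assume z: "z \<in> U"
  then have "z \<in> upper_half_plane" using assms by simp
  then obtain T V q where T: "z \<in> T" "openin (top_of_set upper_half_plane) T" "p z \<in> V"
     "openin (top_of_set (S - {x0})) V" "homeomorphism T V p q"
    by (rule covering_space_local_homeomorphism[OF covering])
  have "openin (top_of_set T) (T \<inter> U)" using assms(1) by (simp add: openin_open_Int)
  then have "openin (top_of_set V) (p ` (T \<inter> U))"
    using homeomorphism_imp_open_map[OF T(5)] by blast
  then have "openin (top_of_set (S - {x0})) (p ` (T \<inter> U))" using T(4) by (rule openin_trans)
  then show "\<exists>W. openin (top_of_set (S - {x0})) W \<and> p z \<in> W \<and> W \<subseteq> p ` U"
    using z T(1) by (intro exI[of _ "p ` (T \<inter> U)"]) auto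
qed

text \<open>A deck transformation matching the points at time 0 matches the whole geodesics by
  unique lifting; two points of the axis then determine the isometry.\<close>

lemma geodesic_lift:
  assumes "f \<in> hyp_isometries" "g \<in> hyp_isometries" "\<And>s. p (f (imag_axis s)) = p (g (imag_axis s))"
  obtains m where "deck m" "\<And>z. 0 < Im z \<Longrightarrow> m (f z) = g z"
proof -
  have pos: "0 < Im (f (imag_axis s))" "0 < Im (g (imag_axis s))" for s
    using assms(1,2) hyp_isometry_Im_pos by auto
  obtain m where m: "deck m" "m (f (imag_axis 0)) = g (imag_axis 0)"
    using deck_exists[OF assms(3)[of 0]] pos by blast
  have mf: "(\<lambda>z. m (f z)) \<in> hyp_isometries" using deck_isometry_comp m(1) assms(1) .
  have cont: "continuous_on UNIV (\<lambda>s. k (imag_axis s))" if "k \<in> hyp_isometries" for k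
    by (rule continuous_on_compose2[OF continuous_on_hyp_isometry[OF that] continuous_on_imag_axis]) auto
  have "m (f (imag_axis s)) = g (imag_axis s)" for s
  proof (rule lift_unique[of UNIV "\<lambda>s. m (f (imag_axis s))" "\<lambda>s. g (imag_axis s)" 0 s])
    show "p (m (f (imag_axis s))) = p (g (imag_axis s))" for s
      using deckD(2)[OF m(1) pos(1)] assms(3) by simp
  qed (use pos m(2) deck_Im_pos[OF m(1)] cont[OF mf] cont[OF assms(2)] in auto)
  from this[of 0] this[of 1] have "m (f z) = g z" if "0 < Im z" for z
    using hyp_isometry_eqI[OF mf assms(2), of "imag_axis 0" "imag_axis 1" z] that by simp
  then show ?thesis using that m(1) by blast
qed

end

section \<open>The cusp\<close>

locale cusped_surface_with_horocycle = cusped_hyperbolic_surface S x0 d p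
  for S :: "'a::t2_space set" and x0 d p +
  fixes h t :: real
  assumes embedded: "embedded_horocycle p h t"
begin

lemma h_pos: "0 < h" and t_pos: "0 < t"
  using embedded by (auto simp: embedded_horocycle_def)

lemma horocycle_period: "p (Complex (x + t) h) = p (Complex x h)"
  and horocycle_inj: "inj_on (\<lambda>x. p (Complex x h)) {0..<t}"
  using embedded by (auto simp: embedded_horocycle_def horocycle_def[abs_def])

text \<open>Period \<open>t\<close> is assumed only on the horocycle at height \<open>h\<close>. The
  deck transformation carrying \<open>Complex 0 h\<close> to \<open>Complex t h\<close> agrees with
  the translation along the whole lifted horocycle by unique lifting, hence everywhere.\<close>

lemma deck_translation: "deck (\<lambda>z. z + of_real t)"
proof -
  obtain m where m: "deck m" "m (Complex 0 h) = Complex t h"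
    using deck_exists[of "Complex 0 h" "Complex t h"] horocycle_period[of 0] h_pos by auto
  have "m (Complex x h) = Complex (x + t) h" for x
  proof (rule lift_unique[of UNIV "\<lambda>x. m (Complex x h)" "\<lambda>x. Complex (x + t) h" 0])
    show "continuous_on UNIV (\<lambda>x. m (Complex x h))"
      by (rule continuous_on_compose2[OF continuous_on_hyp_isometry[OF deckD(1)[OF m(1)]]])
        (use h_pos in \<open>auto intro!: continuous_intros\<close>)
  qed (use m h_pos deckD(2)[OF m(1)] horocycle_period in \<open>auto simp: deck_Im_pos intro!: continuous_intros\<close>)
  then have eq: "m (Complex x h) = Complex x h + of_real t" for x by (simp add: complex_eq_iff)
  have "m z = z + of_real t" if "0 < Im z" for z
    using hyp_isometry_eqI[OF deckD(1)[OF m(1)] hyp_isometry_translation eq[of 0] eq[of 1]] that h_pos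
    by simp
  then show ?thesis using deckD(2)[OF m(1)] by (auto simp: deck_def hyp_isometry_translation)
qed

lemma p_translate_t: "0 < Im z \<Longrightarrow> p (z + of_real t) = p z"
  using deckD(2)[OF deck_translation] .

lemma p_translate_nat: "0 < Im z \<Longrightarrow> p (z + of_real (of_nat n * t)) = p z"
proof (induction n)
  case (Suc n)
  have "z + of_real (of_nat (Suc n) * t) = (z + of_real (of_nat n * t)) + of_real t"
    by (simp add: algebra_simps)
  moreover have "p ((z + of_real (of_nat n * t)) + of_real t) = p (z + of_real (of_nat n * t))"
    using Suc.prems by (intro p_translate_t) simp
  ultimately show ?case using Suc by metis
qed simp

lemma p_translate: "0 < Im z \<Longrightarrow> p (z + of_real (of_int n * t)) = p z"
proof (cases "0 \<le> n")
  case True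
  assume "0 < Im z" then show ?thesis using True p_translate_nat[of z "nat n"] by simp
next
  case False
  assume "0 < Im z"
  then have "p (z + of_real (of_int n * t) + of_real (of_nat (nat (- n)) * t)) = p (z + of_real (of_int n * t))"
    by (intro p_translate_nat) simp
  then show ?thesis using False by simp
qed

lemma Complex_add_of_real: "Complex x y + of_real r = Complex (x + r) y"
  by (simp add: complex_eq_iff)

lemma mod_period: fixes x :: real obtains n :: int where "x + of_int n * t \<in> {0..<t}"
proof
  have "of_int \<lfloor>x / t\<rfloor> * t \<le> x" using t_pos by (simp add: pos_le_divide_eq[symmetric])
  moreover have "x / t < of_int \<lfloor>x / t\<rfloor> + 1" by linarith
  then have "x < of_int \<lfloor>x / t\<rfloor> * t + t" using t_pos by (simp add: pos_divide_less_eq algebra_simps)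
  ultimately show "x + of_int (- \<lfloor>x / t\<rfloor>) * t \<in> {0..<t}" by simp
qed

lemma horocycle_eqD:
  assumes "p (Complex x h) = p (Complex y h)"
  obtains n :: int where "y = x + of_int n * t"
proof -
  obtain m k :: int where mk: "x + of_int m * t \<in> {0..<t}" "y + of_int k * t \<in> {0..<t}"
    using mod_period by metis
  have *: "p (Complex (z + of_int n * t) h) = p (Complex z h)" for z and n :: int
    using p_translate[of "Complex z h" n, unfolded Complex_add_of_real] h_pos by simp
  have "x + of_int m * t = y + of_int k * t"
    by (rule inj_onD[OF horocycle_inj _ mk]) (use assms * in auto)
  then have "y = x + of_int (m - k) * t" by (simp add: algebra_simps)
  then show ?thesis using that by blast
qed

lemma horocycle_eq_iff: "p (Complex x h) = p (Complex y h) \<longleftrightarrow> (\<exists>n::int. y = x + of_int n * t)"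
proof
  assume "\<exists>n::int. y = x + of_int n * t"
  then obtain n :: int where "y = x + of_int n * t" by blast
  then show "p (Complex x h) = p (Complex y h)"
    using p_translate[of "Complex x h" n, unfolded Complex_add_of_real] h_pos by simp
qed (metis horocycle_eqD)

text \<open>A deck transformation that lifts a point of the horocycle either maps another point of the
  horocycle to the horocycle, hence is a translation, or fixes \<open>\<infinity>\<close> and conjugates the translation by
  \<open>t\<close> to a smaller one.\<close>

lemma horoball_disjoint_horocycle:
  assumes "h < Im z"
  shows "p z \<noteq> p (Complex x h)"
proof
  assume eq: "p z = p (Complex x h)"
  obtain m where m: "deck m" "m (Complex x h) = z"
    using deck_exists[OF eq[symmetric]] assms h_pos by auto
  obtain a b c d :: real where g: "0 < a * d - b * c"
    "\<And>z. 0 < Im z \<Longrightarrow> m z = (of_real a * z + of_real b) / (of_real c * z + of_real d)"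
    "\<And>z. 0 < Im z \<Longrightarrow> of_real c * z + of_real d \<noteq> 0"
    using deckD(1)[OF m(1)] by (rule hyp_isometryE) blast
  define D where "D = a * d - b * c"
  have D: "0 < D" using g(1) D_def by simp
  have Im: "Im (m (Complex y h)) = D * h / ((c * y + d)\<^sup>2 + (c * h)\<^sup>2)" for y
    using g(2)[of "Complex y h"] Im_moebius[OF g(1), of "Complex y h"] h_pos
    by (simp add: D_def cmod_power2)
  show False
  proof (cases "c = 0")
    case True
    then have d: "d \<noteq> 0" "a \<noteq> 0" "0 < a / d" using D by (auto simp: D_def zero_less_mult_iff zero_less_divide_iff)
    define \<alpha> where "\<alpha> = a / d"
    have m_eq: "m w = of_real \<alpha> * w + of_real (b / d)" if "0 < Im w" for w
      using g(2)[OF that] True d by (simp add: \<alpha>_def add_divide_distrib)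
    have "Im (m (Complex x h)) = \<alpha> * h" using m_eq h_pos by simp
    then have "1 < \<alpha>" using m(2) assms h_pos by (simp add: mult_less_cancel_right_pos)
    \<comment> \<open>Conjugating the translation by \<open>t\<close> with the expanding map
      \<open>m\<close> gives the translation by \<open>t / \<alpha>\<close>, which would be a period
      of the horocycle shorter than \<open>t\<close>.\<close>
    then have \<alpha>: "0 < t / \<alpha>" "t / \<alpha> < t" using t_pos by (auto simp: field_simps)
    have "p (Complex (t / \<alpha>) h) = p (m (Complex (t / \<alpha>) h))"
      using deckD(2)[OF m(1)] h_pos by simp
    also have "m (Complex (t / \<alpha>) h) = m (Complex 0 h) + of_real t"
      using m_eq h_pos \<open>1 < \<alpha>\<close> by (simp add: Complex_eq algebra_simps)
    also have "p \<dots> = p (m (Complex 0 h))"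
      using deck_Im_pos[OF m(1), of "Complex 0 h"] h_pos by (intro p_translate_t) simp
    also have "\<dots> = p (Complex 0 h)" using deckD(2)[OF m(1)] h_pos by simp
    finally have "t / \<alpha> = 0" using inj_onD[OF horocycle_inj, of "t / \<alpha>" 0] \<alpha> t_pos by simp
    then show False using \<alpha> by simp
  next
    case False
    \<comment> \<open>For \<open>c \<noteq> 0\<close> the image of the lifted horocycle is a circle
      tangent to the real axis: its height exceeds \<open>h\<close> at \<open>x\<close> and drops to
      at most \<open>h\<close> far away, so it equals \<open>h\<close> somewhere in between.\<close>
    let ?f = "\<lambda>y. Im (m (Complex y h))"
    have nz: "(c * y + d)\<^sup>2 + (c * h)\<^sup>2 > 0" for y
      using False h_pos by (simp add: add_nonneg_pos)
    obtain y where y: "x \<le> y" "?f y \<le> h"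
    proof -
      have "\<exists>y\<ge>x. D \<le> (c * y + d)\<^sup>2"
      proof -
        \<comment> \<open>Beyond \<open>r\<close> the value of \<open>c * y + d\<close> is at least
          \<open>max D 1\<close> in modulus; the maximum with 1 ensures that its square dominates
          \<open>D\<close> also when \<open>D < 1\<close>.\<close>
        define r where "r = (max D 1 + \<bar>d\<bar>) / \<bar>c\<bar>"
        define y where "y = max x r"
        have "0 \<le> r" using D False by (auto simp: r_def)
        then have "r \<le> \<bar>y\<bar>" by (auto simp: y_def)
        then have "\<bar>c\<bar> * r \<le> \<bar>c\<bar> * \<bar>y\<bar>" by (simp add: mult_left_mono)
        then have "max D 1 + \<bar>d\<bar> \<le> \<bar>c * y\<bar>" using False by (simp add: r_def abs_mult)
        then have *: "max D 1 \<le> \<bar>c * y + d\<bar>" by linarith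
        have "D \<le> max D 1 * max D 1" using mult_mono[of 1 "max D 1" D "max D 1"] D by simp
        also have "\<dots> \<le> \<bar>c * y + d\<bar> * \<bar>c * y + d\<bar>" using * D by (intro mult_mono) auto
        finally show ?thesis by (intro exI[of _ y]) (auto simp: y_def power2_eq_square)
      qed
      then obtain y where y: "x \<le> y" "D \<le> (c * y + d)\<^sup>2" by blast
      then have "D \<le> (c * y + d)\<^sup>2 + (c * h)\<^sup>2" by (simp add: add_increasing2)
      then have "?f y \<le> h" unfolding Im using nz[of y] h_pos by (simp add: pos_divide_le_eq mult.commute)
      with y(1) show ?thesis using that by blast
    qed
    have "\<exists>w. x \<le> w \<and> w \<le> y \<and> ?f w = h"
    proof (rule IVT2')
      show "continuous_on {x..y} ?f"
        unfolding Im by (intro continuous_intros) (use nz in \<open>auto simp: less_le\<close>)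
    qed (use y assms m(2) in auto)
    then obtain w where w: "Im (m (Complex w h)) = h" by blast
    then have mw: "m (Complex w h) = Complex (Re (m (Complex w h))) h" by (simp add: complex_eq_iff)
    have "p (Complex w h) = p (Complex (Re (m (Complex w h))) h)"
      using deckD(2)[OF m(1), of "Complex w h"] h_pos mw by simp
    then obtain n :: int where n: "Re (m (Complex w h)) = w + of_int n * t"
      by (rule horocycle_eqD)
    \<comment> \<open>Agreement at one point makes \<open>m\<close> a translation, which preserves
      heights, whereas \<open>z\<close> lies above \<open>h\<close>.\<close>
    have "deck (\<lambda>z. z + of_real (of_int n * t))"
      using p_translate[of _ n] hyp_isometry_translation[of "of_int n * t"] by (simp add: deck_def)
    then have "m (Complex x h) = Complex x h + of_real (of_int n * t)"
      by (rule deck_eq[OF m(1), of _ "Complex w h"]) (use mw n h_pos in \<open>auto simp: complex_eq_iff\<close>)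
    then show False using m(2) assms by simp
  qed
qed

section \<open>Neighbourhoods of the puncture\<close>

lemma cusp_eventually_in:
  assumes "open V" "x0 \<in> V"
  obtains r where "h < r" "\<And>z. r < Im z \<Longrightarrow> p z \<in> V"
proof -
  have "eventually (\<lambda>z. p z \<in> V) (filtercomap Im at_top)"
    using cusp_limit assms by (rule topological_tendstoD)
  then obtain P where P: "eventually P at_top" "\<And>z. P (Im z) \<Longrightarrow> p z \<in> V"
    by (auto simp: eventually_filtercomap)
  then obtain r where "\<And>x. r \<le> x \<Longrightarrow> P x" by (auto simp: eventually_at_top_linorder)
  with P(2) show ?thesis using that[of "max r (h + 1)"] by auto
qed

text \<open>Modulo the translation by \<open>t\<close> the strip is a compact rectangle. For
  \<open>r = h\<close> it is the horocycle itself.\<close>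

lemma compact_horoball_image:
  "compact (p ` {z. h \<le> Im z \<and> Im z \<le> r})"
proof -
  have "p ` {z. h \<le> Im z \<and> Im z \<le> r} = (\<lambda>(x, y). p (Complex x y)) ` ({0..t} \<times> {h..r})"
  proof (intro subset_antisym image_subsetI)
    fix z assume z: "z \<in> {z. h \<le> Im z \<and> Im z \<le> r}"
    obtain n :: int where n: "Re z + of_int n * t \<in> {0..<t}" by (rule mod_period)
    have "p z = p (z + of_real (of_int n * t))" using p_translate[of z n] z h_pos by auto
    also have "z + of_real (of_int n * t) = Complex (Re z + of_int n * t) (Im z)"
      by (simp add: complex_eq_iff)
    finally show "p z \<in> (\<lambda>(x, y). p (Complex x y)) ` ({0..t} \<times> {h..r})"
      using n z by force
  qed auto
  moreover have "continuous_on ({0..t} \<times> {h..r}) (\<lambda>w. p (Complex (fst w) (snd w)))"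
    by (rule continuous_on_p_comp) (use h_pos in \<open>auto intro!: continuous_intros\<close>)
  ultimately show ?thesis
    by (simp add: case_prod_beta compact_Times compact_continuous_image)
qed

text \<open>This is the converse of \<open>cusp_limit\<close>. A small punctured disc around
  \<open>x0\<close> misses the horocycle, so it is covered by two disjoint open sets, the open
  horoball and the complement of the closed one. It meets the horoball and is connected, so it lies
  inside.\<close>

lemma punctured_neighbourhood:
  obtains V where "open V" "x0 \<in> V" "V \<inter> S - {x0} \<subseteq> p ` {z. h < Im z}"
proof -
  let ?U = "p ` {z. h < Im z}" and ?C = "p ` {z. Im z = h}" and ?D = "p ` {z. h \<le> Im z}"
  have C: "compact ?C"
    using compact_horoball_image[of h] by (simp add: antisym_conv cong: conj_cong) (metis (mono_tags, lifting) antisym order_refl Collect_cong)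
  \<comment> \<open>Points far up lie in a neighbourhood of \<open>x0\<close> separated from
    \<open>q\<close>, and the remaining part of the closed horoball has compact image.\<close>
  have D: "openin (top_of_set (S - {x0})) (S - {x0} - ?D)"
  proof (subst openin_subopen, intro ballI)
    fix q assume "q \<in> S - {x0} - ?D"
    then have q: "q \<in> S" "q \<noteq> x0" "q \<notin> ?D" by auto
    then obtain V W where VW: "open V" "open W" "x0 \<in> V" "q \<in> W" "V \<inter> W = {}"
      by (metis hausdorff)
    obtain r where r: "h < r" "\<And>z. r < Im z \<Longrightarrow> p z \<in> V" using cusp_eventually_in[OF VW(1,3)] by blast
    let ?K = "p ` {z. h \<le> Im z \<and> Im z \<le> r}"
    have "closed ?K" using compact_horoball_image by (rule compact_imp_closed)
    then have "open (W - ?K)" using VW(2) by (simp add: open_Diff)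
    then have "openin (top_of_set (S - {x0})) ((S - {x0}) \<inter> (W - ?K))" by (rule openin_open_Int)
    moreover have "q \<in> W - ?K" using VW(4) q(3) by auto
    moreover have "(S - {x0}) \<inter> (W - ?K) \<subseteq> S - {x0} - ?D"
    proof
      fix q assume q: "q \<in> (S - {x0}) \<inter> (W - ?K)"
      have "q \<noteq> p z" if "h \<le> Im z" for z
      proof
        assume "q = p z"
        then have "\<not> r < Im z" using q r(2)[of z] VW(5) by blast
        then show False using q that \<open>q = p z\<close> by auto
      qed
      then show "q \<in> S - {x0} - ?D" using q by auto
    qed
    ultimately show "\<exists>T. openin (top_of_set (S - {x0})) T \<and> q \<in> T \<and> T \<subseteq> S - {x0} - ?D"
      using q by blast
  qed
  \<comment> \<open>The chart at \<open>x0\<close> supplies the connected punctured disc; this is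
    where it matters that \<open>S\<close> is a surface also at the marked point.\<close>
  obtain Y where Y: "openin (top_of_set S) Y" "x0 \<in> Y" "Y homeomorphic (ball 0 1 :: complex set)"
    using surface marked_point unfolding closed_surface_def by blast
  obtain f g where fg: "homeomorphism Y (ball 0 1 :: complex set) f g"
    using Y(3) by (auto simp: homeomorphic_def)
  have x0C: "x0 \<notin> ?C" using p_in h_pos by fastforce
  have "openin (top_of_set Y) (Y - ?C)"
    using compact_imp_closed[OF C] by (simp add: openin_open_Int Diff_eq open_Compl)
  then have "openin (top_of_set (ball 0 1)) (f ` (Y - ?C))"
    using homeomorphism_imp_open_map[OF fg] by blast
  then have "open (f ` (Y - ?C))" by (simp add: openin_open_eq)
  moreover have "f x0 \<in> f ` (Y - ?C)" using Y(2) x0C by blast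
  ultimately obtain e where e: "0 < e" "ball (f x0) e \<subseteq> f ` (Y - ?C)"
    using open_contains_ball by blast
  let ?B = "g ` ball (f x0) e"
  have fsub: "f ` (Y - ?C) \<subseteq> ball 0 1" using fg by (auto simp: homeomorphism_def)
  have gf: "g (f y) = y" if "y \<in> Y" for y using fg that by (rule homeomorphism_apply1)
  have B_sub: "?B \<subseteq> Y - ?C" using e(2) gf by fastforce
  have "openin (top_of_set (ball 0 1)) (ball (f x0) e)"
    using e(2) fsub by (simp add: openin_open_eq)
  then have "openin (top_of_set Y) ?B"
    using homeomorphism_imp_open_map[OF homeomorphism_symD[OF fg]] by blast
  then have "openin (top_of_set S) ?B" using Y(1) by (rule openin_trans)
  then obtain V where V: "open V" "?B = S \<inter> V" by (auto simp: openin_open)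
  have x0B: "x0 \<in> ?B" using gf[OF Y(2)] e(1) by (metis centre_in_ball imageI)
  have "g ` (ball (f x0) e - {f x0}) = ?B - {x0}"
  proof -
    have "inj_on g (ball 0 1)" by (rule inj_on_inverseI[of _ f]) (rule homeomorphism_apply2[OF fg])
    then have "inj_on g (ball (f x0) e)" by (rule inj_on_subset) (use e(2) fsub in blast)
    then have "g ` (ball (f x0) e - {f x0}) = ?B - g ` {f x0}"
      using e(1) by (intro inj_on_image_set_diff[of g "ball (f x0) e"]) auto
    then show ?thesis using gf[OF Y(2)] by simp
  qed
  moreover have "connected (g ` (ball (f x0) e - {f x0}))"
  proof (rule connected_continuous_image)
    show "continuous_on (ball (f x0) e - {f x0}) g"
      by (rule continuous_on_subset[OF homeomorphism_cont2[OF fg]]) (use e(2) fsub in blast)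
    show "connected (ball (f x0) e - {f x0})" by (rule connected_punctured_ball) simp
  qed
  ultimately have conn: "connected (?B - {x0})" by simp
  have BS: "?B - {x0} \<subseteq> S - {x0}" using V by auto
  have oU: "openin (top_of_set (S - {x0})) ?U"
    by (rule open_map) (use h_pos in \<open>auto intro: open_halfspace_Im_gt\<close>)
  have part: "?B - {x0} \<subseteq> ?U \<union> (S - {x0} - ?D)"
  proof
    fix q assume q: "q \<in> ?B - {x0}"
    then have "q \<notin> ?C" using B_sub by blast
    have "q \<in> ?U" if qD: "q \<in> ?D"
    proof -
      obtain z where z: "q = p z" "h \<le> Im z" using qD by blast
      then have "Im z \<noteq> h" using \<open>q \<notin> ?C\<close> by blast
      then show ?thesis using z by simp
    qed
    then show "q \<in> ?U \<union> (S - {x0} - ?D)" using q BS by blast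
  qed
  have "?U \<inter> (?B - {x0}) \<noteq> {}"
  proof -
    have "x0 \<in> V" using x0B V(2) by blast
    then obtain r where r: "h < r" "\<And>z. r < Im z \<Longrightarrow> p z \<in> V" using cusp_eventually_in[OF V(1)] by blast
    let ?z = "Complex 0 (r + 1)"
    have "p ?z \<in> V" "p ?z \<in> ?U" using r by (auto intro!: imageI)
    moreover have "p ?z \<in> S - {x0}" by (rule p_in) (use r h_pos in auto)
    ultimately show ?thesis using V(2) by blast
  qed
  moreover have "?U \<inter> (S - {x0} - ?D) = {}" by (auto simp: less_imp_le)
  ultimately have "?B - {x0} \<subseteq> ?U"
  proof -
    obtain U1 where U1: "open U1" "?U = (S - {x0}) \<inter> U1" using oU by (auto simp: openin_open)
    obtain U2 where U2: "open U2" "S - {x0} - ?D = (S - {x0}) \<inter> U2" using D by (auto simp: openin_open)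
    have "U1 \<inter> U2 \<inter> (?B - {x0}) \<subseteq> ?U \<inter> (S - {x0} - ?D)"
      unfolding U1(2) U2(2) using BS by blast
    then have "U1 \<inter> U2 \<inter> (?B - {x0}) = {}" using \<open>?U \<inter> (S - {x0} - ?D) = {}\<close> by blast
    moreover have "?B - {x0} \<subseteq> U1 \<union> U2" using part unfolding U1(2) U2(2) by blast
    ultimately    have "U1 \<inter> (?B - {x0}) = {} \<or> U2 \<inter> (?B - {x0}) = {}"
      using connectedD[OF conn U1(1) U2(1)] by blast
    moreover have "U1 \<inter> (?B - {x0}) \<noteq> {}"
      using \<open>?U \<inter> (?B - {x0}) \<noteq> {}\<close> unfolding U1(2) by blast
    ultimately have "U2 \<inter> (?B - {x0}) = {}" by blast
    then show ?thesis using part unfolding U2(2) by blast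
  qed
  then show ?thesis using that[of V] V x0B by blast
qed

end

section \<open>Cusp geodesics\<close>

text \<open>The time is minus the logarithm of the height, which gives unit speed and makes every
  \<open>down x\<close> cross height \<open>h\<close> at time \<open>- ln h\<close>.\<close>

definition down :: "real \<Rightarrow> real \<Rightarrow> complex" where
  "down x s = Complex x (exp (- s))"

lemma Im_down [simp]: "Im (down x s) = exp (- s)" and Re_down [simp]: "Re (down x s) = x"
  by (simp_all add: down_def)

text \<open>The isometry \<open>z \<mapsto> x - k / z\<close> sends 0 to infinity, infinity to
  \<open>x\<close> and 1 to \<open>x - k\<close>. Frames of this form show an edge leaving the cusp
  as a descending vertical, with \<open>k\<close> the width of the triangle on its right.\<close>

lemma down_imag_axis:
  assumes "0 < k" shows "of_real x - of_real k / imag_axis s = down x (s - ln k)"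
proof -
  have "of_real x - of_real k / imag_axis s = of_real x + (- of_real k / imag_axis s)" by simp
  then show ?thesis
    unfolding neg_inverse_imag_axis[OF assms] by (simp add: complex_eq_iff)
qed

lemma range_shift:
  fixes c :: "real \<Rightarrow> 'a"
  shows "range (\<lambda>s. c (s + r)) = range c" "range (\<lambda>s. c (r - s)) = range c"
proof -
  have "c s = c ((s - r) + r)" "c s = c (r - (r - s))" for s by simp_all
  then show "range (\<lambda>s. c (s + r)) = range c" "range (\<lambda>s. c (r - s)) = range c" by blast+
qed

lemma oriented_class_iff: "f \<in> oriented_class c \<longleftrightarrow> (\<exists>r. \<forall>s. f s = c (s + r))"
  by (auto simp: oriented_class_def fun_eq_iff)

lemma oriented_class_self: "c \<in> oriented_class c"
  unfolding oriented_class_iff by (rule exI[of _ 0]) simp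

lemma oriented_class_eqI:
  assumes "f \<in> oriented_class c" shows "oriented_class f = oriented_class c"
proof -
  obtain r where "\<And>s. f s = c (s + r)" using assms by (auto simp: oriented_class_iff)
  then have f: "f = (\<lambda>s. c (s + r))" by auto
  show ?thesis
  proof (intro set_eqI iffI)
    fix k assume "k \<in> oriented_class f"
    then obtain q where "\<And>s. k s = c (s + q + r)" by (auto simp: oriented_class_iff f)
    then show "k \<in> oriented_class c" unfolding oriented_class_iff by (intro exI[of _ "q + r"]) (simp add: add.assoc)
  next
    fix k assume "k \<in> oriented_class c"
    then obtain q where "\<And>s. k s = c (s + q)" by (auto simp: oriented_class_iff)
    then show "k \<in> oriented_class f" unfolding oriented_class_iff f by (intro exI[of _ "q - r"]) (simp add: algebra_simps)
  qed
qed

lemma edge_support_oriented_class: "edge_support (oriented_class c) = range c"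
proof -
  have "range f = range c" if f: "f \<in> oriented_class c" for f
  proof -
    obtain r where "f = (\<lambda>s. c (s + r))" using f unfolding oriented_class_def by blast
    then show ?thesis using range_shift(1)[of c r] by simp
  qed
  then show ?thesis using oriented_class_self[of c] unfolding edge_support_def by blast
qed

lemma tendsto_shift_real:
  fixes c :: "real \<Rightarrow> 'a::topological_space"
  assumes "(c \<longlongrightarrow> x) at_bot" "(c \<longlongrightarrow> x) at_top"
  shows "((\<lambda>s. c (s + r)) \<longlongrightarrow> x) at_bot" "((\<lambda>s. c (s + r)) \<longlongrightarrow> x) at_top"
    "((\<lambda>s. c (r - s)) \<longlongrightarrow> x) at_bot" "((\<lambda>s. c (r - s)) \<longlongrightarrow> x) at_top"
proof -
  have "filterlim (\<lambda>s. s + r) at_bot at_bot" "filterlim (\<lambda>s. s + r) at_top at_top"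
    "filterlim (\<lambda>s. r - s) at_top at_bot" "filterlim (\<lambda>s. r - s) at_bot at_top"
    by real_asymp+
  then show "((\<lambda>s. c (s + r)) \<longlongrightarrow> x) at_bot" "((\<lambda>s. c (s + r)) \<longlongrightarrow> x) at_top"
    "((\<lambda>s. c (r - s)) \<longlongrightarrow> x) at_bot" "((\<lambda>s. c (r - s)) \<longlongrightarrow> x) at_top"
    by (auto intro: filterlim_compose[OF assms(1)] filterlim_compose[OF assms(2)])
qed

lemma cusp_geodesic_shift:
  assumes "cusp_geodesic p x0 c" shows "cusp_geodesic p x0 (\<lambda>s. c (s + r))"
proof -
  obtain g where g: "g \<in> hyp_isometries" "c = p \<circ> g \<circ> imag_axis" and c: "inj c" "(c \<longlongrightarrow> x0) at_bot" "(c \<longlongrightarrow> x0) at_top"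
    using assms by (auto simp: cusp_geodesic_def)
  have "g \<circ> (\<lambda>z. of_real (exp r) * z) \<in> hyp_isometries"
    by (intro hyp_isometry_comp g hyp_isometry_scale) simp
  moreover have "(\<lambda>s. c (s + r)) = p \<circ> (g \<circ> (\<lambda>z. of_real (exp r) * z)) \<circ> imag_axis"
    by (simp add: g(2) fun_eq_iff imag_axis_shift)
  moreover have "inj (\<lambda>s. c (s + r))" using injD[OF c(1)] by (intro injI) fastforce
  ultimately show ?thesis using tendsto_shift_real[OF c(2,3)] unfolding cusp_geodesic_def by blast
qed

lemma cusp_geodesic_reverse:
  assumes "cusp_geodesic p x0 c" shows "cusp_geodesic p x0 (\<lambda>s. c (r - s))"
proof -
  obtain g where g: "g \<in> hyp_isometries" "c = p \<circ> g \<circ> imag_axis" and c: "inj c" "(c \<longlongrightarrow> x0) at_bot" "(c \<longlongrightarrow> x0) at_top"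
    using assms by (auto simp: cusp_geodesic_def)
  have "g \<circ> (\<lambda>z. - of_real (exp r) / z) \<in> hyp_isometries"
    by (intro hyp_isometry_comp g hyp_isometry_neg_inverse) simp
  moreover have "(\<lambda>s. c (r - s)) = p \<circ> (g \<circ> (\<lambda>z. - of_real (exp r) / z)) \<circ> imag_axis"
    using neg_inverse_imag_axis[of "exp r"] by (simp add: g(2) fun_eq_iff)
  moreover have "inj (\<lambda>s. c (r - s))" using injD[OF c(1)] by (intro injI) fastforce
  ultimately show ?thesis using tendsto_shift_real[OF c(2,3)] unfolding cusp_geodesic_def by blast
qed

text \<open>The part of \<open>ideal_triangulation\<close> that concerns edges alone. It also holds
  for a single cusp geodesic, so the local analysis of lifts can be applied to one edge at a
  time.\<close>

definition edge_family :: "(complex \<Rightarrow> 'a::t2_space) \<Rightarrow> 'a \<Rightarrow> 'a set set \<Rightarrow> bool" where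
  "edge_family p x0 T \<longleftrightarrow> finite T \<and> (\<forall>E\<in>T. \<exists>c. cusp_geodesic p x0 c \<and> E = range c) \<and> pairwise disjnt T"

lemma ideal_triangulation_edge_family: "ideal_triangulation p S x0 T \<Longrightarrow> edge_family p x0 T"
  by (simp add: ideal_triangulation_def edge_family_def)

lemma edge_family_single: "cusp_geodesic p x0 c \<Longrightarrow> edge_family p x0 {range c}"
  by (auto simp: edge_family_def)

context cusped_surface_with_horocycle
begin

abbreviation (input) down_edge :: "real \<Rightarrow> (real \<Rightarrow> 'a) set" where
  "down_edge x \<equiv> oriented_class (\<lambda>s. p (down x s))"

abbreviation (input) trace :: "(complex \<Rightarrow> complex) \<Rightarrow> 'a set" where
  "trace g \<equiv> range (\<lambda>s. p (g (imag_axis s)))"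

abbreviation (input) down_trace :: "real \<Rightarrow> 'a set" where
  "down_trace x \<equiv> range (\<lambda>s. p (down x s))"

text \<open>The backward end of the geodesic lies in the image of the horoball, and a deck
  transformation lifts one of its points above height \<open>h\<close>. From there backwards the
  lift cannot come down to height \<open>h\<close>, since a point of the horocycle would then also
  have a lift above \<open>h\<close>; so it ends at infinity.\<close>

lemma cusp_ray:
  assumes g: "g \<in> hyp_isometries" and lim: "((\<lambda>s. p (g (imag_axis s))) \<longlongrightarrow> x0) at_bot"
  obtains m x k where "deck m" "0 < k" "\<And>z. 0 < Im z \<Longrightarrow> m (g z) = of_real x - of_real k / z"
proof -
  obtain V where V: "open V" "x0 \<in> V" "V \<inter> S - {x0} \<subseteq> p ` {z. h < Im z}"
    by (rule punctured_neighbourhood) blast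
  have pos: "0 < Im (g (imag_axis s))" for s using hyp_isometry_Im_pos[OF g] by simp
  obtain s1 where s1: "\<And>s. s \<le> s1 \<Longrightarrow> p (g (imag_axis s)) \<in> V"
    using topological_tendstoD[OF lim V(1,2)] by (auto simp: eventually_at_bot_linorder)
  have in_cusp: "p (g (imag_axis s)) \<in> p ` {z. h < Im z}" if "s \<le> s1" for s
    using s1[OF that] p_in[OF pos] V(3) by blast
  obtain w where w: "h < Im w" "p (g (imag_axis s1)) = p w" using in_cusp[of s1] by auto
  obtain m where m: "deck m" "m (g (imag_axis s1)) = w"
    using deck_exists[OF w(2) pos] w(1) h_pos by auto
  have mg: "(\<lambda>z. m (g z)) \<in> hyp_isometries" using deck_isometry_comp m(1) g .
  have "h < Im (m (g (imag_axis s)))" if s: "s \<le> s1" for s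
  proof (rule ccontr)
    assume "\<not> h < Im (m (g (imag_axis s)))"
    have "\<exists>r. s \<le> r \<and> r \<le> s1 \<and> Im (m (g (imag_axis r))) = h"
    proof (rule IVT')
      show "continuous_on {s..s1} (\<lambda>r. Im (m (g (imag_axis r))))"
        by (intro continuous_intros continuous_on_compose2[OF continuous_on_hyp_isometry[OF mg] continuous_on_imag_axis]) auto
    qed (use \<open>\<not> h < _\<close> s m(2) w(1) in auto)
    then obtain r where r: "r \<le> s1" "Im (m (g (imag_axis r))) = h" by blast
    obtain v where v: "h < Im v" "p (g (imag_axis r)) = p v" using in_cusp[OF r(1)] by auto
    have "m (g (imag_axis r)) = Complex (Re (m (g (imag_axis r)))) h" using r(2) by (simp add: complex_eq_iff)
    then have "p v = p (Complex (Re (m (g (imag_axis r)))) h)"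
      using deckD(2)[OF m(1) pos[of r]] v(2) by simp
    then show False using horoball_disjoint_horocycle[OF v(1)] by blast
  qed
  then obtain x k where "0 < k" "\<And>z. 0 < Im z \<Longrightarrow> m (g z) = of_real x - of_real k / z"
    using hyp_isometry_zero_to_infinity[OF mg h_pos, of s1] by metis
  then show ?thesis using that m(1) by blast
qed

lemma cusp_geodesic_down:
  assumes "cusp_geodesic p x0 c"
  obtains x where "oriented_class c = down_edge x" "cusp_geodesic p x0 (\<lambda>s. p (down x s))"
proof -
  obtain g where g: "g \<in> hyp_isometries" "c = p \<circ> g \<circ> imag_axis" "(c \<longlongrightarrow> x0) at_bot"
    using assms by (auto simp: cusp_geodesic_def)
  obtain m x k where m: "deck m" "0 < k" "\<And>z. 0 < Im z \<Longrightarrow> m (g z) = of_real x - of_real k / z"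
    using cusp_ray[of g thesis] g unfolding comp_def by blast
  have c: "c s = p (down x (s - ln k))" for s
    using deckD(2)[OF m(1), of "g (imag_axis s)"] hyp_isometry_Im_pos[OF g(1)]
      m(3)[of "imag_axis s"] down_imag_axis[OF m(2), of x s] by (simp add: g(2))
  then have c': "p (down x s) = c (s + ln k)" for s by simp
  have "(\<lambda>s. p (down x s)) \<in> oriented_class c" unfolding oriented_class_iff using c' by blast
  moreover have "cusp_geodesic p x0 (\<lambda>s. p (down x s))" unfolding c' by (rule cusp_geodesic_shift[OF assms])
  ultimately show ?thesis using that oriented_class_eqI by metis
qed

lemma continuous_cusp_geodesic:
  assumes "cusp_geodesic p x0 c" shows "continuous_on A c" "c s \<in> S - {x0}"
proof -
  obtain g where g: "g \<in> hyp_isometries" "c = p \<circ> g \<circ> imag_axis"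
    using assms by (auto simp: cusp_geodesic_def)
  have pos: "0 < Im (g (imag_axis s))" for s using hyp_isometry_Im_pos[OF g(1)] by simp
  have "continuous_on A (\<lambda>s. p (g (imag_axis s)))"
    by (rule continuous_on_p_comp)
      (auto simp: pos intro: continuous_on_compose2[OF continuous_on_hyp_isometry[OF g(1)] continuous_on_imag_axis])
  then show "continuous_on A c" by (simp add: g(2) comp_def)
  show "c s \<in> S - {x0}" using p_in[OF pos] by (simp add: g(2))
qed

text \<open>A cusp geodesic is a proper curve in the punctured surface: away from \<open>x0\<close>
  only a compact parameter interval matters.\<close>

lemma cusp_geodesic_separation:
  assumes c: "cusp_geodesic p x0 c" and J: "closed J" and q: "q \<noteq> x0" "q \<notin> c ` J"
  obtains U where "open U" "q \<in> U" "U \<inter> c ` J = {}"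
proof -
  obtain V W where VW: "open V" "open W" "x0 \<in> V" "q \<in> W" "V \<inter> W = {}"
    using hausdorff[of x0 q] q(1) by metis
  have "(c \<longlongrightarrow> x0) at_bot" "(c \<longlongrightarrow> x0) at_top" using c by (auto simp: cusp_geodesic_def)
  then have "eventually (\<lambda>s. c s \<in> V) at_bot" "eventually (\<lambda>s. c s \<in> V) at_top"
    using VW(1,3) by (auto intro: topological_tendstoD)
  then obtain a b where ab: "\<And>s. s \<le> a \<Longrightarrow> c s \<in> V" "\<And>s. b \<le> s \<Longrightarrow> c s \<in> V"
    by (auto simp: eventually_at_bot_linorder eventually_at_top_linorder)
  let ?K = "c ` ({a..b} \<inter> J)"
  have "compact ?K"
    by (intro compact_continuous_image continuous_cusp_geodesic[OF c] compact_Int_closed J) simp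
  then have "open (W - ?K)" using VW(2) by (intro open_Diff compact_imp_closed)
  moreover have "q \<in> W - ?K" using VW(4) q(2) by blast
  moreover have "(W - ?K) \<inter> c ` J = {}"
  proof -
    have "c s \<notin> W - ?K" if "s \<in> J" for s
      using ab[of s] VW(5) that by (cases "s \<in> {a..b}") auto
    then show ?thesis by blast
  qed
  ultimately show ?thesis using that by blast
qed

text \<open>Near a point of a lifted edge the lifted edges form a single geodesic segment, since an edge is
  embedded and converges to the puncture at both ends.\<close>

lemma edge_lift_local:
  assumes T: "edge_family p x0 T" and g: "g \<in> hyp_isometries"
    and c: "cusp_geodesic p x0 (\<lambda>s. p (g (imag_axis s)))" "trace g \<in> T"
  obtains B where "open B" "g (imag_axis 0) \<in> B"
    "\<And>w. w \<in> B \<Longrightarrow> 0 < Im w" "\<And>w. w \<in> B \<Longrightarrow> p w \<in> \<Union>T \<Longrightarrow> \<exists>s. w = g (imag_axis s)"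
proof -
  let ?c = "\<lambda>s. p (g (imag_axis s))" and ?z = "g (imag_axis 0)"
  have pos: "0 < Im (g (imag_axis s))" for s using hyp_isometry_Im_pos[OF g] by simp
  have cont: "continuous_on UNIV (\<lambda>s. g (imag_axis s))"
    by (rule continuous_on_compose2[OF continuous_on_hyp_isometry[OF g] continuous_on_imag_axis]) auto
  obtain U where U: "open U" "?z \<in> U" "\<And>u. u \<in> U \<Longrightarrow> 0 < Im u" "inj_on p U"
    using locally_injective[OF pos] by blast
  have "open ((\<lambda>s. g (imag_axis s)) -` U)" using cont U(1) by (rule open_vimage[rotated])
  then obtain e where e: "0 < e" "\<And>s. \<bar>s\<bar> < e \<Longrightarrow> g (imag_axis s) \<in> U"
    using U(2) unfolding open_dist by (force simp: dist_real_def)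
  have "?c 0 \<notin> ?c ` {s. e \<le> \<bar>s\<bar>}"
    using c(1) e(1) unfolding cusp_geodesic_def by (auto dest: injD)
  moreover have "closed {s::real. e \<le> \<bar>s\<bar>}" by (intro closed_Collect_le continuous_intros)
  moreover have x0: "?c 0 \<noteq> x0" using p_in[OF pos] by blast
  ultimately obtain W where W: "open W" "?c 0 \<in> W" "W \<inter> ?c ` {s. e \<le> \<bar>s\<bar>} = {}"
    using cusp_geodesic_separation[OF c(1)] by blast
  have "\<exists>Z. open Z \<and> ?c 0 \<in> Z \<and> Z \<inter> E = {}" if E: "E \<in> T - {range ?c}" for E
  proof -
    obtain f where f: "cusp_geodesic p x0 f" "E = range f" using T E unfolding edge_family_def by blast
    have "disjnt E (range ?c)" using T E c(2) by (auto simp: edge_family_def pairwise_def)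
    then have "?c 0 \<notin> f ` UNIV" using f(2) by (auto simp: disjnt_iff)
    then show ?thesis using cusp_geodesic_separation[OF f(1) closed_UNIV x0] f(2) by metis
  qed
  then obtain Z where Z: "\<And>E. E \<in> T - {range ?c} \<Longrightarrow> open (Z E) \<and> ?c 0 \<in> Z E \<and> Z E \<inter> E = {}"
    by metis
  define Y where "Y = W \<inter> (\<Inter>E\<in>T - {range ?c}. Z E)"
  have Y: "open Y" "?c 0 \<in> Y" unfolding Y_def
    using W Z T by (auto simp: edge_family_def intro!: open_Int open_INT)
  define B where "B = U \<inter> p -` Y"
  have "continuous_on U p" using continuous_on_p by (rule continuous_on_subset) (use U(3) in auto)
  then have "open B" unfolding B_def Int_commute[of U]
    using U(1) Y(1) continuous_on_open_vimage[of U p] by blast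
  moreover have "?z \<in> B" using U(2) Y(2) by (simp add: B_def)
  moreover have "\<exists>s. w = g (imag_axis s)" if w: "w \<in> B" "p w \<in> \<Union>T" for w
  proof -
    obtain E where E: "E \<in> T" "p w \<in> E" using w(2) by blast
    have "E = range ?c" using E w(1) Z[of E] by (auto simp: B_def Y_def)
    then obtain s where s: "p w = ?c s" using E(2) by blast
    have "\<bar>s\<bar> < e"
    proof (rule ccontr)
      assume "\<not> \<bar>s\<bar> < e"
      then have "p w \<in> ?c ` {s. e \<le> \<bar>s\<bar>}" using s by auto
      then show False using w(1) W(3) by (auto simp: B_def Y_def)
    qed
    then have "w = g (imag_axis s)"
      using inj_onD[OF U(4) s] w(1) e(2) by (auto simp: B_def)
    then show ?thesis by blast
  qed
  ultimately show ?thesis using that[of B] U(3) by (auto simp: B_def)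
qed

text \<open>Choose a lift \<open>g\<close> of the edge through the initial point of
  \<open>f\<close>. Near this point no other part of the edge is lifted, so the geodesic of
  \<open>f\<close> follows that of \<open>g\<close> on an interval. The transition isometry maps two
  axis points to the axis, hence is a scaling or an inversion: the same edge, shifted or
  reversed.\<close>

lemma geodesic_in_edge:
  assumes c: "cusp_geodesic p x0 c" and f: "f \<in> hyp_isometries"
    and sub: "trace f \<subseteq> range c"
  obtains r where "\<And>s. p (f (imag_axis s)) = c (s + r)" | r where "\<And>s. p (f (imag_axis s)) = c (r - s)"
proof -
  have posf: "0 < Im (f (imag_axis s))" for s using hyp_isometry_Im_pos[OF f] by simp
  obtain r where r: "p (f (imag_axis 0)) = c r" using sub by blast
  obtain g0 where g0: "g0 \<in> hyp_isometries" "c = p \<circ> g0 \<circ> imag_axis"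
    using c by (auto simp: cusp_geodesic_def)
  define g1 where "g1 = g0 \<circ> (\<lambda>z. of_real (exp r) * z)"
  have g1: "g1 \<in> hyp_isometries" unfolding g1_def by (intro hyp_isometry_comp g0 hyp_isometry_scale) simp
  have pg1: "p (g1 (imag_axis s)) = c (s + r)" for s by (simp add: g1_def g0(2) imag_axis_shift)
  have posg1: "0 < Im (g1 (imag_axis s))" for s using hyp_isometry_Im_pos[OF g1] by simp
  obtain m where m: "deck m" "m (g1 (imag_axis 0)) = f (imag_axis 0)"
    using deck_exists[of "g1 (imag_axis 0)" "f (imag_axis 0)"] pg1[of 0] r posf posg1 by auto
  define g where "g = (\<lambda>z. m (g1 z))"
  have g: "g \<in> hyp_isometries" unfolding g_def using deck_isometry_comp m(1) g1 .
  have pg: "p (g (imag_axis s)) = c (s + r)" for s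
    using deckD(2)[OF m(1) posg1] pg1 by (simp add: g_def)
  obtain B where B: "open B" "g (imag_axis 0) \<in> B" "\<And>w. w \<in> B \<Longrightarrow> p w \<in> \<Union>{range c} \<Longrightarrow> \<exists>s. w = g (imag_axis s)"
  proof (rule edge_lift_local[OF edge_family_single[OF c] g])
    show "cusp_geodesic p x0 (\<lambda>s. p (g (imag_axis s)))" unfolding pg by (rule cusp_geodesic_shift[OF c])
    show "trace g \<in> {range c}" unfolding pg range_shift by simp
  qed blast
  obtain k where k: "k \<in> hyp_isometries" "\<And>z. 0 < Im z \<Longrightarrow> k (g z) = z" "\<And>z. 0 < Im z \<Longrightarrow> g (k z) = z"
    using hyp_isometry_inverse[OF g] by blast
  have kf: "k \<circ> f \<in> hyp_isometries" using hyp_isometry_comp k(1) f .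
  have "open ((\<lambda>s. f (imag_axis s)) -` B)"
    by (rule open_vimage[OF B(1)], rule continuous_on_compose2[OF continuous_on_hyp_isometry[OF f] continuous_on_imag_axis]) auto
  moreover have "0 \<in> (\<lambda>s. f (imag_axis s)) -` B" using B(2) m(2) by (simp add: g_def)
  ultimately obtain e where e: "0 < e" "\<And>s. \<bar>s\<bar> < e \<Longrightarrow> f (imag_axis s) \<in> B"
    unfolding open_dist by (force simp: dist_real_def)
  have Re: "Re ((k \<circ> f) (imag_axis s)) = 0" if s: "\<bar>s\<bar> < e" for s
  proof -
    obtain q where "f (imag_axis s) = g (imag_axis q)" using B(3)[OF e(2)[OF s]] sub by blast
    then show ?thesis using k(2)[of "imag_axis q"] by simp
  qed
  have fk: "f (imag_axis s) = g ((k \<circ> f) (imag_axis s))" for s using k(3)[OF posf] by simp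
  show ?thesis
  proof (rule hyp_isometry_imag_axis_cases[OF kf Re Re])
    show "\<bar>0\<bar> < e" "\<bar>e / 2\<bar> < e" "0 \<noteq> e / 2" using e(1) by auto
  next
    fix l :: real assume l: "0 < l" "\<And>z. 0 < Im z \<Longrightarrow> (k \<circ> f) z = of_real l * z"
    have "p (f (imag_axis s)) = c (s + (ln l + r))" for s
    proof -
      have "f (imag_axis s) = g (imag_axis (s + ln l))"
        unfolding fk[of s] l(2)[of "imag_axis s", simplified Im_imag_axis, OF exp_gt_zero] imag_axis_shift using l(1) by simp
      then show ?thesis using pg by (simp add: add.assoc)
    qed
    then show ?thesis using that(1) by blast
  next
    fix l :: real assume l: "0 < l" "\<And>z. 0 < Im z \<Longrightarrow> (k \<circ> f) z = - of_real l / z"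
    have "p (f (imag_axis s)) = c (ln l + r - s)" for s
    proof -
      have "f (imag_axis s) = g (imag_axis (ln l - s))"
        unfolding fk[of s] l(2)[of "imag_axis s", simplified Im_imag_axis, OF exp_gt_zero] neg_inverse_imag_axis[OF l(1)] ..
      then show ?thesis using pg by (simp add: algebra_simps)
    qed
    then show ?thesis using that(2) by blast
  qed
qed

lemma edge_family_cusp_geodesic:
  assumes "edge_family p x0 T" "f \<in> hyp_isometries" "trace f \<in> T"
  shows "cusp_geodesic p x0 (\<lambda>s. p (f (imag_axis s)))"
proof -
  obtain c where c: "cusp_geodesic p x0 c" "trace f = range c"
    using assms by (auto simp: edge_family_def)
  show ?thesis
    using geodesic_in_edge[OF c(1) assms(2)] c(2) cusp_geodesic_shift[OF c(1)] cusp_geodesic_reverse[OF c(1)]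
    by (metis (no_types, lifting) ext subset_refl)
qed

end

section \<open>Frames of an ideal triangulation\<close>

context cusped_surface_with_horocycle
begin

text \<open>A strengthening of \<open>right_frame\<close> with an embedded triangle and all three
  sides in \<open>T\<close>, as supplied by \<open>ideal_triangulation\<close>. By
  \<open>frame_unique\<close> the two notions agree up to deck transformations once an edge has a
  frame.\<close>

definition frame :: "'a set set \<Rightarrow> (complex \<Rightarrow> complex) \<Rightarrow> bool" where
  "frame T g \<longleftrightarrow> g \<in> hyp_isometries \<and> inj_on p (g ` std_triangle) \<and>
     p ` g ` std_triangle \<in> components (S - {x0} - \<Union>T) \<and>
     trace g \<in> T \<and>
     range (\<lambda>s. p (g (tri_rot (imag_axis s)))) \<in> T \<and>
     range (\<lambda>s. p (g (tri_rot (tri_rot (imag_axis s))))) \<in> T"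

lemma frame_isometry: "frame T g \<Longrightarrow> g \<in> hyp_isometries"
  by (simp add: frame_def)

lemma frame_Im_pos: "frame T g \<Longrightarrow> 0 < Im z \<Longrightarrow> 0 < Im (g z)"
  using frame_isometry hyp_isometry_Im_pos by blast

lemma Im_tri_rot_pos: "0 < Im z \<Longrightarrow> 0 < Im (tri_rot z)"
  using hyp_isometry_Im_pos[OF hyp_isometry_tri_rot] .

lemma frame_cong:
  assumes "frame T g" "\<And>z. 0 < Im z \<Longrightarrow> f z = g z"
  shows "frame T f"
proof -
  have "f ` std_triangle = g ` std_triangle"
    by (rule image_cong) (use assms(2) in \<open>auto simp: std_triangle_iff\<close>)
  moreover have "f \<in> hyp_isometries" by (rule hyp_isometry_cong[OF frame_isometry[OF assms(1)] assms(2)])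
  moreover have "f (imag_axis s) = g (imag_axis s)" "f (tri_rot (imag_axis s)) = g (tri_rot (imag_axis s))"
    "f (tri_rot (tri_rot (imag_axis s))) = g (tri_rot (tri_rot (imag_axis s)))" for s
    by (auto intro!: assms(2) Im_tri_rot_pos)
  ultimately show ?thesis using assms(1) by (simp add: frame_def)
qed

lemma frame_rotate: "frame T g \<Longrightarrow> frame T (\<lambda>z. g (tri_rot z))"
  using hyp_isometry_comp[OF _ hyp_isometry_tri_rot, of g] tri_rot_image_std_triangle
  unfolding frame_def by (simp add: tri_rot_cubed comp_def flip: image_image[of g tri_rot])

lemma frame_deck:
  assumes m: "deck m" and g: "frame T g"
  shows "frame T (\<lambda>z. m (g z))"
proof -
  have pm: "p (m (g z)) = p (g z)" if "0 < Im z" for z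
    using deckD(2)[OF m] frame_Im_pos[OF g that] .
  have 1: "(\<lambda>z. m (g z)) \<in> hyp_isometries" using deck_isometry_comp[OF m frame_isometry[OF g]] .
  have 2: "p ` (\<lambda>z. m (g z)) ` std_triangle = p ` g ` std_triangle"
    unfolding image_image by (rule image_cong) (auto simp: pm std_triangle_iff)
  have 3: "inj_on p ((\<lambda>z. m (g z)) ` std_triangle)"
  proof (rule inj_onI, clarify)
    fix u v assume uv: "u \<in> std_triangle" "v \<in> std_triangle" "p (m (g u)) = p (m (g v))"
    then have "p (g u) = p (g v)" by (simp add: pm std_triangle_iff)
    then have "g u = g v" using g uv by (auto simp: frame_def dest: inj_onD)
    then show "m (g u) = m (g v)" by simp
  qed
  show ?thesis using g 1 2 3 by (simp add: frame_def pm Im_tri_rot_pos)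
qed

lemma component_frame:
  assumes "ideal_triangulation p S x0 T" "C \<in> components (S - {x0} - \<Union>T)"
  obtains g where "frame T g" "C = p ` g ` std_triangle"
proof -
  have "\<exists>g\<in>hyp_isometries. inj_on p (g ` std_triangle) \<and> C = p ` g ` std_triangle \<and>
        range (p \<circ> g \<circ> imag_axis) \<in> T \<and> range (p \<circ> g \<circ> tri_rot \<circ> imag_axis) \<in> T \<and>
        range (p \<circ> g \<circ> tri_rot \<circ> tri_rot \<circ> imag_axis) \<in> T"
    using assms by (simp add: ideal_triangulation_def)
  then show ?thesis using assms(2) that by (auto simp: frame_def comp_def)
qed

lemma frame_interior: "frame T g \<Longrightarrow> z \<in> std_triangle \<Longrightarrow> p (g z) \<notin> \<Union>T"
  using in_components_subset[of "p ` g ` std_triangle" "S - {x0} - \<Union>T"] by (auto simp: frame_def)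

text \<open>The indices cross because \<open>tri_rot\<close> has order three: if
  \<open>tri_rot z\<close> is on the axis, then \<open>z\<close> is obtained from an axis point by
  applying \<open>tri_rot\<close> twice.\<close>

lemma frame_side:
  assumes g: "frame T g" and z: "0 < Im z"
  shows "Re z = 0 \<Longrightarrow> p (g z) \<in> trace g"
    "Re (tri_rot z) = 0 \<Longrightarrow> p (g z) \<in> range (\<lambda>s. p (g (tri_rot (tri_rot (imag_axis s)))))"
    "Re (tri_rot (tri_rot z)) = 0 \<Longrightarrow> p (g z) \<in> range (\<lambda>s. p (g (tri_rot (imag_axis s))))"
proof -
  show "p (g z) \<in> trace g" if "Re z = 0"
    using Re_eq_0_imag_axis[OF z that] by (metis rangeI)
  show "p (g z) \<in> range (\<lambda>s. p (g (tri_rot (tri_rot (imag_axis s)))))" if "Re (tri_rot z) = 0"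
  proof -
    have "tri_rot z = imag_axis (ln (Im (tri_rot z)))"
      using Re_eq_0_imag_axis[OF Im_tri_rot_pos[OF z] that] .
    then have "z = tri_rot (tri_rot (imag_axis (ln (Im (tri_rot z)))))" using tri_rot_cubed[OF z] by metis
    then show ?thesis by (metis rangeI)
  qed
  show "p (g z) \<in> range (\<lambda>s. p (g (tri_rot (imag_axis s))))" if "Re (tri_rot (tri_rot z)) = 0"
  proof -
    have "tri_rot (tri_rot z) = imag_axis (ln (Im (tri_rot (tri_rot z))))"
      using Re_eq_0_imag_axis[OF Im_tri_rot_pos[OF Im_tri_rot_pos[OF z]] that] .
    then have "z = tri_rot (imag_axis (ln (Im (tri_rot (tri_rot z)))))" using tri_rot_cubed[OF z] by metis
    then show ?thesis by (metis rangeI)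
  qed
qed

lemma frame_side_mem:
  assumes "frame T g" "0 < Im z" "Re z = 0 \<or> Re (tri_rot z) = 0 \<or> Re (tri_rot (tri_rot z)) = 0"
  shows "p (g z) \<in> \<Union>T"
  using assms frame_side[OF assms(1,2)] unfolding frame_def by blast

text \<open>Sides of the lifted triangle project into edges, so a connected set over the complement
  of the edges cannot leave the triangle.\<close>

lemma frame_contains_connected:
  assumes g: "frame T g" and N: "connected N" "\<And>z. z \<in> N \<Longrightarrow> 0 < Im z" "\<And>z. z \<in> N \<Longrightarrow> p z \<notin> \<Union>T"
    and meet: "N \<inter> g ` std_triangle \<noteq> {}"
  shows "N \<subseteq> g ` std_triangle"
proof -
  obtain k where k: "k \<in> hyp_isometries" "\<And>z. 0 < Im z \<Longrightarrow> k (g z) = z" "\<And>z. 0 < Im z \<Longrightarrow> g (k z) = z"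
    using hyp_isometry_inverse[OF frame_isometry[OF g]] by blast
  have "k ` N \<subseteq> std_triangle"
  proof (rule connected_subset_std_triangle)
    show "connected (k ` N)"
      by (rule connected_continuous_image[OF continuous_on_subset[OF continuous_on_hyp_isometry[OF k(1)]] N(1)])
        (use N(2) in auto)
    show pos: "0 < Im z" if "z \<in> k ` N" for z using that N(2) hyp_isometry_Im_pos[OF k(1)] by auto
    obtain z where "g z \<in> N" "z \<in> std_triangle" using meet by auto
    then have "z \<in> k ` N \<inter> std_triangle" using k(2)[of z] by (force simp: std_triangle_iff)
    then show "k ` N \<inter> std_triangle \<noteq> {}" by blast
    have no: "p (g z) \<notin> \<Union>T" if "z \<in> k ` N" for z using that k(3) N(2,3) by auto
    show "Re z \<noteq> 0" "Re (tri_rot z) \<noteq> 0" "Re (tri_rot (tri_rot z)) \<noteq> 0" if "z \<in> k ` N" for z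
      using no[OF that] frame_side_mem[OF g pos[OF that]] by auto
  qed
  show ?thesis
  proof
    fix z assume z: "z \<in> N"
    then have "z = g (k z)" using k(3) N(2) by simp
    then show "z \<in> g ` std_triangle" using \<open>k ` N \<subseteq> std_triangle\<close> z by blast
  qed
qed

lemma frame_image_connected:
  assumes "g \<in> hyp_isometries" shows "connected (g ` std_triangle)"
  by (intro connected_continuous_image connected_std_triangle
      continuous_on_subset[OF continuous_on_hyp_isometry[OF assms]] std_triangle_subset)

text \<open>Each lifted triangle is itself a connected set over the complement of the edges, so the
  previous containment applies in both directions.\<close>

lemma frame_image_eq:
  assumes f: "frame T f" and g: "frame T g" and meet: "f ` std_triangle \<inter> g ` std_triangle \<noteq> {}"
  shows "f ` std_triangle = g ` std_triangle"
proof -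
  have "f ` std_triangle \<subseteq> g ` std_triangle" if f: "frame T f" and g: "frame T g" and "f ` std_triangle \<inter> g ` std_triangle \<noteq> {}" for f g
    by (rule frame_contains_connected[OF g frame_image_connected[OF frame_isometry[OF f]]])
      (use that frame_interior[OF f] frame_Im_pos[OF f] in \<open>auto simp: std_triangle_iff\<close>)
  from this[OF f g meet] this[OF g f] meet show ?thesis by blast
qed

text \<open>A half ball on the right of a lifted edge lies in a lifted triangle, and the edge is one of the
  three sides of this triangle since the lifted edges form a single geodesic in the ball.\<close>

lemma frame_exists:
  assumes T: "ideal_triangulation p S x0 T" and g: "g \<in> hyp_isometries" "trace g \<in> T"
  obtains l where "0 < l" "frame T (\<lambda>z. g (of_real l * z))"
proof -
  have ef: "edge_family p x0 T" using ideal_triangulation_edge_family[OF T] .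
  have pos: "0 < Im (g z)" if "0 < Im z" for z using hyp_isometry_Im_pos[OF g(1) that] .
  obtain B where B: "open B" "g (imag_axis 0) \<in> B" "\<And>w. w \<in> B \<Longrightarrow> 0 < Im w"
      "\<And>w. w \<in> B \<Longrightarrow> p w \<in> \<Union>T \<Longrightarrow> \<exists>s. w = g (imag_axis s)"
    using edge_lift_local[OF ef g(1) edge_family_cusp_geodesic[OF ef g] g(2)] by blast
  obtain g' where g': "g' \<in> hyp_isometries" "\<And>z. 0 < Im z \<Longrightarrow> g' (g z) = z" "\<And>z. 0 < Im z \<Longrightarrow> g (g' z) = z"
    using hyp_isometry_inverse[OF g(1)] by blast
  have oU: "open upper_half_plane" unfolding upper_half_plane_def by (rule open_halfspace_Im_gt)
  have "open (upper_half_plane \<inter> g -` B)"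
    using continuous_on_open_vimage[OF oU, of g] continuous_on_hyp_isometry[OF g(1)] B(1)
    by (metis Int_commute)
  moreover have "imag_axis 0 \<in> upper_half_plane \<inter> g -` B" using B(2) by simp
  ultimately obtain e where e: "0 < e" "ball (imag_axis 0) e \<subseteq> upper_half_plane \<inter> g -` B"
    using open_contains_ball by blast
  have on_axis: "Re w = 0" if w: "w \<in> ball (imag_axis 0) e" "p (g w) \<in> \<Union>T" for w
  proof -
    have "0 < Im w" "g w \<in> B" using w(1) e(2) by auto
    then obtain s where "g w = g (imag_axis s)" using B(4)[OF _ w(2)] by blast
    then have "w = imag_axis s"
      using g'(2)[OF \<open>0 < Im w\<close>] g'(2)[of "imag_axis s"] by (metis Im_imag_axis exp_gt_zero)
    then show ?thesis by simp
  qed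
  define N where "N = ball (imag_axis 0) e \<inter> {w. 0 < Re w}"
  have Npos: "0 < Im w" if "w \<in> N" for w using that e(2) by (auto simp: N_def)
  have Nconn: "connected N" unfolding N_def
    by (intro convex_connected convex_Int convex_ball convex_halfspace_Re_gt)
  have gNconn: "connected (g ` N)"
    by (rule connected_continuous_image[OF continuous_on_subset[OF continuous_on_hyp_isometry[OF g(1)]] Nconn])
      (use Npos in auto)
  have NT: "p (g w) \<notin> \<Union>T" if "w \<in> N" for w using on_axis[of w] that by (auto simp: N_def)
  define w0 where "w0 = imag_axis 0 + of_real (e / 2)"
  have w0: "w0 \<in> N" using e(1) by (auto simp: N_def w0_def dist_norm)
  have "connected (p ` g ` N)"
    by (rule connected_continuous_image[OF continuous_on_subset[OF continuous_on_p] gNconn])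
      (use Npos pos in auto)
  moreover have "p ` g ` N \<subseteq> S - {x0} - \<Union>T"
    unfolding image_image by (rule image_subsetI) (intro DiffI[of _ "S - {x0}"] p_in pos Npos NT)
  ultimately obtain C where C: "C \<in> components (S - {x0} - \<Union>T)" "p ` g ` N \<subseteq> C"
    using exists_component_superset[of "p ` g ` N" "S - {x0} - \<Union>T"] w0 by blast
  obtain g1 where g1: "frame T g1" "C = p ` g1 ` std_triangle" using component_frame[OF T C(1)] .
  obtain v where v: "v \<in> std_triangle" "p (g w0) = p (g1 v)" using C(2) w0 g1(2) by blast
  obtain m where m: "deck m" "m (g1 v) = g w0"
    by (rule deck_exists[OF v(2)[symmetric]])
      (use v(1) pos[OF Npos[OF w0]] frame_Im_pos[OF g1(1)] in \<open>auto simp: std_triangle_iff\<close>)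
  define g2 where "g2 = (\<lambda>z. m (g1 z))"
  have g2: "frame T g2" unfolding g2_def using frame_deck m(1) g1(1) .
  have "g w0 \<in> g ` N \<inter> g2 ` std_triangle" using w0 v(1) m(2) unfolding g2_def by (metis IntI imageI)
  then have sub: "g ` N \<subseteq> g2 ` std_triangle"
    by (intro frame_contains_connected[OF g2 gNconn]) (use Npos pos NT in auto)
  obtain k0 where k0: "k0 \<in> hyp_isometries" "\<And>z. 0 < Im z \<Longrightarrow> k0 (g2 z) = z" "\<And>z. 0 < Im z \<Longrightarrow> g2 (k0 z) = z"
    using hyp_isometry_inverse[OF frame_isometry[OF g2]] by blast
  define k where "k = (\<lambda>z. k0 (g z))"
  have k: "k \<in> hyp_isometries" unfolding k_def using hyp_isometry_comp[OF k0(1) g(1)] by (simp add: comp_def)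
  have g2k: "g2 (k z) = g z" if "0 < Im z" for z unfolding k_def using k0(3) pos that by blast
  have kN: "k w \<in> std_triangle" if w: "w \<in> N" for w
  proof -
    obtain u where "u \<in> std_triangle" "g w = g2 u" using sub w by blast
    then show ?thesis using k0(2)[of u] by (simp add: k_def std_triangle_iff)
  qed
  \<comment> \<open>The half ball accumulates at the axis point, so this point lies in the closure
    of the triangle; as it projects into an edge, it lies on a side.\<close>
  have "k (imag_axis 0) \<in> closure (k ` N)"
  proof -
    have "continuous (at (imag_axis 0)) k"
      using continuous_on_hyp_isometry[OF k] oU by (simp add: continuous_on_eq_continuous_at)
    moreover have "(\<lambda>n. imag_axis 0 + of_real (e / (real n + 2))) \<longlonglongrightarrow> imag_axis 0"
    proof -
      have "(\<lambda>n. e / (real n + 2)) \<longlonglongrightarrow> 0" by real_asymp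
      then have "(\<lambda>n. imag_axis 0 + of_real (e / (real n + 2))) \<longlonglongrightarrow> imag_axis 0 + of_real 0"
        by (intro tendsto_intros)
      then show ?thesis by simp
    qed
    ultimately have lim: "(\<lambda>n. k (imag_axis 0 + of_real (e / (real n + 2)))) \<longlonglongrightarrow> k (imag_axis 0)"
      by (rule isCont_tendsto_compose)
    have "imag_axis 0 + of_real (e / (real n + 2)) \<in> N" for n
    proof -
      have "e / (real n + 2) < e" using e(1) by (simp add: field_simps add_pos_nonneg)
      then show ?thesis using e(1) by (simp add: N_def dist_norm del: of_real_divide)
    qed
    then have "\<forall>n. k (imag_axis 0 + of_real (e / (real n + 2))) \<in> k ` N" by blast
    then show ?thesis using lim closure_sequential by (metis (no_types, lifting))
  qed
  then have kcl: "k (imag_axis 0) \<in> closure std_triangle"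
    using closure_mono[of "k ` N" std_triangle] kN by blast
  have kpos: "0 < Im (k z)" if "0 < Im z" for z using hyp_isometry_Im_pos[OF k that] .
  have "p (g2 (k (imag_axis 0))) \<in> \<Union>T" using g2k[of "imag_axis 0"] g(2)
    by (metis (mono_tags, lifting) Im_imag_axis UnionI exp_gt_zero rangeI)
  then have "k (imag_axis 0) \<notin> std_triangle" using frame_interior[OF g2] by blast
  then have sides: "Re (k (imag_axis 0)) = 0 \<or> Re (tri_rot (k (imag_axis 0))) = 0 \<or> Re (tri_rot (tri_rot (k (imag_axis 0)))) = 0"
    using std_triangle_boundary[OF kcl] kpos by simp
  \<comment> \<open>Rotating the frame turns whichever side carries the point into the first
    one.\<close>
  obtain g3 k3 where g3: "frame T g3" and k3: "k3 \<in> hyp_isometries" "\<And>z. 0 < Im z \<Longrightarrow> g3 (k3 z) = g z"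
      "\<And>w. w \<in> N \<Longrightarrow> k3 w \<in> std_triangle" "Re (k3 (imag_axis 0)) = 0"
  proof -
    have rk: "(\<lambda>z. tri_rot (k z)) \<in> hyp_isometries" "(\<lambda>z. tri_rot (tri_rot (k z))) \<in> hyp_isometries"
      using hyp_isometry_comp[OF hyp_isometry_tri_rot k]
        hyp_isometry_comp[OF hyp_isometry_tri_rot hyp_isometry_comp[OF hyp_isometry_tri_rot k]]
      by (auto simp: comp_def)
    note fr = frame_rotate[OF g2] frame_rotate[OF frame_rotate[OF g2]]
    consider "Re (k (imag_axis 0)) = 0" | "Re (tri_rot (k (imag_axis 0))) = 0"
      | "Re (tri_rot (tri_rot (k (imag_axis 0)))) = 0" using sides by blast
    then show ?thesis
    proof cases
      case 1 then show ?thesis using that[OF g2 k g2k kN] by blast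
    next
      case 2
      show ?thesis
        by (rule that[OF fr(2) rk(1)]) (use 2 g2k kN tri_rot_cubed kpos tri_rot_std_triangle in auto)
    next
      case 3
      show ?thesis
        by (rule that[OF fr(1) rk(2)]) (use 3 g2k kN tri_rot_cubed kpos tri_rot_std_triangle in auto)
    qed
  qed
  obtain l where l: "l \<in> hyp_isometries" "\<And>z. 0 < Im z \<Longrightarrow> l (k3 z) = z" "\<And>z. 0 < Im z \<Longrightarrow> k3 (l z) = z"
    using hyp_isometry_inverse[OF k3(1)] by blast
  have gl: "g3 z = g (l z)" if "0 < Im z" for z
    using k3(2)[of "l z"] l(3)[OF that] hyp_isometry_Im_pos[OF l(1) that] by simp
  obtain s0 where s0: "k3 (imag_axis 0) = imag_axis s0"
    using Re_eq_0_imag_axis[OF hyp_isometry_Im_pos[OF k3(1)] k3(4)] by auto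
  have ls0: "l (imag_axis s0) = imag_axis 0" using l(2)[of "imag_axis 0"] s0 by simp
  have "open ((\<lambda>s. l (imag_axis s)) -` ball (imag_axis 0) e)"
    by (rule open_vimage[OF open_ball], rule continuous_on_compose2[OF continuous_on_hyp_isometry[OF l(1)] continuous_on_imag_axis]) auto
  moreover have "s0 \<in> (\<lambda>s. l (imag_axis s)) -` ball (imag_axis 0) e" using ls0 e(1) by simp
  ultimately obtain r where r: "0 < r" "\<And>s. \<bar>s - s0\<bar> < r \<Longrightarrow> l (imag_axis s) \<in> ball (imag_axis 0) e"
    unfolding open_dist by (force simp: dist_real_def)
  have Rel: "Re (l (imag_axis s)) = 0" if "\<bar>s - s0\<bar> < r" for s
  proof (rule on_axis[OF r(2)[OF that]])
    show "p (g (l (imag_axis s))) \<in> \<Union>T"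
      using gl[of "imag_axis s"] frame_side_mem[OF g3, of "imag_axis s"] by simp
  qed
  show ?thesis
  proof (rule hyp_isometry_imag_axis_cases[OF l(1) Rel Rel])
    show "\<bar>s0 - s0\<bar> < r" "\<bar>(s0 + r / 2) - s0\<bar> < r" "s0 \<noteq> s0 + r / 2" using r(1) by auto
  next
    fix q :: real assume q: "0 < q" "\<And>z. 0 < Im z \<Longrightarrow> l z = of_real q * z"
    have "frame T (\<lambda>z. g (of_real q * z))" by (rule frame_cong[OF g3]) (use gl q in auto)
    then show ?thesis using that q(1) by blast
  next
    fix q :: real assume q: "0 < q" "\<And>z. 0 < Im z \<Longrightarrow> l z = - of_real q / z"
    \<comment> \<open>Inversion would put the triangle on the left of the edge, while
      \<open>w0\<close> was chosen on its right.\<close>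
    have k: "0 < Re (k3 w0)" "0 < Im (k3 w0)" using k3(3)[OF w0] by (auto simp: std_triangle_iff)
    have "w0 = - of_real q / k3 w0" using l(2)[OF Npos[OF w0]] q(2)[OF k(2)] by simp
    then have "Re w0 = Re (- of_real q / k3 w0)" by (rule arg_cong)
    also have "\<dots> = - (q * Re (k3 w0)) / ((Re (k3 w0))\<^sup>2 + (Im (k3 w0))\<^sup>2)"
      by (simp add: Re_divide)
    finally have "Re w0 = - (q * Re (k3 w0)) / ((Re (k3 w0))\<^sup>2 + (Im (k3 w0))\<^sup>2)" .
    moreover have "0 < (Re (k3 w0))\<^sup>2 + (Im (k3 w0))\<^sup>2" using k by (simp add: add_pos_pos)
    ultimately have "Re w0 < 0" using q(1) k by (simp add: divide_neg_pos)
    then show ?thesis using w0 by (simp add: N_def)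
  qed
qed

text \<open>The oriented edge leaves only a scaling by \<open>l\<close> along the axis, which moves
  the third vertex of the triangle from 1 to \<open>l\<close>. For \<open>l \<noteq> 1\<close> the
  triangle of \<open>f\<close> would contain points of another side of the triangle of
  \<open>g\<close>.\<close>

lemma frame_unique:
  assumes g: "frame T g" and f: "f \<in> hyp_isometries"
    and edge: "(\<lambda>s. p (f (imag_axis s))) \<in> oriented_class (\<lambda>s. p (g (imag_axis s)))"
    and tri: "\<And>z. z \<in> std_triangle \<Longrightarrow> p (f z) \<notin> \<Union>T"
  obtains m where "deck m" "\<And>z. 0 < Im z \<Longrightarrow> m (g z) = f z"
proof -
  obtain r where r: "\<And>s. p (f (imag_axis s)) = p (g (imag_axis (s + r)))"
    using edge by (auto simp: oriented_class_iff)
  define l where "l = exp r"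
  have l: "0 < l" by (simp add: l_def)
  have gl: "(\<lambda>z. g (of_real l * z)) \<in> hyp_isometries"
    using hyp_isometry_comp[OF frame_isometry[OF g] hyp_isometry_scale[OF l]] by (simp add: comp_def)
  obtain m where m: "deck m" "\<And>z. 0 < Im z \<Longrightarrow> m (g (of_real l * z)) = f z"
    using geodesic_lift[OF gl f] r by (auto simp: imag_axis_shift l_def)
  have no: "p (g w) \<notin> \<Union>T" if w: "of_real (1 / l) * w \<in> std_triangle" for w
  proof -
    let ?u = "of_real (1 / l) * w"
    have u: "0 < Im ?u" using w by (simp add: std_triangle_iff)
    have "of_real l * ?u = w" using l by simp
    then have "m (g w) = f ?u" using m(2)[OF u] by simp
    moreover have "0 < Im w" using u l by (simp add: zero_less_divide_iff)
    ultimately have "p (g w) = p (f ?u)" using deckD(2)[OF m(1) frame_Im_pos[OF g]] by metis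
    then show ?thesis using tri[OF w] by simp
  qed
  have "\<not> 1 < l"
  proof
    assume l1: "1 < l"
    \<comment> \<open>For \<open>l > 1\<close> the point \<open>Complex 1 l\<close> on the side
      \<open>Re z = 1\<close> lies in the scaled triangle.\<close>
    have "1 / l < (1 + l\<^sup>2) / l\<^sup>2" using l1 by (simp add: field_simps power2_eq_square add_strict_increasing)
    then have "of_real (1 / l) * Complex 1 l \<in> std_triangle"
      using l1 by (simp add: std_triangle_iff norm_mult norm_divide power_mult_distrib power_divide cmod_power2)
    moreover have "Re (tri_rot (tri_rot (Complex 1 l))) = 0"
      using l by (simp add: tri_rot_tri_rot Re_divide)
    ultimately show False using no frame_side_mem[OF g, of "Complex 1 l"] l by auto
  qed
  moreover have "\<not> l < 1"
  proof
    assume l1: "l < 1"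
    \<comment> \<open>For \<open>l < 1\<close> the point of the semicircle with real part
      \<open>l / 2\<close> lies in the scaled triangle, above the middle of its base.\<close>
    let ?y = "sqrt (l / 2 - (l / 2)\<^sup>2)" and ?w = "Complex (l / 2) (sqrt (l / 2 - (l / 2)\<^sup>2))"
    have "(l / 2)\<^sup>2 < l / 2" using l l1 by (simp add: power2_eq_square field_simps)
    then have y: "0 < ?y" "?y\<^sup>2 = l / 2 - (l / 2)\<^sup>2" by auto
    then have n: "(cmod ?w)\<^sup>2 = l / 2" by (simp add: cmod_power2)
    have "(cmod (of_real (1 / l) * ?w))\<^sup>2 = (l / 2) / l\<^sup>2"
      unfolding norm_mult power_mult_distrib n by (simp add: norm_divide power_divide)
    also have "\<dots> = 1 / (2 * l)" using l by (simp add: power2_eq_square)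
    finally have n2: "(cmod (of_real (1 / l) * ?w))\<^sup>2 = 1 / (2 * l)" .
    moreover have "1 / 2 < 1 / (2 * l)" using l l1 by (simp add: field_simps)
    ultimately have "of_real (1 / l) * ?w \<in> std_triangle"
      unfolding std_triangle_iff n2 using l y(1) by simp
    moreover have "Re (tri_rot ?w) = 0" unfolding Re_tri_rot n using l by simp
    ultimately show False using no frame_side_mem[OF g, of ?w] y(1) by auto
  qed
  ultimately have "l = 1" by simp
  then show ?thesis using that m by simp
qed

end

section \<open>Moves\<close>

text \<open>The third side runs from 1 to 0, so its image climbs from \<open>x - k\<close> to
  infinity; this is why the time is reversed.\<close>

lemma vertical_frame_third_side:
  assumes "0 < k"
  shows "of_real x - of_real k / tri_rot (tri_rot (imag_axis s)) = down (x - k) (- s - ln k)"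
proof -
  have "1 - imag_axis s \<noteq> 0" by (simp add: complex_eq_iff)
  then show ?thesis using assms by (simp add: tri_rot_tri_rot complex_eq_iff exp_add)
qed

text \<open>The side opposite to infinity is a semicircle of radius \<open>k / 2\<close>, which
  height \<open>k\<close> clears.\<close>

lemma vertical_strip_in_triangle:
  assumes "x - k < Re z" "Re z < x" "k \<le> Im z"
  shows "z \<in> (\<lambda>w. of_real x - of_real k / w) ` std_triangle"
proof (rule image_eqI)
  define a b where "a = x - Re z" and "b = Im z"
  have ab: "0 < a" "a < k" "k \<le> b" using assms by (auto simp: a_def b_def)
  then have pos: "0 < a\<^sup>2 + b\<^sup>2" by (simp add: add_pos_pos)
  let ?w = "of_real k / (of_real x - z)"
  have xz: "of_real x - z = Complex a (- b)" by (simp add: a_def b_def complex_eq_iff)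
  have "z \<noteq> of_real x" using ab by (auto simp: b_def)
  then show "z = of_real x - of_real k / ?w" using ab by simp
  have "k * a < k * k" using ab by simp
  also have "\<dots> \<le> b * b" using ab by (intro mult_mono) auto
  finally have "k * a < a\<^sup>2 + b\<^sup>2" using ab by (simp add: power2_eq_square add_pos_pos add.commute add_strict_increasing2)
  moreover have "(cmod ?w)\<^sup>2 = k\<^sup>2 / (a\<^sup>2 + b\<^sup>2)"
    unfolding xz by (simp add: norm_divide power_divide cmod_power2)
  moreover have "Re ?w = k * a / (a\<^sup>2 + b\<^sup>2)" "Im ?w = k * b / (a\<^sup>2 + b\<^sup>2)"
    unfolding xz by (simp_all add: Re_divide Im_divide)
  ultimately show "?w \<in> std_triangle"
    using ab pos by (simp add: std_triangle_iff divide_strict_right_mono power2_eq_square)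
qed

text \<open>The point \<open>v\<close> runs along the geodesic from 1 to \<open>-l\<close>. The sign
  of \<open>1 - l * (exp s)\<^sup>2\<close> is that of \<open>Re v\<close> and tells whether
  \<open>v\<close> is in the right triangle, on the axis, or in the left triangle, the image of
  \<open>std_triangle\<close> under \<open>z \<mapsto> - l / z\<close>.\<close>

lemma diagonal_in_quadrilateral:
  fixes l s :: real
  assumes l: "0 < l"
  defines "v \<equiv> (of_real l * imag_axis s + 1) / (1 - imag_axis s)"
  shows "v \<in> std_triangle \<or> Re v = 0 \<or> (\<exists>w\<in>std_triangle. v = - of_real l / w)"
proof -
  define q where "q = exp s"
  have q: "0 < q" by (simp add: q_def)
  have pos: "0 < 1 + q\<^sup>2" "0 < 1 + l\<^sup>2 * q\<^sup>2" by (auto intro: add_pos_nonneg)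
  have v: "v = Complex 1 (l * q) / Complex 1 (- q)"
  proof -
    have "of_real l * imag_axis s + 1 = Complex 1 (l * q)" "1 - imag_axis s = Complex 1 (- q)"
      by (simp_all add: q_def complex_eq_iff)
    then show ?thesis by (simp add: v_def)
  qed
  have Re: "Re v = (1 - l * q\<^sup>2) / (1 + q\<^sup>2)" and Im: "Im v = q * (1 + l) / (1 + q\<^sup>2)"
    unfolding v by (simp_all add: Re_divide Im_divide power2_eq_square algebra_simps)
  have n: "(cmod v)\<^sup>2 = (1 + l\<^sup>2 * q\<^sup>2) / (1 + q\<^sup>2)"
    unfolding v by (simp add: norm_divide power_divide cmod_power2 power_mult_distrib)
  have Imv: "0 < Im v" unfolding Im using q l pos by simp
  have "l * q\<^sup>2 > 0" "l\<^sup>2 * q\<^sup>2 > 0" "q\<^sup>2 > 0" using l q by auto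
  consider "l * q\<^sup>2 < 1" | "l * q\<^sup>2 = 1" | "1 < l * q\<^sup>2" by linarith
  then show ?thesis
  proof cases
    case 1
    have "0 < Re v" unfolding Re using 1 pos by (intro divide_pos_pos) auto
    moreover have "Re v < 1" unfolding Re divide_less_eq_1_pos[OF pos(1)]
      using \<open>l * q\<^sup>2 > 0\<close> \<open>q\<^sup>2 > 0\<close> by linarith
    moreover have "Re v < (cmod v)\<^sup>2" unfolding Re n
      using \<open>l * q\<^sup>2 > 0\<close> \<open>l\<^sup>2 * q\<^sup>2 > 0\<close> by (intro divide_strict_right_mono pos) linarith
    ultimately have "v \<in> std_triangle" using Imv by (simp add: std_triangle_iff)
    then show ?thesis by blast
  next
    case 2 then show ?thesis by (simp add: Re)
  next
    case 3
    let ?w = "- of_real l / v"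
    have v0: "v \<noteq> 0" using Imv by auto
    have n0: "(Re v)\<^sup>2 + (Im v)\<^sup>2 = (1 + l\<^sup>2 * q\<^sup>2) / (1 + q\<^sup>2)" using n by (simp add: cmod_power2)
    have "Re ?w = - l * Re v / ((Re v)\<^sup>2 + (Im v)\<^sup>2)" by (simp add: Re_divide)
    also have "\<dots> = - l * (1 - l * q\<^sup>2) / (1 + l\<^sup>2 * q\<^sup>2)"
      unfolding n0 unfolding Re using pos(1) by simp
    also have "- l * (1 - l * q\<^sup>2) = l * (l * q\<^sup>2 - 1)" by (simp add: algebra_simps)
    finally have Rew: "Re ?w = l * (l * q\<^sup>2 - 1) / (1 + l\<^sup>2 * q\<^sup>2)" .
    have nw: "(cmod ?w)\<^sup>2 = l\<^sup>2 * (1 + q\<^sup>2) / (1 + l\<^sup>2 * q\<^sup>2)"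
      unfolding norm_divide power_divide n using pos by (simp add: algebra_simps)
    have "0 < Im ?w" using l hyp_isometry_Im_pos[OF hyp_isometry_neg_inverse[OF l] Imv] by simp
    moreover have "l * (l * q\<^sup>2 - 1) < 1 + l\<^sup>2 * q\<^sup>2" using l by (simp add: power2_eq_square algebra_simps)
    moreover have "l * (l * q\<^sup>2 - 1) < l\<^sup>2 * (1 + q\<^sup>2)"
      using l by (simp add: power2_eq_square algebra_simps add_pos_pos)
    ultimately have "?w \<in> std_triangle"
      unfolding std_triangle_iff nw Rew using 3 l pos by (simp add: divide_strict_right_mono)
    moreover have "v = - of_real l / ?w" using v0 l by simp
    ultimately show ?thesis by blast
  qed
qed

lemma imag_axis_closure_std_triangle: "imag_axis 0 \<in> closure std_triangle"
proof -
  have "(\<lambda>n. 1 / (real n + 2)) \<longlonglongrightarrow> 0" by real_asymp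
  then have "(\<lambda>n. imag_axis 0 + of_real (1 / (real n + 2))) \<longlonglongrightarrow> imag_axis 0 + of_real 0"
    by (intro tendsto_intros)
  moreover have "imag_axis 0 + of_real (1 / (real n + 2)) \<in> std_triangle" for n
  proof -
    have "1 / (real n + 2) < 1" by simp
    then show ?thesis unfolding std_triangle_iff cmod_power2 by (simp add: add_strict_increasing2 less_imp_le del: of_real_divide)
  qed
  ultimately show ?thesis unfolding closure_sequential
    by (intro exI[of _ "\<lambda>n. imag_axis 0 + of_real (1 / (real n + 2))"]) simp
qed

lemma hyp_isometry_closure:
  assumes "n \<in> hyp_isometries" "n ` std_triangle \<subseteq> std_triangle" "z \<in> closure std_triangle" "0 < Im z"
  shows "n z \<in> closure std_triangle"
proof -
  obtain f where f: "\<And>k::nat. f k \<in> std_triangle" "f \<longlonglongrightarrow> z" using assms(3) by (auto simp: closure_sequential)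
  have "open upper_half_plane" unfolding upper_half_plane_def by (rule open_halfspace_Im_gt)
  then have "isCont n z"
    using continuous_on_hyp_isometry[OF assms(1)] assms(4) by (simp add: continuous_on_eq_continuous_at)
  then have "(\<lambda>k. n (f k)) \<longlonglongrightarrow> n z" using f(2) by (rule isCont_tendsto_compose)
  moreover have "n (f k) \<in> std_triangle" for k using f(1) assms(2) by blast
  ultimately show ?thesis unfolding closure_sequential by (intro exI[of _ "\<lambda>k. n (f k)"]) simp
qed

context cusped_surface_with_horocycle
begin

section \<open>Well-definedness of the successor edge and of the flip\<close>

lemma oriented_edgeI:
  "frame T g \<Longrightarrow> ideal_triangulation p S x0 T \<Longrightarrow> oriented_class (\<lambda>s. p (g (imag_axis s))) \<in> oriented_edges p x0 T"
  using edge_family_cusp_geodesic[OF ideal_triangulation_edge_family frame_isometry]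
  unfolding oriented_edges_def frame_def by blast

lemma right_frame_frame: "frame T g \<Longrightarrow> right_frame p S x0 T (oriented_class (\<lambda>s. p (g (imag_axis s)))) g"
  using oriented_class_self[of "\<lambda>s. p (g (imag_axis s))"] by (simp add: right_frame_def frame_def comp_def)

lemma right_frame_unique:
  assumes "frame T g" "right_frame p S x0 T (oriented_class (\<lambda>s. p (g (imag_axis s)))) f"
  obtains m where "deck m" "\<And>z. 0 < Im z \<Longrightarrow> m (g z) = f z"
proof (rule frame_unique[OF assms(1)])
  show "f \<in> hyp_isometries" "(\<lambda>s. p (f (imag_axis s))) \<in> oriented_class (\<lambda>s. p (g (imag_axis s)))"
    using assms(2) by (auto simp: right_frame_def comp_def)
  show "p (f z) \<notin> \<Union>T" if "z \<in> std_triangle" for z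
    using assms(2) that in_components_subset[of "p ` f ` std_triangle"] by (fastforce simp: right_frame_def)
qed (rule that)

text \<open>Any two right frames of an edge differ by a deck transformation, which is invisible
  after \<open>p\<close>; so the definite description has a unique value.\<close>

lemma next_edge_eq:
  assumes g: "frame T g"
  shows "next_edge p S x0 T (oriented_class (\<lambda>s. p (g (imag_axis s)))) =
    oriented_class (\<lambda>s. p (g (tri_rot (imag_axis s))))"
  unfolding next_edge_def
proof (rule the_equality)
  show "\<exists>f. right_frame p S x0 T (oriented_class (\<lambda>s. p (g (imag_axis s)))) f \<and>
      oriented_class (\<lambda>s. p (g (tri_rot (imag_axis s)))) = oriented_class (p \<circ> f \<circ> tri_rot \<circ> imag_axis)"
    using right_frame_frame[OF g] by (intro exI[of _ g]) (simp add: comp_def)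
  fix e assume "\<exists>f. right_frame p S x0 T (oriented_class (\<lambda>s. p (g (imag_axis s)))) f \<and>
      e = oriented_class (p \<circ> f \<circ> tri_rot \<circ> imag_axis)"
  then obtain f where f: "right_frame p S x0 T (oriented_class (\<lambda>s. p (g (imag_axis s)))) f"
      "e = oriented_class (p \<circ> f \<circ> tri_rot \<circ> imag_axis)" by blast
  obtain m where m: "deck m" "\<And>z. 0 < Im z \<Longrightarrow> m (g z) = f z" using right_frame_unique[OF g f(1)] by blast
  have "p (f (tri_rot (imag_axis s))) = p (g (tri_rot (imag_axis s)))" for s
    using deckD(2)[OF m(1) frame_Im_pos[OF g], of "tri_rot (imag_axis s)"] m(2) by (simp add: Im_tri_rot_pos)
  then show "e = oriented_class (\<lambda>s. p (g (tri_rot (imag_axis s))))" by (simp add: f(2) comp_def)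
qed

text \<open>The triangle on the left is the one on the right of the reversed edge; inversion turns
  the scaling by \<open>l\<close> there into the parameter \<open>1 / l\<close>.\<close>

lemma left_frame_exists:
  assumes T: "ideal_triangulation p S x0 T" and g: "frame T g"
  obtains l where "0 < l" "frame T (\<lambda>z. g (- of_real l / z))"
proof -
  have iso: "(\<lambda>z. g (- of_real 1 / z)) \<in> hyp_isometries"
    using hyp_isometry_comp[OF frame_isometry[OF g] hyp_isometry_neg_inverse[of 1]] by (simp add: comp_def)
  have "range (\<lambda>s. p (g (- of_real 1 / imag_axis s))) = trace g"
    using range_shift(2)[of "\<lambda>s. p (g (imag_axis s))" "ln 1"] neg_inverse_imag_axis[of 1] by simp
  then have "range (\<lambda>s. p (g (- of_real 1 / imag_axis s))) \<in> T" using g by (simp add: frame_def)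
  then obtain l where l: "0 < l" "frame T (\<lambda>z. g (- of_real 1 / (of_real l * z)))"
    using frame_exists[OF T iso] by blast
  have "frame T (\<lambda>z. g (- of_real (1 / l) / z))" by (rule frame_cong[OF l(2)]) simp
  then show ?thesis using that[of "1 / l"] l(1) by simp
qed

text \<open>Besides the frame, the third vertex \<open>-l\<close> of the left triangle has to be
  unique: two left frames over the same \<open>g\<close> are related by a deck transformation, and
  the embedded common edge then forces equal parameters.\<close>

lemma flip_edge_eq:
  assumes T: "ideal_triangulation p S x0 T" and g: "frame T g" and l: "0 < l" "frame T (\<lambda>z. g (- of_real l / z))"
  shows "flip_edge p S x0 T (oriented_class (\<lambda>s. p (g (imag_axis s)))) =
    oriented_class (\<lambda>s. p (g ((of_real l * imag_axis s + 1) / (1 - imag_axis s))))"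
  unfolding flip_edge_def
proof (rule the_equality)
  let ?e = "oriented_class (\<lambda>s. p (g (imag_axis s)))"
  show "\<exists>f k. right_frame p S x0 T ?e f \<and> 0 < k \<and>
      p ` f ` (\<lambda>z. - of_real k / z) ` std_triangle \<in> components (S - {x0} - \<Union>T) \<and>
      oriented_class (\<lambda>s. p (g ((of_real l * imag_axis s + 1) / (1 - imag_axis s)))) =
      oriented_class (p \<circ> f \<circ> (\<lambda>z. (of_real k * z + 1) / (1 - z)) \<circ> imag_axis)"
    using right_frame_frame[OF g] l by (intro exI[of _ g] exI[of _ l]) (simp add: comp_def frame_def image_image)
  fix e assume "\<exists>f k. right_frame p S x0 T ?e f \<and> 0 < k \<and>
      p ` f ` (\<lambda>z. - of_real k / z) ` std_triangle \<in> components (S - {x0} - \<Union>T) \<and>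
      e = oriented_class (p \<circ> f \<circ> (\<lambda>z. (of_real k * z + 1) / (1 - z)) \<circ> imag_axis)"
  then obtain f k where f: "right_frame p S x0 T ?e f" and k: "0 < k"
      "p ` f ` (\<lambda>z. - of_real k / z) ` std_triangle \<in> components (S - {x0} - \<Union>T)"
      and e: "e = oriented_class (p \<circ> f \<circ> (\<lambda>z. (of_real k * z + 1) / (1 - z)) \<circ> imag_axis)" by blast
  obtain m where m: "deck m" "\<And>z. 0 < Im z \<Longrightarrow> m (g z) = f z" using right_frame_unique[OF g f] by blast
  have pf: "p (f z) = p (g z)" if "0 < Im z" for z
    using deckD(2)[OF m(1) frame_Im_pos[OF g that]] m(2)[OF that] by simp
  note inv = hyp_isometry_neg_inverse[OF k(1)]
  have gk: "(\<lambda>z. g (- of_real k / z)) \<in> hyp_isometries"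
    using hyp_isometry_comp[OF frame_isometry[OF g] inv] by (simp add: comp_def)
  have ax: "p (g (- of_real l / imag_axis s)) = p (g (imag_axis (ln l - s)))"
    "p (g (- of_real k / imag_axis s)) = p (g (imag_axis (ln k - s)))" for s
    using neg_inverse_imag_axis l(1) k(1) by simp_all
  obtain n where n: "deck n" "\<And>z. 0 < Im z \<Longrightarrow> n (g (- of_real l / z)) = g (- of_real k / z)"
  proof (rule frame_unique[OF l(2) gk])
    show "(\<lambda>s. p (g (- of_real k / imag_axis s))) \<in> oriented_class (\<lambda>s. p (g (- of_real l / imag_axis s)))"
      unfolding ax oriented_class_iff by (intro exI[of _ "ln l - ln k"]) simp
    show "p (g (- of_real k / z)) \<notin> \<Union>T" if "z \<in> std_triangle" for z
    proof -
      have "0 < Im (- of_real k / z)" using hyp_isometry_Im_pos[OF inv] that by (simp add: std_triangle_iff)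
      then have "p (g (- of_real k / z)) \<in> p ` f ` (\<lambda>z. - of_real k / z) ` std_triangle"
        using pf that by (metis imageI)
      then show ?thesis using in_components_subset[OF k(2)] by blast
    qed
  qed blast
  \<comment> \<open>At \<open>imag_axis 0\<close> the two left frames give the points of the edge
    with parameters \<open>ln l\<close> and \<open>ln k\<close>.\<close>
  have "p (g (imag_axis (ln l))) = p (g (imag_axis (ln k)))"
    using ax[of 0] n(2)[of "imag_axis 0"] deckD(2)[OF n(1), of "g (- of_real l / imag_axis 0)"]
      frame_Im_pos[OF l(2), of "imag_axis 0"] by simp
  moreover have "inj (\<lambda>s. p (g (imag_axis s)))"
    using edge_family_cusp_geodesic[OF ideal_triangulation_edge_family[OF T] frame_isometry[OF g]] g
    by (simp add: frame_def cusp_geodesic_def)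
  ultimately have "ln l = ln k" by (rule injD[rotated])
  then have "l = k" using l(1) k(1) by simp
  moreover have "0 < Im ((of_real l * imag_axis s + 1) / (1 - imag_axis s))" for s
    using hyp_isometry_Im_pos[OF hyp_isometry_diagonal[OF l(1)], of "imag_axis s"] by simp
  ultimately show "e = oriented_class (\<lambda>s. p (g ((of_real l * imag_axis s + 1) / (1 - imag_axis s))))"
    unfolding e comp_def by (simp add: pf)
qed

section \<open>Triangles with a vertex at infinity\<close>

abbreviation (input) vertical_frame :: "'a set set \<Rightarrow> real \<Rightarrow> real \<Rightarrow> bool" where
  "vertical_frame T x k \<equiv> frame T (\<lambda>z. of_real x - of_real k / z)"

lemma vertical_frame_exists:
  assumes T: "ideal_triangulation p S x0 T" and e: "e \<in> oriented_edges p x0 T"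
  obtains x k where "0 < k" "e = down_edge x" "vertical_frame T x k"
proof -
  obtain c where c: "e = oriented_class c" "cusp_geodesic p x0 c" "range c \<in> T"
    using e by (auto simp: oriented_edges_def)
  obtain x where x: "oriented_class c = down_edge x"
    using cusp_geodesic_down[OF c(2)] by blast
  have "down_trace x = range c" using x edge_support_oriented_class by metis
  then have "range (\<lambda>s. p (of_real x - of_real 1 / imag_axis s)) \<in> T"
    using down_imag_axis[of 1 x] c(3) by simp
  then obtain l where l: "0 < l" "frame T (\<lambda>z. of_real x - of_real 1 / (of_real l * z))"
    using frame_exists[OF T hyp_isometry_pole_zero[of 1 x]] by auto
  have "vertical_frame T x (1 / l)" by (rule frame_cong[OF l(2)]) simp
  then show ?thesis using that[of "1 / l" x] l(1) c(1) x by simp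
qed

lemma vertical_frame_side:
  assumes "0 < k" "vertical_frame T x k"
  shows "down_trace x \<in> T" "down_trace (x - k) \<in> T"
    "oriented_class (\<lambda>s. p (of_real x - of_real k / imag_axis s)) = down_edge x"
    "range (\<lambda>s. p (of_real x - of_real k / imag_axis s)) = down_trace x"
    "range (\<lambda>s. p (of_real x - of_real k / tri_rot (tri_rot (imag_axis s)))) = down_trace (x - k)"
proof -
  have 1: "p (of_real x - of_real k / imag_axis s) = p (down x (s + (- ln k)))" for s
    unfolding down_imag_axis[OF assms(1)] by simp
  have 2: "p (of_real x - of_real k / tri_rot (tri_rot (imag_axis s))) = p (down (x - k) (- ln k - s))" for s
  proof -
    have "- s - ln k = - ln k - s" by simp
    then show ?thesis unfolding vertical_frame_third_side[OF assms(1)] by (simp only:)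
  qed
  show 3: "range (\<lambda>s. p (of_real x - of_real k / imag_axis s)) = down_trace x"
    unfolding 1 by (rule range_shift)
  show 4: "range (\<lambda>s. p (of_real x - of_real k / tri_rot (tri_rot (imag_axis s)))) = down_trace (x - k)"
    unfolding 2 by (rule range_shift)
  show "down_trace x \<in> T" "down_trace (x - k) \<in> T"
    using assms(2) unfolding frame_def 3 4 by blast+
  show "oriented_class (\<lambda>s. p (of_real x - of_real k / imag_axis s)) = down_edge x"
    unfolding 1 by (rule oriented_class_eqI) (unfold oriented_class_iff, blast)
qed

lemma cusp_geodesic_down_edge:
  assumes "ideal_triangulation p S x0 T" "down_trace x \<in> T"
  shows "cusp_geodesic p x0 (\<lambda>s. p (down x s))"
proof -
  have "of_real x - of_real 1 / imag_axis s = down x s" for s using down_imag_axis[of 1 x s] by simp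
  then show ?thesis
    using edge_family_cusp_geodesic[OF ideal_triangulation_edge_family[OF assms(1)] hyp_isometry_pole_zero[of 1 x]] assms(2)
    by simp
qed

text \<open>A vertical edge with foot in between would pass through the interior of the triangle at
  height \<open>k\<close>.\<close>

lemma vertical_frame_gap:
  assumes "0 < k" "vertical_frame T x k" "x - k < y" "y < x"
  shows "down_trace y \<notin> T"
proof
  assume T: "down_trace y \<in> T"
  have "down y (- ln k) \<in> (\<lambda>w. of_real x - of_real k / w) ` std_triangle"
    by (rule vertical_strip_in_triangle) (use assms in auto)
  then have "p (down y (- ln k)) \<notin> \<Union>T" using frame_interior[OF assms(2)] by auto
  then show False using T by (metis UnionI rangeI)
qed

lemma p_down_period: "p (down (x + of_int n * t) s) = p (down x s)"
  using p_translate[of "down x s" n] unfolding down_def Complex_add_of_real by simp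

lemma down_horocycle: "down x (- ln h) = Complex x h"
  using h_pos by (simp add: down_def)

text \<open>A time shift \<open>q\<close> between the two parametrizations must vanish: both rays
  lie in the open horoball before time \<open>- ln h\<close> and are on the horocycle at that time.
  The points on the horocycle then coincide.\<close>

lemma oriented_class_down_eqD:
  assumes "down_edge x = down_edge y"
  obtains n :: int where "y = x + of_int n * t"
proof -
  obtain q where q: "\<And>s. p (down x s) = p (down y (s + q))"
    using assms oriented_class_self[of "\<lambda>s. p (down x s)"] by (auto simp: oriented_class_iff)
  have high: "h < Im (down z s)" if "s < - ln h" for z s
  proof -
    have "exp (ln h) < exp (- s)" using that by (intro exp_less_mono) simp
    then show ?thesis using h_pos by simp
  qed
  have "\<not> q < 0"
    using horoball_disjoint_horocycle[OF high[of "- ln h + q" y], of x] q[of "- ln h"] down_horocycle by force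
  moreover have "\<not> 0 < q"
    using horoball_disjoint_horocycle[OF high[of "- ln h - q" x], of y] q[of "- ln h - q"] down_horocycle by force
  ultimately have "q = 0" by simp
  then have "p (Complex x h) = p (Complex y h)" using q[of "- ln h"] by (simp add: down_horocycle)
  then show ?thesis using horocycle_eqD that by blast
qed

text \<open>If the two sides agree with directions following the boundary, a rotation of the
  triangle is induced by a deck transformation, against embeddedness. If they are folded together at
  their common vertex, the horocycle carries only one point of \<open>K\<close>, but an edge and its
  reversal have different points.\<close>

lemma frame_adjacent_sides_distinct:
  assumes T: "ideal_triangulation p S x0 T" and g: "frame T g"
  shows "trace g \<noteq> range (\<lambda>s. p (g (tri_rot (tri_rot (imag_axis s)))))"
proof
  assume eq: "trace g = range (\<lambda>s. p (g (tri_rot (tri_rot (imag_axis s)))))"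
  note ef = ideal_triangulation_edge_family[OF T]
  note g2 = frame_rotate[OF frame_rotate[OF g]]
  have c: "cusp_geodesic p x0 (\<lambda>s. p (g (imag_axis s)))"
    using edge_family_cusp_geodesic[OF ef frame_isometry[OF g]] g by (simp add: frame_def)
  show False
  proof (rule geodesic_in_edge[OF c frame_isometry[OF g2]])
    show "range (\<lambda>s. p (g (tri_rot (tri_rot (imag_axis s))))) \<subseteq> trace g"
      using eq by simp
  next
    fix r assume r: "\<And>s. p (g (tri_rot (tri_rot (imag_axis s)))) = p (g (imag_axis (s + r)))"
    obtain m where m: "deck m" "\<And>z. 0 < Im z \<Longrightarrow> m (g z) = g (tri_rot (tri_rot z))"
    proof (rule frame_unique[OF g frame_isometry[OF g2]])
      show "(\<lambda>s. p (g (tri_rot (tri_rot (imag_axis s))))) \<in> oriented_class (\<lambda>s. p (g (imag_axis s)))"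
        using r by (auto simp: oriented_class_iff)
      show "p (g (tri_rot (tri_rot z))) \<notin> \<Union>T" if "z \<in> std_triangle" for z
        using frame_interior[OF g2 that] .
    qed blast
    \<comment> \<open>Any interior point moved by the rotation contradicts embeddedness; this one is
      easy to evaluate.\<close>
    let ?z = "Complex (1 / 2) 1"
    have z: "?z \<in> std_triangle" unfolding std_triangle_iff cmod_power2 by (simp add: power2_eq_square)
    have "p (g (tri_rot (tri_rot ?z))) = p (g ?z)"
      using m(2)[of ?z] deckD(2)[OF m(1) frame_Im_pos[OF g, of ?z]] by simp
    then have "g (tri_rot (tri_rot ?z)) = g ?z"
      using g z tri_rot_std_triangle by (auto simp: frame_def intro: inj_onD)
    moreover obtain g' where "g' \<in> hyp_isometries" and g': "\<And>z. 0 < Im z \<Longrightarrow> g' (g z) = z"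
        and "\<And>z. 0 < Im z \<Longrightarrow> g (g' z) = z"
      using hyp_isometry_inverse[OF frame_isometry[OF g]] by blast
    moreover have "g' (g (tri_rot (tri_rot ?z))) = tri_rot (tri_rot ?z)"
      by (intro g' Im_tri_rot_pos) simp
    moreover have "g' (g ?z) = ?z" by (intro g') simp
    ultimately have "tri_rot (tri_rot ?z) = ?z" by simp
    moreover have "Re (tri_rot (tri_rot ?z)) = 2 / 5"
      by (simp add: tri_rot_tri_rot Re_divide power2_eq_square)
    ultimately show False by simp
  next
    fix r assume r: "\<And>s. p (g (tri_rot (tri_rot (imag_axis s)))) = p (g (imag_axis (r - s)))"
    have lim: "((\<lambda>s. p (g (imag_axis s))) \<longlongrightarrow> x0) at_bot" using c by (simp add: cusp_geodesic_def)
    obtain m x k where m: "deck m" "0 < k" "\<And>z. 0 < Im z \<Longrightarrow> m (g z) = of_real x - of_real k / z"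
      by (rule cusp_ray[OF frame_isometry[OF g] lim]) (rule that)
    have v: "vertical_frame T x k" by (rule frame_cong[OF frame_deck[OF m(1) g]]) (simp add: m(3))
    have pg: "p (g z) = p (of_real x - of_real k / z)" if "0 < Im z" for z
      using deckD(2)[OF m(1) frame_Im_pos[OF g that]] m(3)[OF that] by simp
    have shift: "p (down (x - k) (- s - ln k)) = p (down x (r - s - ln k))" for s
    proof -
      have "p (g (tri_rot (tri_rot (imag_axis s)))) = p (down (x - k) (- s - ln k))"
        unfolding vertical_frame_third_side[OF m(2), symmetric] by (intro pg Im_tri_rot_pos) simp
      moreover have "p (g (imag_axis (r - s))) = p (down x (r - s - ln k))"
        unfolding down_imag_axis[OF m(2), symmetric] by (intro pg) simp
      ultimately show ?thesis using r[of s] by simp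
    qed
    have eq_class: "down_edge (x - k) = down_edge x"
    proof (rule oriented_class_eqI, unfold oriented_class_iff, intro exI allI)
      show "p (down (x - k) s) = p (down x (s + r))" for s
        using shift[of "- s - ln k"] by (simp add: algebra_simps)
    qed
    obtain n :: int where n: "x = x - k + of_int n * t" using eq_class by (rule oriented_class_down_eqD)
    have "0 < of_int n * t" using n m(2) by simp
    then have "0 < n" using t_pos by (simp add: zero_less_mult_iff)
    have "\<not> t < k"
    proof
      assume tk: "t < k"
      let ?V = "(\<lambda>z. of_real x - of_real k / z) ` std_triangle"
      \<comment> \<open>\<open>?a\<close> and \<open>?a + t\<close> lie symmetrically in the gap of
        width \<open>k\<close>; they are identified by \<open>p\<close> although the triangle is
        embedded.\<close>
      let ?a = "x - (k + t) / 2"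
      have "Complex ?a k \<in> ?V" "Complex (?a + t) k \<in> ?V"
        using tk t_pos by (auto intro!: vertical_strip_in_triangle simp: field_simps)
      moreover have "p (Complex (?a + t) k) = p (Complex ?a k)"
        using p_translate_t[of "Complex ?a k"] m(2) by (simp add: Complex_add_of_real)
      moreover have "inj_on p ?V" using v by (simp add: frame_def)
      ultimately have "Complex (?a + t) k = Complex ?a k" by (auto dest: inj_onD)
      then show False using t_pos by simp
    qed
    moreover have "k = of_int n * t" using n by simp
    \<comment> \<open>The width is a positive multiple of the period and not larger than it, so one
      gap fills the whole horocycle.\<close>
    ultimately have "k = t" using \<open>0 < n\<close> t_pos by (cases "n = 1") (auto simp: not_less)
    define c' where "c' = (\<lambda>s. p (down x s))"
    have c': "cusp_geodesic p x0 c'" "range c' \<in> T"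
      unfolding c'_def using vertical_frame_side(1)[OF m(2) v] cusp_geodesic_down_edge[OF T] by auto
    have rev: "cusp_geodesic p x0 (\<lambda>s. c' (0 - s))" "range (\<lambda>s. c' (0 - s)) \<in> T"
      unfolding range_shift(2) by (fact cusp_geodesic_reverse[OF c'(1)] c'(2))+
    obtain y where y: "oriented_class (\<lambda>s. c' (0 - s)) = down_edge y"
      using cusp_geodesic_down[OF rev(1)] by blast
    \<comment> \<open>The foot of the reversed edge is moved into the period starting at
      \<open>x\<close>. Since the gap below \<open>x\<close> has width \<open>t\<close>, it can only
      be \<open>x\<close>.\<close>
    obtain j :: int where j: "(y - x + t) + of_int j * t \<in> {0..<t}" by (rule mod_period)
    define y' where "y' = y + of_int (j + 1) * t"
    have y': "oriented_class (\<lambda>s. c' (0 - s)) = down_edge y'"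
      unfolding y'_def p_down_period by (rule y)
    have "x \<le> y'" "y' < x + t" using j by (auto simp: y'_def algebra_simps)
    have "down_trace y' \<in> T" using rev(2) y' edge_support_oriented_class by metis
    then have "range (\<lambda>s. p (down (y' + of_int (- 1) * t) s)) \<in> T" unfolding p_down_period .
    then have "y' = x"
      using vertical_frame_gap[OF m(2) v, of "y' - t"] \<open>x \<le> y'\<close> \<open>y' < x + t\<close> \<open>k = t\<close> by fastforce
    then have "oriented_class (\<lambda>s. c' (0 - s)) = oriented_class c'" using y' by (simp add: c'_def)
    then obtain q where "\<And>s. c' (0 - s) = c' (s + q)"
      using oriented_class_self[of "\<lambda>s. c' (0 - s)"] by (auto simp: oriented_class_iff)
    \<comment> \<open>At time \<open>1 - q / 2\<close> the two sides have parameters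
      \<open>q / 2 - 1\<close> and \<open>q / 2 + 1\<close>, which injectivity would
      identify.\<close>
    then have "0 - (1 - q / 2) = (1 - q / 2) + q"
      using c'(1) unfolding cusp_geodesic_def by (blast dest: injD)
    then show False by simp
  qed
qed

end

context cusped_surface_with_horocycle
begin

section \<open>Adjacent triangles and lifts of the diagonal\<close>

lemma frame_sides_distinct:
  assumes T: "ideal_triangulation p S x0 T" and g: "frame T g"
  shows "range (\<lambda>s. p (g (tri_rot (imag_axis s)))) \<noteq> trace g"
    "range (\<lambda>s. p (g (tri_rot (tri_rot (imag_axis s))))) \<noteq> trace g"
    "range (\<lambda>s. p (g (tri_rot (tri_rot (imag_axis s))))) \<noteq> range (\<lambda>s. p (g (tri_rot (imag_axis s))))"
  using frame_adjacent_sides_distinct[OF T g] frame_adjacent_sides_distinct[OF T frame_rotate[OF g]]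
    frame_adjacent_sides_distinct[OF T frame_rotate[OF frame_rotate[OF g]]]
  by (simp_all add: tri_rot_cubed Im_tri_rot_pos)

text \<open>Such a deck transformation, inverted, carries a point of the common side to a side of
  the first triangle with the same projection. As the three sides are distinct edges and each is
  embedded, the point is fixed, so the transformation is the identity; but the two triangles lie on
  opposite sides of the axis.\<close>

lemma frame_adjacent_not_equivalent:
  assumes T: "ideal_triangulation p S x0 T" and g: "frame T g"
    and l: "0 < l" "frame T (\<lambda>z. g (- of_real l / z))" and m: "deck m"
  shows "(\<lambda>z. m (g z)) ` std_triangle \<noteq> (\<lambda>z. g (- of_real l / z)) ` std_triangle"
proof
  assume eq: "(\<lambda>z. m (g z)) ` std_triangle = (\<lambda>z. g (- of_real l / z)) ` std_triangle"
  let ?g2 = "\<lambda>z. g (- of_real l / z)"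
  obtain m' where m': "deck m'" "\<And>z. 0 < Im z \<Longrightarrow> m' (m z) = z" "\<And>z. 0 < Im z \<Longrightarrow> m (m' z) = z"
    using deck_inverse[OF m] by blast
  obtain k where k: "k \<in> hyp_isometries" "\<And>z. 0 < Im z \<Longrightarrow> k (g z) = z" "\<And>z. 0 < Im z \<Longrightarrow> g (k z) = z"
    using hyp_isometry_inverse[OF frame_isometry[OF g]] by blast
  define n where "n = (\<lambda>z. k (m' (?g2 z)))"
  have n: "n \<in> hyp_isometries"
    using hyp_isometry_comp[OF k(1) deck_isometry_comp[OF m'(1) frame_isometry[OF l(2)]]]
    by (simp add: n_def comp_def)
  have gn: "g (n z) = m' (?g2 z)" if "0 < Im z" for z
    unfolding n_def using k(3) deck_Im_pos[OF m'(1) frame_Im_pos[OF l(2) that]] .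
  have "n ` std_triangle \<subseteq> std_triangle"
  proof (rule image_subsetI)
    fix z assume z: "z \<in> std_triangle"
    then obtain w where w: "w \<in> std_triangle" "?g2 z = m (g w)" using eq by blast
    then have "0 < Im w" by (simp add: std_triangle_iff)
    then have "n z = w"
      unfolding n_def w(2) using m'(2)[OF frame_Im_pos[OF g, of w]] k(2)[of w] by simp
    then show "n z \<in> std_triangle" using w(1) by simp
  qed
  then have cl: "n (imag_axis 0) \<in> closure std_triangle"
    by (rule hyp_isometry_closure[OF n _ imag_axis_closure_std_triangle]) simp
  have npos: "0 < Im (n (imag_axis 0))" using hyp_isometry_Im_pos[OF n] by simp
  have g20: "?g2 (imag_axis 0) = g (imag_axis (ln l))" using neg_inverse_imag_axis[OF l(1), of 0] by simp
  have pn: "p (g (n (imag_axis 0))) = p (g (imag_axis (ln l)))"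
    using gn[of "imag_axis 0"] deckD(2)[OF m'(1) frame_Im_pos[OF g, of "imag_axis (ln l)"]] g20 by simp
  have sidesT: "trace g \<in> T" "range (\<lambda>s. p (g (tri_rot (imag_axis s)))) \<in> T"
     "range (\<lambda>s. p (g (tri_rot (tri_rot (imag_axis s))))) \<in> T" using g by (auto simp: frame_def)
  have mem: "p (g (n (imag_axis 0))) \<in> trace g" unfolding pn by blast
  then have "n (imag_axis 0) \<notin> std_triangle" using frame_interior[OF g] sidesT(1) by blast
  then have sides: "Re (n (imag_axis 0)) = 0 \<or> Re (tri_rot (n (imag_axis 0))) = 0 \<or> Re (tri_rot (tri_rot (n (imag_axis 0)))) = 0"
    using std_triangle_boundary[OF cl npos] by blast
  have disj: "A = B" if "A \<in> T" "B \<in> T" "q \<in> A" "q \<in> B" for A B q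
    using T that unfolding ideal_triangulation_def pairwise_def disjnt_iff by blast
  have "Re (tri_rot (n (imag_axis 0))) \<noteq> 0"
    using frame_side(2)[OF g npos] disj[OF sidesT(1,3) mem] frame_sides_distinct(2)[OF T g] by blast
  moreover have "Re (tri_rot (tri_rot (n (imag_axis 0)))) \<noteq> 0"
    using frame_side(3)[OF g npos] disj[OF sidesT(1,2) mem] frame_sides_distinct(1)[OF T g] by blast
  ultimately obtain s where s: "n (imag_axis 0) = imag_axis s"
    using Re_eq_0_imag_axis[OF npos] sides by blast
  have "inj (\<lambda>s. p (g (imag_axis s)))"
    using edge_family_cusp_geodesic[OF ideal_triangulation_edge_family[OF T] frame_isometry[OF g]] sidesT(1)
    by (simp add: cusp_geodesic_def)
  moreover have "p (g (imag_axis s)) = p (g (imag_axis (ln l)))" using pn s by simp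
  ultimately have "s = ln l" by (rule injD)
  then have fixed: "m' (?g2 (imag_axis 0)) = ?g2 (imag_axis 0)" using gn[of "imag_axis 0"] s g20 by simp
  have m'_id: "m' z = z" if "0 < Im z" for z
    using deck_fixed_point[OF m'(1) fixed frame_Im_pos[OF l(2)] that] by simp
  let ?z = "Complex (1 / 2) 1"
  have z: "?z \<in> std_triangle" unfolding std_triangle_iff cmod_power2 by (simp add: power2_eq_square)
  have zpos: "0 < Im ?z" by simp
  have "n ?z = - of_real l / ?z"
    unfolding n_def m'_id[OF frame_Im_pos[OF l(2) zpos]]
    by (rule k(2)) (rule hyp_isometry_Im_pos[OF hyp_isometry_neg_inverse[OF l(1)] zpos])
  moreover have "n ?z \<in> std_triangle" using \<open>n ` std_triangle \<subseteq> std_triangle\<close> z by blast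
  moreover have "Re (- of_real l / ?z) < 0" using l(1) by (simp add: Re_divide add_pos_pos)
  ultimately show False by (simp add: std_triangle_iff)
qed

text \<open>Inside a triangle the lifts of the flipped edge form a single segment: another segment would
  come from a deck transformation that maps the triangle to its neighbour.\<close>

lemma diagonal_lift_unique:
  assumes T: "ideal_triangulation p S x0 T" and g: "frame T g"
    and l: "0 < l" "frame T (\<lambda>z. g (- of_real l / z))"
    and q: "q \<in> g ` std_triangle" "p q = p (g ((of_real l * imag_axis s + 1) / (1 - imag_axis s)))"
  shows "q = g ((of_real l * imag_axis s + 1) / (1 - imag_axis s))"
proof -
  define v where "v = (of_real l * imag_axis s + 1) / (1 - imag_axis s)"
  have vpos: "0 < Im v" unfolding v_def using hyp_isometry_Im_pos[OF hyp_isometry_diagonal[OF l(1)], of "imag_axis s"] by simp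
  have pq: "p q = p (g v)" using q(2) by (simp add: v_def)
  obtain w where w: "w \<in> std_triangle" "q = g w" using q(1) by blast
  have wpos: "0 < Im w" using w(1) by (simp add: std_triangle_iff)
  consider "v \<in> std_triangle" | "Re v = 0" | u where "u \<in> std_triangle" "v = - of_real l / u"
    using diagonal_in_quadrilateral[OF l(1), of s] unfolding v_def by blast
  then have "q = g v"
  proof cases
    case 1
    then show ?thesis using g q(1) pq by (auto simp: frame_def intro: inj_onD)
  next
    case 2
    then have "p (g v) \<in> \<Union>T" using frame_side_mem[OF g vpos] by blast
    then show ?thesis using frame_interior[OF g w(1)] pq w(2) by simp
  next
    case 3
    obtain m where m: "deck m" "m q = g v"
      using deck_exists[OF pq] frame_Im_pos[OF g wpos] frame_Im_pos[OF g vpos] w(2) by auto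
    have "g v \<in> (\<lambda>z. m (g z)) ` std_triangle" using m(2) w by (metis (no_types, lifting) imageI)
    moreover have "g v \<in> (\<lambda>z. g (- of_real l / z)) ` std_triangle" using 3 by blast
    ultimately have "(\<lambda>z. m (g z)) ` std_triangle \<inter> (\<lambda>z. g (- of_real l / z)) ` std_triangle \<noteq> {}" by blast
    then show ?thesis
      using frame_image_eq[OF frame_deck[OF m(1) g] l(2)] frame_adjacent_not_equivalent[OF T g l m(1)] by blast
  qed
  then show ?thesis by (simp add: v_def)
qed

text \<open>\<open>tri_rot\<close> sends 1 to 0 and \<open>-l\<close> to \<open>(l + 1) / l\<close>,
  so the diagonal from 1 to \<open>-l\<close> becomes the vertical from infinity down to
  \<open>x - k * l / (l + 1)\<close>.\<close>

lemma vertical_diagonal: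
  assumes "0 < k" "0 < l"
  shows "of_real x - of_real k / tri_rot ((of_real l * imag_axis s + 1) / (1 - imag_axis s)) =
    down (x - k * l / (l + 1)) (s - ln (k / (l + 1)))"
proof -
  define w where "w = imag_axis s"
  have w: "w \<noteq> 0" "1 - w \<noteq> 0" by (auto simp: w_def complex_eq_iff)
  have lw: "of_real l * w + 1 \<noteq> 0" by (simp add: w_def complex_eq_iff)
  have l1: "of_real l + 1 \<noteq> (0 :: complex)"
  proof
    assume "of_real l + 1 = (0 :: complex)"
    then have "Re (of_real l + 1) = 0" by (simp only: zero_complex.sel)
    then show False using assms(2) by simp
  qed
  let ?v = "(of_real l * w + 1) / (1 - w)"
  have v0: "?v \<noteq> 0" using lw w(2) by simp
  have "tri_rot ?v = 1 - 1 / ?v" unfolding tri_rot_def diff_divide_distrib divide_self[OF v0] ..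
  also have "\<dots> = (of_real l + 1) * w / (of_real l * w + 1)" using lw w(2) by (simp add: field_simps)
  finally have "of_real x - of_real k / tri_rot ?v = of_real x - of_real k * (of_real l * w + 1) / ((of_real l + 1) * w)"
    by simp
  also have "\<dots> = of_real (x - k * l / (l + 1)) - of_real (k / (l + 1)) / w"
    using w(1) l1 by (simp add: distrib_left add_divide_distrib)
  also have "\<dots> = down (x - k * l / (l + 1)) (s - ln (k / (l + 1)))"
    unfolding w_def by (rule down_imag_axis) (use assms in simp)
  finally show ?thesis by (simp only: w_def)
qed

section \<open>Points on the horocycle\<close>

text \<open>Before time \<open>- ln h\<close> the ray lies in the open horoball, which misses the
  horocycle.\<close>

lemma edge_point_down: "edge_point p h (down_edge x) = horocycle p h x"
  unfolding edge_point_def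
proof (rule the_equality)
  have high: "p (down x s) \<notin> range (horocycle p h)" if "s < - ln h" for s
  proof -
    have "exp (ln h) < exp (- s)" using that by (intro exp_less_mono) simp
    then have "h < Im (down x s)" using h_pos by simp
    then show ?thesis using horoball_disjoint_horocycle by (auto simp: horocycle_def)
  qed
  have at: "p (down x (- ln h)) = horocycle p h x" by (simp add: down_horocycle horocycle_def)
  show "\<exists>c\<in>down_edge x. \<exists>s. horocycle p h x = c s \<and>
      c s \<in> range (horocycle p h) \<and> (\<forall>r<s. c r \<notin> range (horocycle p h))"
    by (rule bexI[OF _ oriented_class_self], rule exI[of _ "- ln h"]) (auto simp: at high)
  fix y assume "\<exists>c\<in>down_edge x. \<exists>s. y = c s \<and>
      c s \<in> range (horocycle p h) \<and> (\<forall>r<s. c r \<notin> range (horocycle p h))"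
  then obtain c s where c: "c \<in> down_edge x" and s: "y = c s"
      "c s \<in> range (horocycle p h)" "\<forall>r<s. c r \<notin> range (horocycle p h)" by blast
  obtain q where q: "\<And>s. c s = p (down x (s + q))" using c by (auto simp: oriented_class_iff)
  have "c (- ln h - q) = horocycle p h x" using at by (simp add: q)
  then have "\<not> - ln h - q < s" using s(3) by (metis rangeI)
  moreover have "\<not> s + q < - ln h" using high s(2) q by metis
  ultimately have "s + q = - ln h" by simp
  then show "y = horocycle p h x" using s(1) q at by simp
qed

lemma edge_points_iff:
  "horocycle p h y \<in> edge_points p x0 h T \<longleftrightarrow>
    cusp_geodesic p x0 (\<lambda>s. p (down y s)) \<and> down_trace y \<in> T"
proof
  assume "horocycle p h y \<in> edge_points p x0 h T"
  then obtain c where c: "cusp_geodesic p x0 c" "range c \<in> T" "horocycle p h y = edge_point p h (oriented_class c)"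
    unfolding edge_points_def oriented_edges_def by blast
  obtain x where x: "oriented_class c = down_edge x" "cusp_geodesic p x0 (\<lambda>s. p (down x s))"
    using cusp_geodesic_down[OF c(1)] by blast
  have "p (Complex x h) = p (Complex y h)" using c(3) x(1) edge_point_down by (simp add: horocycle_def)
  then obtain n :: int where "y = x + of_int n * t" by (rule horocycle_eqD)
  then have "p (down y s) = p (down x s)" for s using p_down_period by simp
  moreover have "down_trace x = range c" using x(1) edge_support_oriented_class by metis
  ultimately show "cusp_geodesic p x0 (\<lambda>s. p (down y s)) \<and> down_trace y \<in> T"
    using x(2) c(2) by simp
next
  assume "cusp_geodesic p x0 (\<lambda>s. p (down y s)) \<and> down_trace y \<in> T"
  then have "down_edge y \<in> oriented_edges p x0 T" by (auto simp: oriented_edges_def)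
  then show "horocycle p h y \<in> edge_points p x0 h T"
    using edge_point_down[of y] unfolding edge_points_def by (metis imageI)
qed

lemma horocycle_periodic: "horocycle p h (x + of_int n * t) = horocycle p h x"
  using horocycle_eq_iff[of x "x + of_int n * t"] by (auto simp: horocycle_def)

lemma vertical_frame_points:
  assumes "ideal_triangulation p S x0 T" "0 < k" "vertical_frame T x k"
  shows "horocycle p h x \<in> edge_points p x0 h T" "horocycle p h (x - k) \<in> edge_points p x0 h T"
    "\<And>z. x - k < z \<Longrightarrow> z < x \<Longrightarrow> horocycle p h z \<notin> edge_points p x0 h T"
  using vertical_frame_side(1,2)[OF assms(2,3)] vertical_frame_gap[OF assms(2,3)]
    cusp_geodesic_down_edge[OF assms(1)] by (auto simp: edge_points_iff)

lemma right_move_points: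
  assumes T: "ideal_triangulation p S x0 T" and v: "0 < k" "vertical_frame T x k"
  obtains y T' e' where "right_move p S x0 T (down_edge x) = (T', e')"
    "x - k < y" "y < x" "edge_point p h e' = horocycle p h y"
    "horocycle p h x \<in> edge_points p x0 h T'" "horocycle p h (x - k) \<in> edge_points p x0 h T'"
    "\<And>z. x - k < z \<Longrightarrow> z < x \<Longrightarrow> z \<noteq> y \<Longrightarrow> horocycle p h z \<notin> edge_points p x0 h T'"
proof -
  let ?g = "\<lambda>z. of_real x - of_real k / z" and ?g1 = "\<lambda>z. of_real x - of_real k / tri_rot z"
  have g1: "frame T ?g1" using frame_rotate[OF v(2)] .
  obtain l where l: "0 < l" "frame T (\<lambda>z. ?g1 (- of_real l / z))" using left_frame_exists[OF T g1] by blast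
  define y where "y = x - k * l / (l + 1)"
  have y: "x - k < y" "y < x" using v(1) l(1) by (auto simp: y_def field_simps)
  define f where "f = oriented_class (\<lambda>s. p (?g1 (imag_axis s)))"
  have nxt: "next_edge p S x0 T (down_edge x) = f"
    using next_edge_eq[OF v(2)] unfolding f_def vertical_frame_side(3)[OF v] .
  have diag: "?g1 ((of_real l * imag_axis s + 1) / (1 - imag_axis s)) = down y (s - ln (k / (l + 1)))" for s
    unfolding y_def by (rule vertical_diagonal[OF v(1) l(1)])
  have "flip_edge p S x0 T f = oriented_class (\<lambda>s. p (down y (s - ln (k / (l + 1)))))"
    unfolding f_def flip_edge_eq[OF T g1 l] diag ..
  also have "\<dots> = down_edge y"
    by (rule oriented_class_eqI, unfold oriented_class_iff) (intro exI[of _ "- ln (k / (l + 1))"], simp)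
  finally have fe: "flip_edge p S x0 T f = down_edge y" .
  define T' where "T' = insert (down_trace y) (T - {range (\<lambda>s. p (?g1 (imag_axis s)))})"
  have move: "right_move p S x0 T (down_edge x) = (T', down_edge y)"
    unfolding right_move_def nxt flip_def fe edge_support_oriented_class T'_def
    by (simp add: f_def edge_support_oriented_class)
  \<comment> \<open>The removed edge differs from both vertical sides, so the two ends of the gap
    survive the flip.\<close>
  have "down_trace x \<noteq> range (\<lambda>s. p (?g1 (imag_axis s)))"
    using frame_sides_distinct(1)[OF T v(2)] unfolding vertical_frame_side(4)[OF v] by metis
  then have 1: "horocycle p h x \<in> edge_points p x0 h T'"
    using vertical_frame_points(1)[OF T v] unfolding edge_points_iff T'_def by blast
  have "down_trace (x - k) \<noteq> range (\<lambda>s. p (?g1 (imag_axis s)))"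
    using frame_sides_distinct(3)[OF T v(2)] unfolding vertical_frame_side(5)[OF v] .
  then have 2: "horocycle p h (x - k) \<in> edge_points p x0 h T'"
    using vertical_frame_points(2)[OF T v] unfolding edge_points_iff T'_def by blast
  have 3: "horocycle p h z \<notin> edge_points p x0 h T'" if z: "x - k < z" "z < x" "z \<noteq> y" for z
  proof
    assume "horocycle p h z \<in> edge_points p x0 h T'"
    then have "down_trace z \<in> T'" by (simp add: edge_points_iff)
    then have eq: "down_trace z = down_trace y"
      using vertical_frame_gap[OF v z(1,2)] unfolding T'_def by blast
    \<comment> \<open>At height \<open>k\<close> a vertical lift of the diagonal over
      \<open>z\<close> is inside the triangle, where the diagonal has only one lift.\<close>
    have "down z (- ln k) \<in> ?g ` std_triangle"
      by (rule vertical_strip_in_triangle) (use z v(1) in auto)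
    also have "?g ` std_triangle = ?g1 ` std_triangle"
      by (simp flip: image_image[of ?g tri_rot] add: tri_rot_image_std_triangle)
    finally have mem: "down z (- ln k) \<in> ?g1 ` std_triangle" .
    obtain s where s: "p (down z (- ln k)) = p (down y s)" using eq by blast
    have "p (down z (- ln k)) = p (?g1 ((of_real l * imag_axis (s + ln (k / (l + 1))) + 1) / (1 - imag_axis (s + ln (k / (l + 1))))))"
      unfolding diag using s by simp
    then have "down z (- ln k) = ?g1 ((of_real l * imag_axis (s + ln (k / (l + 1))) + 1) / (1 - imag_axis (s + ln (k / (l + 1)))))"
      by (rule diagonal_lift_unique[OF T g1 l mem])
    then have "down z (- ln k) = down y s" unfolding diag by simp
    then have "z = y" by (metis Re_down)
    then show False using z(3) by simp
  qed
  show ?thesis by (rule that[OF move y edge_point_down 1 2 3])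
qed

section \<open>The form on intervals of the horocycle\<close>

lemma horocycle_curve_length:
  assumes "a \<le> b" shows "curve_length d (horocycle p h) a b = (b - a) / h"
proof (rule curve_length_eq[OF h_pos assms])
  have M: "Metric_space (S - {x0}) d" using metric by (simp add: complete_hyperbolic_metric_def)
  have in_M: "horocycle p h x \<in> S - {x0}" for x unfolding horocycle_def using p_in h_pos by simp
  show "d (horocycle p h x) (horocycle p h z) \<le> d (horocycle p h x) (horocycle p h y) + d (horocycle p h y) (horocycle p h z)" for x y z
    using Metric_space.triangle[OF M in_M in_M in_M] .
  show "d (horocycle p h x) (horocycle p h x) = 0" for x
    using Metric_space.mdist_zero[OF M in_M] .
  fix x
  have hd: "hyp_dist (Complex u h) (Complex v h) = arcosh (1 + ((u - v) / h)\<^sup>2 / 2)" for u v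
    unfolding hyp_dist_def cmod_power2 using h_pos by (simp add: power_divide power2_eq_square mult_ac)
  obtain r where r: "r > 0" "\<forall>u\<in>upper_half_plane. \<forall>v\<in>upper_half_plane.
        hyp_dist (Complex x h) u < r \<longrightarrow> hyp_dist (Complex x h) v < r \<longrightarrow> d (p u) (p v) = hyp_dist u v"
    using cover h_pos unfolding hyperbolic_universal_cover_def by (metis complex.sel(2) mem_upper_half_plane)
  \<comment> \<open>Arcs are at least as long as chords, so a parameter distance below
    \<open>r * h\<close> stays in the ball of radius \<open>r\<close>.\<close>
  have near: "hyp_dist (Complex x h) (Complex u h) < r" if "\<bar>u - x\<bar> < r * h" for u
  proof -
    have "hyp_dist (Complex x h) (Complex u h) = arcosh (1 + \<bar>(x - u) / h\<bar>\<^sup>2 / 2)" unfolding hd power2_abs ..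
    also have "\<dots> \<le> \<bar>(x - u) / h\<bar>" by (rule arcosh_quadratic_le) simp
    also have "\<dots> < r" using that h_pos by (simp add: abs_divide pos_divide_less_eq abs_minus_commute)
    finally show ?thesis .
  qed
  show "\<exists>\<delta>>0. \<forall>u v. \<bar>u - x\<bar> < \<delta> \<longrightarrow> \<bar>v - x\<bar> < \<delta> \<longrightarrow>
       d (horocycle p h u) (horocycle p h v) = arcosh (1 + ((u - v) / h)\<^sup>2 / 2)"
  proof (intro exI[of _ "r * h"] conjI allI impI)
    show "0 < r * h" using r(1) h_pos by simp
    fix u v assume "\<bar>u - x\<bar> < r * h" "\<bar>v - x\<bar> < r * h"
    then have "d (p (Complex u h)) (p (Complex v h)) = hyp_dist (Complex u h) (Complex v h)"
      using r(2) near h_pos by simp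
    then show "d (horocycle p h u) (horocycle p h v) = arcosh (1 + ((u - v) / h)\<^sup>2 / 2)"
      by (simp add: horocycle_def hd)
  qed
qed

text \<open>The preimage picked by \<open>SOME\<close> is \<open>x\<close> up to a multiple
  \<open>c\<close> of the period, and the whole gap moves along with it. The factor
  \<open>1 / h\<close> of both lengths cancels.\<close>

lemma Phi_eq:
  assumes e: "edge_point p h e = horocycle p h x" and ab: "a < x" "x < b"
    and K: "horocycle p h a \<in> edge_points p x0 h T" "horocycle p h b \<in> edge_points p x0 h T"
    and gap: "\<And>z. a < z \<Longrightarrow> z < b \<Longrightarrow> z \<noteq> x \<Longrightarrow> horocycle p h z \<notin> edge_points p x0 h T"
  shows "Phi p d x0 h t (T, e) = (b - a) / (2 * t)"
proof -
  define x' where "x' = (SOME x. horocycle p h x = edge_point p h e)"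
  have "horocycle p h x' = edge_point p h e" unfolding x'_def by (rule someI[of _ x]) (simp add: e)
  then have "p (Complex x h) = p (Complex x' h)" using e by (simp add: horocycle_def)
  then obtain n :: int where n: "x' = x + of_int n * t" by (rule horocycle_eqD)
  define c where "c = of_int n * t"
  have per: "horocycle p h (z + c) = horocycle p h z" for z unfolding c_def by (rule horocycle_periodic)
  have gap': "horocycle p h z \<notin> edge_points p x0 h T" if "a + c < z" "z < b + c" "z \<noteq> x'" for z
    using gap[of "z - c"] per[of "z - c"] that n by (simp add: c_def)
  have x': "x' = x + c" using n c_def by simp
  have "Sup {y. y < x' \<and> horocycle p h y \<in> edge_points p x0 h T} = a + c"
  proof (rule cSup_eq_maximum)
    show "a + c \<in> {y. y < x' \<and> horocycle p h y \<in> edge_points p x0 h T}"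
      using ab K per x' by simp
    show "y \<le> a + c" if "y \<in> {y. y < x' \<and> horocycle p h y \<in> edge_points p x0 h T}" for y
      using gap'[of y] that ab x' by (cases "a + c < y") auto
  qed
  moreover have "Inf {y. x' < y \<and> horocycle p h y \<in> edge_points p x0 h T} = b + c"
  proof (rule cInf_eq_minimum)
    show "b + c \<in> {y. x' < y \<and> horocycle p h y \<in> edge_points p x0 h T}"
      using ab K per x' by simp
    show "b + c \<le> y" if "y \<in> {y. x' < y \<and> horocycle p h y \<in> edge_points p x0 h T}" for y
      using gap'[of y] that ab x' by (cases "y < b + c") auto
  qed
  ultimately have "interval_length p d x0 h (T, e) = curve_length d (horocycle p h) (a + c) (b + c)"
    unfolding interval_length_def by (simp add: x'_def[symmetric] Let_def)
  also have "\<dots> = (b - a) / h" using horocycle_curve_length[of "a + c" "b + c"] ab by simp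
  finally show ?thesis
    unfolding Phi_def using horocycle_curve_length[of 0 t] t_pos h_pos by simp
qed

text \<open>The successor map has order three, so its square is its inverse.\<close>

lemma next_edge_bij:
  assumes T: "ideal_triangulation p S x0 T"
  shows "bij_betw (next_edge p S x0 T) (oriented_edges p x0 T) (oriented_edges p x0 T)"
proof -
  have *: "next_edge p S x0 T e \<in> oriented_edges p x0 T \<and>
      next_edge p S x0 T (next_edge p S x0 T (next_edge p S x0 T e)) = e" if e: "e \<in> oriented_edges p x0 T" for e
  proof -
    obtain x k where x: "0 < k" "e = down_edge x" "vertical_frame T x k"
      using vertical_frame_exists[OF T e] by blast
    define g where "g = (\<lambda>z. of_real x - of_real k / z :: complex)"
    have g: "frame T g" using x(3) by (simp add: g_def)
    have e: "e = oriented_class (\<lambda>s. p (g (imag_axis s)))"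
      unfolding g_def vertical_frame_side(3)[OF x(1,3)] by (rule x(2))
    have n1: "next_edge p S x0 T e = oriented_class (\<lambda>s. p (g (tri_rot (imag_axis s))))"
      unfolding e by (rule next_edge_eq[OF g])
    show ?thesis
      unfolding n1 next_edge_eq[OF frame_rotate[OF g]] next_edge_eq[OF frame_rotate[OF frame_rotate[OF g]]]
      using oriented_edgeI[OF frame_rotate[OF g] T] by (simp add: tri_rot_cubed e)
  qed
  show ?thesis
    by (rule bij_betw_byWitness[of _ "\<lambda>e. next_edge p S x0 T (next_edge p S x0 T e)"]) (use * in auto)
qed

end

section \<open>Summation over the horocycle\<close>

lemma sum_gaps_telescope:
  fixes P :: "real set"
  assumes "finite P" "P \<noteq> {}"
  shows "(\<Sum>x\<in>P - {Min P}. x - Max {y \<in> P. y < x}) = Max P - Min P"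
  using assms
proof (induction P rule: finite_linorder_max_induct)
  case (insert b A)
  show ?case
  proof (cases "A = {}")
    case False
    have b: "Max (insert b A) = b" "Min (insert b A) = Min A" "b \<notin> A" "b \<noteq> Min A"
    proof -
      have "Max A < b" "Min A < b" "b \<notin> A" "Min A \<in> A" using insert.hyps False by auto
      then show "Max (insert b A) = b" "Min (insert b A) = Min A" "b \<notin> A" "b \<noteq> Min A"
        using insert.hyps(1) False less_irrefl[of b] by (simp, simp, blast, metis)
    qed
    have split: "insert b A - {Min A} = insert b (A - {Min A})" using b by auto
    have pred: "{y \<in> insert b A. y < b} = A" "\<And>x. x \<in> A \<Longrightarrow> {y \<in> insert b A. y < x} = {y \<in> A. y < x}"
      using insert.hyps by auto
    have "(\<Sum>x\<in>insert b (A - {Min A}). x - Max {y \<in> insert b A. y < x}) =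
        (b - Max A) + (\<Sum>x\<in>A - {Min A}. x - Max {y \<in> insert b A. y < x})"
      using insert.hyps(1) b(3) by (simp only: pred(1) sum.insert finite_Diff Diff_iff simp_thms)
    also have "(\<Sum>x\<in>A - {Min A}. x - Max {y \<in> insert b A. y < x}) = (\<Sum>x\<in>A - {Min A}. x - Max {y \<in> A. y < x})"
      by (rule sum.cong) (simp_all only: pred(2) Diff_iff)
    finally show ?thesis unfolding split b(1,2) using insert.IH[OF False] by linarith
  qed simp
qed simp

text \<open>Unrolled along the line, \<open>P\<close> is one period of the set \<open>X\<close>. The
  gaps below all points except the smallest telescope inside the period, and the smallest point
  closes the cycle.\<close>

lemma sum_cyclic_gaps:
  fixes t :: real
  assumes P: "finite P" "P \<noteq> {}" "P \<subseteq> {0..<t}"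
    and X: "\<And>x. x \<in> X \<longleftrightarrow> (\<exists>n::int. x + of_int n * t \<in> P)"
    and k: "\<And>x. x \<in> P \<Longrightarrow> 0 < k x" "\<And>x. x \<in> P \<Longrightarrow> x - k x \<in> X"
      "\<And>x y. x \<in> P \<Longrightarrow> x - k x < y \<Longrightarrow> y < x \<Longrightarrow> y \<notin> X"
  shows "(\<Sum>x\<in>P. k x) = t"
proof -
  have Pt: "0 \<le> x" "x < t" if "x \<in> P" for x using P(3) that by auto
  have PX: "x \<in> X" if "x \<in> P" for x unfolding X by (rule exI[of _ 0]) (simp add: that)
  have XP: "x \<in> P" if xX: "x \<in> X" and "0 \<le> x" "x < t" for x
  proof -
    obtain n :: int where n: "x + of_int n * t \<in> P" using xX[unfolded X] by blast
    have "0 < t" using that(2,3) by linarith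
    have "- 1 * t < of_int n * t" "of_int n * t < 1 * t" using Pt[OF n] that(2,3) by linarith+
    then have "of_int n > (- 1 :: real)" "of_int n < (1 :: real)"
      unfolding mult_less_cancel_right_pos[OF \<open>0 < t\<close>] .
    then have "n = 0" by linarith
    then show ?thesis using n by simp
  qed
  have Min: "Min P \<in> P" and Max: "Max P \<in> P" using P by auto
  have 1: "k x = x - Max {y \<in> P. y < x}" if x: "x \<in> P - {Min P}" for x
  proof -
    have xP: "x \<in> P" using x by simp
    have lt: "Min P < x" using x P by (simp add: less_le)
    have fin: "finite {y \<in> P. y < x}" using P(1) by simp
    have "Min P \<le> x - k x" using k(3)[OF xP, of "Min P"] lt PX[OF Min] by force
    then have "x - k x \<in> P" using XP[OF k(2)[OF xP]] Pt[OF Min] Pt[OF xP] k(1)[OF xP] by simp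
    then have "Max {y \<in> P. y < x} = x - k x"
      using k(1)[OF xP] k(3)[OF xP] PX by (intro Max_eqI[OF fin]) force+
    then show ?thesis by simp
  qed
  \<comment> \<open>The predecessor of the smallest point is the translate \<open>Max P - t\<close>
    of the largest. A later one would be negative, and its translate by \<open>t\<close> would be a
    point of \<open>P\<close> above the maximum.\<close>
  have 2: "k (Min P) = Min P - (Max P - t)"
  proof -
    have XM: "Max P - t \<in> X" unfolding X using Max by (intro exI[of _ 1]) simp
    have "Max P - t < Min P" using Pt[OF Min] Pt[OF Max] by simp
    then have "Max P - t \<le> Min P - k (Min P)" using k(3)[OF Min, of "Max P - t"] XM by force
    moreover have "\<not> Max P - t < Min P - k (Min P)"
    proof
      assume lt: "Max P - t < Min P - k (Min P)"
      let ?y = "Min P - k (Min P)"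
      have "?y < 0"
      proof (rule ccontr)
        assume "\<not> ?y < 0"
        then have "?y \<in> P" using XP[OF k(2)[OF Min]] k(1)[OF Min] Pt[OF Min] by simp
        then show False using k(1)[OF Min] Min_le[OF P(1)] by force
      qed
      moreover have "?y + t \<in> X"
      proof -
        obtain n :: int where "?y + of_int n * t \<in> P" using k(2)[OF Min, unfolded X] by blast
        then show ?thesis unfolding X by (intro exI[of _ "n - 1"]) (simp add: algebra_simps)
      qed
      ultimately have "?y + t \<in> P" using lt Pt[OF Max] by (intro XP) auto
      then show False using Max_ge[OF P(1)] lt by force
    qed
    ultimately show ?thesis by simp
  qed
  have "(\<Sum>x\<in>P. k x) = k (Min P) + (\<Sum>x\<in>P - {Min P}. k x)"
    using P(1) Min by (rule sum.remove)
  also have "(\<Sum>x\<in>P - {Min P}. k x) = Max P - Min P"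
    using 1 sum_gaps_telescope[OF P(1,2)] by simp
  finally show ?thesis using 2 by simp
qed

context cusped_surface_with_horocycle
begin

text \<open>By \<open>geodesic_in_edge\<close> an edge has no parametrizations besides the shifts of
  one geodesic and of its reversal.\<close>

lemma finite_oriented_edges:
  assumes "edge_family p x0 T" shows "finite (oriented_edges p x0 T)"
proof -
  obtain c where c: "\<And>E. E \<in> T \<Longrightarrow> cusp_geodesic p x0 (c E) \<and> E = range (c E)"
    using assms unfolding edge_family_def by metis
  have "oriented_edges p x0 T \<subseteq> (\<Union>E\<in>T. {oriented_class (c E), oriented_class (\<lambda>s. c E (0 - s))})"
  proof
    fix e assume "e \<in> oriented_edges p x0 T"
    then obtain f where f: "e = oriented_class f" "cusp_geodesic p x0 f" "range f \<in> T"
      by (auto simp: oriented_edges_def)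
    define E where "E = range f"
    obtain g where g: "g \<in> hyp_isometries" "f = p \<circ> g \<circ> imag_axis" using f(2) by (auto simp: cusp_geodesic_def)
    have fg: "f s = p (g (imag_axis s))" for s by (simp add: g(2))
    have cE: "cusp_geodesic p x0 (c E)" and "range f = range (c E)" using c f(3) E_def by auto
    then have "trace g \<subseteq> range (c E)" by (simp flip: fg)
    then have "f \<in> oriented_class (c E) \<or> f \<in> oriented_class (\<lambda>s. c E (0 - s))"
    proof (rule geodesic_in_edge[OF cE g(1)])
      fix r assume "\<And>s. p (g (imag_axis s)) = c E (s + r)"
      then show ?thesis unfolding oriented_class_iff fg by blast
    next
      fix r assume "\<And>s. p (g (imag_axis s)) = c E (r - s)"
      then have "\<forall>s. f s = c E (0 - (s + - r))" by (simp add: fg)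
      then show ?thesis unfolding oriented_class_iff by blast
    qed
    then have "e = oriented_class (c E) \<or> e = oriented_class (\<lambda>s. c E (0 - s))"
      using f(1) oriented_class_eqI by blast
    then show "e \<in> (\<Union>E\<in>T. {oriented_class (c E), oriented_class (\<lambda>s. c E (0 - s))})"
      using f(3) E_def by blast
  qed
  moreover have "finite T" using assms by (simp add: edge_family_def)
  ultimately show ?thesis by (auto intro: finite_subset)
qed

lemma oriented_edges_nonempty:
  assumes T: "ideal_triangulation p S x0 T" shows "oriented_edges p x0 T \<noteq> {}"
proof -
  have "T \<noteq> {}"
  proof
    assume "T = {}"
    have "p (imag_axis 0) \<in> S - {x0} - \<Union>T" using p_in[of "imag_axis 0"] \<open>T = {}\<close> by simp
    then have "\<Union> (components (S - {x0} - \<Union>T)) \<noteq> {}" by (simp only: Union_components) blast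
    then obtain C where "C \<in> components (S - {x0} - \<Union>T)" by blast
    then show False using component_frame[OF T] \<open>T = {}\<close> by (auto simp: frame_def)
  qed
  then obtain E where "E \<in> T" by blast
  then obtain c where "cusp_geodesic p x0 c" "range c \<in> T"
    using T unfolding ideal_triangulation_def by metis
  then show ?thesis unfolding oriented_edges_def by blast
qed

text \<open>Oriented edges correspond to the feet of their vertical lifts in one period. The frame
  of an edge may sit over another translate of its foot, hence the shift by
  \<open>n * t\<close>.\<close>

lemma sum_vertical_gaps:
  assumes T: "ideal_triangulation p S x0 T"
    and k: "\<And>e. e \<in> oriented_edges p x0 T \<Longrightarrow>
      0 < k e \<and> (\<exists>x. e = down_edge x \<and> vertical_frame T x (k e))"
  shows "(\<Sum>e\<in>oriented_edges p x0 T. k e) = t"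
proof -
  define X where "X = {x. down_trace x \<in> T}"
  define P where "P = X \<inter> {0..<t}"
  let ?c = "\<lambda>x. down_edge x"
  have per: "x + of_int n * t \<in> X \<longleftrightarrow> x \<in> X" for x and n :: int by (simp add: X_def p_down_period)
  have class_per: "?c (x + of_int n * t) = ?c x" for x and n :: int by (simp add: p_down_period)
  have edge: "?c x \<in> oriented_edges p x0 T" if "x \<in> X" for x
    using cusp_geodesic_down_edge[OF T] that unfolding X_def oriented_edges_def by blast
  have bij: "bij_betw ?c P (oriented_edges p x0 T)"
  proof (rule bij_betw_imageI)
    show "inj_on ?c P"
    proof (rule inj_onI)
      fix x y assume xy: "x \<in> P" "y \<in> P" "?c x = ?c y"
      obtain n :: int where n: "y = x + of_int n * t" using oriented_class_down_eqD[OF xy(3)] by blast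
      then have "p (Complex x h) = p (Complex y h)" using horocycle_eq_iff by blast
      then show "x = y" using inj_onD[OF horocycle_inj] xy by (simp add: P_def)
    qed
    show "?c ` P = oriented_edges p x0 T"
    proof
      show "?c ` P \<subseteq> oriented_edges p x0 T" using edge by (auto simp: P_def)
      show "oriented_edges p x0 T \<subseteq> ?c ` P"
      proof
        fix e assume "e \<in> oriented_edges p x0 T"
        then obtain x k where x: "0 < k" "e = ?c x" "vertical_frame T x k" by (rule vertical_frame_exists[OF T])
        obtain n :: int where n: "x + of_int n * t \<in> {0..<t}" by (rule mod_period)
        have "x \<in> X" using vertical_frame_side(1)[OF x(1,3)] by (simp add: X_def)
        then have "x + of_int n * t \<in> P" using n per by (simp add: P_def)
        then show "e \<in> ?c ` P" using x(2) class_per by (metis imageI)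
      qed
    qed
  qed
  have "(\<Sum>x\<in>P. k (?c x)) = t"
  proof (rule sum_cyclic_gaps)
    show "finite P" using bij finite_oriented_edges[OF ideal_triangulation_edge_family[OF T]] bij_betw_finite by metis
    show "P \<noteq> {}" using bij oriented_edges_nonempty[OF T] by (auto simp: bij_betw_def)
    show "P \<subseteq> {0..<t}" by (simp add: P_def)
    show "x \<in> X \<longleftrightarrow> (\<exists>n::int. x + of_int n * t \<in> P)" for x
    proof
      assume "x \<in> X"
      then show "\<exists>n::int. x + of_int n * t \<in> P" using mod_period[of x] per unfolding P_def by (metis IntI)
    qed (auto simp: P_def per)
    fix x assume "x \<in> P"
    then have e: "?c x \<in> oriented_edges p x0 T" using edge by (simp add: P_def)
    then obtain x' where x': "?c x = ?c x'" "vertical_frame T x' (k (?c x))" and pos: "0 < k (?c x)"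
      using k by blast
    show "0 < k (?c x)" by (rule pos)
    obtain n :: int where n: "x' = x + of_int n * t" using oriented_class_down_eqD[OF x'(1)] by blast
    have "x' - k (?c x) \<in> X" using vertical_frame_side(2)[OF pos x'(2)] by (simp add: X_def)
    moreover have "x' - k (?c x) = (x - k (?c x)) + of_int n * t" using n by simp
    ultimately show "x - k (?c x) \<in> X" using per by metis
    fix y assume "x - k (?c x) < y" "y < x"
    then have "y + of_int n * t \<notin> X" using vertical_frame_gap[OF pos x'(2), of "y + of_int n * t"] n by (simp add: X_def)
    then show "y \<notin> X" using per by blast
  qed
  then show ?thesis using sum.reindex_bij_betw[OF bij, of k] by simp
qed

end

section \<open>Reversing the orientation\<close>

lemma hyp_isometry_mirror:
  assumes "g \<in> hyp_isometries" shows "(\<lambda>z. - cnj (g (- cnj z))) \<in> hyp_isometries"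
proof -
  obtain a b c d :: real where g: "0 < a * d - b * c"
    "\<And>z. 0 < Im z \<Longrightarrow> g z = (of_real a * z + of_real b) / (of_real c * z + of_real d)"
    "\<And>z. 0 < Im z \<Longrightarrow> of_real c * z + of_real d \<noteq> 0"
    using assms by (rule hyp_isometryE) blast
  show ?thesis
  proof (rule hyp_isometryI[of a d "- b" "- c"])
    show "0 < a * d - - b * - c" using g(1) by simp
    fix z assume z: "0 < Im z"
    have "- cnj (g (- cnj z)) = - ((of_real a * (- z) + of_real b) / (of_real c * (- z) + of_real d))"
      using g(2)[of "- cnj z"] z by simp
    also have "\<dots> = (- (of_real a * (- z) + of_real b)) / (of_real c * (- z) + of_real d)"
      by (rule minus_divide_left)
    finally show "- cnj (g (- cnj z)) = (of_real a * z + of_real (- b)) / (of_real (- c) * z + of_real d)"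
      by simp
  qed
qed

lemma mirror_imag_axis: "- cnj (imag_axis s) = imag_axis s"
  by (simp add: complex_eq_iff)

lemma hyp_dist_mirror: "hyp_dist (- cnj z) (- cnj w) = hyp_dist z w"
proof -
  have "cmod (- cnj z - - cnj w) = cmod (cnj (w - z))" by simp
  also have "\<dots> = cmod (z - w)" unfolding complex_mod_cnj by (rule norm_minus_commute)
  finally show ?thesis by (simp add: hyp_dist_def)
qed

lemma cusp_geodesic_mirror: "cusp_geodesic (\<lambda>z. p (- cnj z)) x0 c \<longleftrightarrow> cusp_geodesic p x0 c"
proof -
  have *: "(\<exists>g\<in>hyp_isometries. c = (\<lambda>z. p (- cnj z)) \<circ> g \<circ> imag_axis)"
    if "g \<in> hyp_isometries" "c = p \<circ> g \<circ> imag_axis" for p :: "complex \<Rightarrow> 'a" and c g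
  proof (intro bexI[OF _ hyp_isometry_mirror[OF that(1)]])
    show "c = (\<lambda>z. p (- cnj z)) \<circ> (\<lambda>z. - cnj (g (- cnj z))) \<circ> imag_axis"
      by (simp add: that(2) fun_eq_iff mirror_imag_axis)
  qed
  have "(\<exists>g\<in>hyp_isometries. c = (\<lambda>z. p (- cnj z)) \<circ> g \<circ> imag_axis) \<longleftrightarrow>
      (\<exists>g\<in>hyp_isometries. c = p \<circ> g \<circ> imag_axis)"
    using *[of _ c p] *[of _ c "\<lambda>z. p (- cnj z)"] by auto
  then show ?thesis unfolding cusp_geodesic_def by blast
qed

lemma oriented_edges_mirror: "oriented_edges (\<lambda>z. p (- cnj z)) x0 T = oriented_edges p x0 T"
  by (simp add: oriented_edges_def cusp_geodesic_mirror)

lemma horocycle_mirror: "horocycle (\<lambda>z. p (- cnj z)) h x = horocycle p h (- x)"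
proof -
  have "- cnj (Complex x h) = Complex (- x) h" by (simp add: complex_eq_iff)
  then show ?thesis by (simp add: horocycle_def)
qed

lemma range_horocycle_mirror: "range (horocycle (\<lambda>z. p (- cnj z)) h) = range (horocycle p h)"
proof -
  have "horocycle p h x = horocycle p h (- (- x))" for x by simp
  then show ?thesis unfolding horocycle_mirror by blast
qed

lemma edge_point_mirror: "edge_point (\<lambda>z. p (- cnj z)) h e = edge_point p h e"
  unfolding edge_point_def range_horocycle_mirror ..

lemma edge_points_mirror: "edge_points (\<lambda>z. p (- cnj z)) x0 h T = edge_points p x0 h T"
  unfolding edge_points_def oriented_edges_mirror edge_point_mirror[abs_def] ..

lemma covering_space_mirror:
  assumes "covering_space upper_half_plane p M"
  shows "covering_space upper_half_plane (\<lambda>z. p (- cnj z)) M"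
proof -
  let ?r = "\<lambda>z. - cnj z"
  have rr: "?r (?r z) = z" for z by simp
  have rU: "?r ` upper_half_plane = upper_half_plane"
  proof (rule set_eqI)
    show "z \<in> ?r ` upper_half_plane \<longleftrightarrow> z \<in> upper_half_plane" for z
      by (auto intro!: image_eqI[of _ _ "?r z"])
  qed
  have hom: "homeomorphism (?r ` A) A ?r ?r" for A
    by (auto simp: homeomorphism_def image_image intro!: continuous_intros)
  have hom': "homeomorphism A (?r ` A) ?r ?r" for A
    by (auto simp: homeomorphism_def image_image intro!: continuous_intros)
  show ?thesis
  proof (rule covering_spaceI)
    show "continuous_on upper_half_plane (\<lambda>z. p (- cnj z))"
      by (rule continuous_on_compose2[OF covering_space_imp_continuous[OF assms]])
        (auto intro!: continuous_intros)
    show "(\<lambda>z. p (- cnj z)) ` upper_half_plane = M"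
      using covering_space_imp_surjective[OF assms] rU by (metis image_image)
    fix x assume "x \<in> M"
    then obtain T v where T: "x \<in> T" "openin (top_of_set M) T" "\<Union>v = upper_half_plane \<inter> p -` T"
        "\<forall>u\<in>v. openin (top_of_set upper_half_plane) u" "pairwise disjnt v"
        "\<forall>u\<in>v. \<exists>q. homeomorphism u T p q"
      using assms unfolding covering_space_def by metis
    show "\<exists>T. x \<in> T \<and> openin (top_of_set M) T \<and>
       (\<exists>v. \<Union>v = upper_half_plane \<inter> (\<lambda>z. p (- cnj z)) -` T \<and>
            (\<forall>u\<in>v. openin (top_of_set upper_half_plane) u) \<and> pairwise disjnt v \<and>
            (\<forall>u\<in>v. \<exists>q. homeomorphism u T (\<lambda>z. p (- cnj z)) q))"
    proof (intro exI[of _ T] exI[of _ "(`) ?r ` v"] conjI T(1,2))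
      show "\<Union> ((`) ?r ` v) = upper_half_plane \<inter> (\<lambda>z. p (- cnj z)) -` T"
      proof (rule set_eqI)
        fix z
        have "z \<in> ?r ` w \<longleftrightarrow> ?r z \<in> w" for w by (metis (no_types, lifting) imageE imageI rr)
        then have "z \<in> \<Union> ((`) ?r ` v) \<longleftrightarrow> ?r z \<in> \<Union>v" by simp
        also have "\<dots> \<longleftrightarrow> z \<in> upper_half_plane \<inter> (\<lambda>z. p (- cnj z)) -` T" unfolding T(3) by simp
        finally show "z \<in> \<Union> ((`) ?r ` v) \<longleftrightarrow> z \<in> upper_half_plane \<inter> (\<lambda>z. p (- cnj z)) -` T" .
      qed
      show "\<forall>u\<in>(`) ?r ` v. openin (top_of_set upper_half_plane) u"
      proof
        fix u assume "u \<in> (`) ?r ` v"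
        then obtain w where w: "w \<in> v" "u = ?r ` w" by blast
        have "openin (top_of_set (?r ` upper_half_plane)) (?r ` w)"
          using homeomorphism_imp_open_map[OF hom'[of upper_half_plane]] T(4) w(1) by blast
        then show "openin (top_of_set upper_half_plane) u" by (simp only: rU w(2))
      qed
      show "pairwise disjnt ((`) ?r ` v)"
      proof (rule pairwiseI)
        fix A B assume "A \<in> (`) ?r ` v" "B \<in> (`) ?r ` v" "A \<noteq> B"
        then obtain a b where ab: "a \<in> v" "b \<in> v" "A = ?r ` a" "B = ?r ` b" "a \<noteq> b" by blast
        then have "disjnt a b" using T(5) by (simp add: pairwise_def)
        then show "disjnt A B" unfolding ab disjnt_iff by auto
      qed
      show "\<forall>u\<in>(`) ?r ` v. \<exists>q. homeomorphism u T (\<lambda>z. p (- cnj z)) q"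
      proof
        fix u assume "u \<in> (`) ?r ` v"
        then obtain w where w: "w \<in> v" "u = ?r ` w" by blast
        then obtain q where "homeomorphism w T p q" using T(6) by blast
        then have "homeomorphism (?r ` w) T (p \<circ> ?r) (?r \<circ> q)" using homeomorphism_compose hom by blast
        then show "\<exists>q. homeomorphism u T (\<lambda>z. p (- cnj z)) q" unfolding w(2) comp_def by blast
      qed
    qed
  qed
qed

lemma hyperbolic_universal_cover_mirror:
  assumes "hyperbolic_universal_cover M d p"
  shows "hyperbolic_universal_cover M d (\<lambda>z. p (- cnj z))"
  unfolding hyperbolic_universal_cover_def
proof (intro conjI ballI impI)
  show "covering_space upper_half_plane (\<lambda>z. p (- cnj z)) M"
    using assms by (intro covering_space_mirror) (simp add: hyperbolic_universal_cover_def)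
next
  fix z assume "z \<in> upper_half_plane"
  then have "- cnj z \<in> upper_half_plane" by simp
  then obtain r where r: "r > 0" "\<forall>u\<in>upper_half_plane. \<forall>v\<in>upper_half_plane.
        hyp_dist (- cnj z) u < r \<longrightarrow> hyp_dist (- cnj z) v < r \<longrightarrow> d (p u) (p v) = hyp_dist u v"
    using assms unfolding hyperbolic_universal_cover_def by blast
  show "\<exists>r>0. \<forall>u\<in>upper_half_plane. \<forall>v\<in>upper_half_plane.
        hyp_dist z u < r \<longrightarrow> hyp_dist z v < r \<longrightarrow> d (p (- cnj u)) (p (- cnj v)) = hyp_dist u v"
  proof (intro exI[of _ r] conjI r(1) ballI impI)
    fix u v assume "u \<in> upper_half_plane" "v \<in> upper_half_plane" "hyp_dist z u < r" "hyp_dist z v < r"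
    then have "d (p (- cnj u)) (p (- cnj v)) = hyp_dist (- cnj u) (- cnj v)"
      using r(2) by (simp add: hyp_dist_mirror)
    then show "d (p (- cnj u)) (p (- cnj v)) = hyp_dist u v" by (simp only: hyp_dist_mirror)
  qed
next
  fix z w assume zw: "z \<in> upper_half_plane" "w \<in> upper_half_plane" "p (- cnj z) = p (- cnj w)"
  then have "- cnj z \<in> upper_half_plane" "- cnj w \<in> upper_half_plane" by simp_all
  then obtain g where g: "g \<in> hyp_isometries" "g (- cnj z) = - cnj w" "\<forall>u\<in>upper_half_plane. p (g u) = p u"
    using assms zw(3) unfolding hyperbolic_universal_cover_def by blast
  show "\<exists>g\<in>hyp_isometries. g z = w \<and> (\<forall>u\<in>upper_half_plane. p (- cnj (g u)) = p (- cnj u))"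
  proof (intro bexI[OF _ hyp_isometry_mirror[OF g(1)]] conjI ballI)
    show "- cnj (g (- cnj z)) = w" by (simp add: g(2))
    fix u assume "u \<in> upper_half_plane"
    then have "- cnj u \<in> upper_half_plane" by simp
    then show "p (- cnj (- cnj (g (- cnj u)))) = p (- cnj u)" using g(3) by simp
  qed
qed

text \<open>The reflection \<open>z \<mapsto> - cnj z\<close> moves the standard triangle; composed with a translation it
  becomes a symmetry of it.\<close>

lemma reflection_std_triangle: "(\<lambda>z. 1 - cnj z) ` std_triangle = std_triangle"
proof -
  have sub: "1 - cnj z \<in> std_triangle" if "z \<in> std_triangle" for z
  proof -
    have "1 - cnj z - 1 / 2 = - cnj (z - 1 / 2)" by (simp add: complex_eq_iff)
    then have "cmod (1 - cnj z - 1 / 2) = cmod (z - 1 / 2)" by (metis complex_mod_cnj norm_minus_cancel)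
    then show ?thesis using that by (simp add: std_triangle_def)
  qed
  moreover have "z = 1 - cnj (1 - cnj z)" for z by simp
  ultimately show ?thesis by (metis (no_types, lifting) image_eqI image_subsetI subsetI subset_antisym)
qed

text \<open>The reflection exchanges the vertices 0 and 1 and fixes infinity: it swaps the first two
  sides and preserves the third, each with time reversed.\<close>

lemma reflection_imag_axis:
  "1 - cnj (imag_axis s) = tri_rot (imag_axis (0 - s))"
  "1 - cnj (tri_rot (imag_axis s)) = imag_axis (0 - s)"
  "1 - cnj (tri_rot (tri_rot (imag_axis s))) = tri_rot (tri_rot (imag_axis (0 - s)))"
proof -
  have nz: "imag_axis r \<noteq> 0" for r using exp_gt_zero[of r] by (metis Im_imag_axis less_irrefl zero_complex.sel(2))
  have rot: "tri_rot (imag_axis r) = 1 - inverse (imag_axis r)" for r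
    using nz[of r] by (simp add: tri_rot_def field_simps)
  have inv: "inverse (imag_axis r) = cnj (imag_axis (0 - r))" for r
    by (rule inverse_unique) (simp add: complex_eq_iff exp_minus)
  show 1: "1 - cnj (imag_axis s) = tri_rot (imag_axis (0 - s))" for s by (simp add: rot inv)
  show 2: "1 - cnj (tri_rot (imag_axis s)) = imag_axis (0 - s)" for s by (simp add: rot inv)
  have "1 - cnj (tri_rot (tri_rot (imag_axis s))) = 1 - 1 / (1 - cnj (imag_axis s))"
    by (simp add: tri_rot_tri_rot)
  also have "\<dots> = 1 - 1 / tri_rot (imag_axis (0 - s))" by (simp only: 1)
  also have "\<dots> = tri_rot (tri_rot (imag_axis (0 - s)))"
    using tri_rot_nonzero[of "imag_axis (0 - s)"] by (subst (2) tri_rot_def) (simp add: diff_divide_distrib)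
  finally show "1 - cnj (tri_rot (tri_rot (imag_axis s))) = tri_rot (tri_rot (imag_axis (0 - s)))" .
qed

lemma ideal_triangulation_mirror:
  assumes "ideal_triangulation p S x0 T"
  shows "ideal_triangulation (\<lambda>z. p (- cnj z)) S x0 T"
  unfolding ideal_triangulation_def cusp_geodesic_mirror
proof (intro conjI ballI)
  fix C assume "C \<in> components (S - {x0} - \<Union>T)"
  then have "\<exists>g\<in>hyp_isometries. inj_on p (g ` std_triangle) \<and> C = p ` g ` std_triangle \<and>
        range (p \<circ> g \<circ> imag_axis) \<in> T \<and> range (p \<circ> g \<circ> tri_rot \<circ> imag_axis) \<in> T \<and>
        range (p \<circ> g \<circ> tri_rot \<circ> tri_rot \<circ> imag_axis) \<in> T"
    using assms by (simp add: ideal_triangulation_def)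
  then obtain g where g: "g \<in> hyp_isometries" "inj_on p (g ` std_triangle)" "C = p ` g ` std_triangle"
      "range (p \<circ> g \<circ> imag_axis) \<in> T" "range (p \<circ> g \<circ> tri_rot \<circ> imag_axis) \<in> T"
      "range (p \<circ> g \<circ> tri_rot \<circ> tri_rot \<circ> imag_axis) \<in> T"
    by blast
  \<comment> \<open>The mirror image of \<open>g\<close> is precomposed with the translation by
    \<open>-1\<close>, so that the reflected frame again has its triangle on the right of the
    axis.\<close>
  define f where "f = (\<lambda>z. - cnj (g (1 - cnj z)))"
  have "(\<lambda>z. - cnj (g (- cnj z))) \<circ> (\<lambda>z. z + of_real (- 1)) \<in> hyp_isometries"
    by (intro hyp_isometry_comp hyp_isometry_mirror g(1) hyp_isometry_translation)
  then have f: "f \<in> hyp_isometries" by (simp add: f_def comp_def)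
  have pf: "p (- cnj (f z)) = p (g (1 - cnj z))" for z by (simp add: f_def)
  have fstd: "(\<lambda>z. - cnj z) ` f ` std_triangle = g ` std_triangle"
    using image_image[of g "\<lambda>z. 1 - cnj z" std_triangle]
    by (simp add: image_image f_def reflection_std_triangle)
  have "inj_on (p \<circ> (\<lambda>z. - cnj z)) (f ` std_triangle)"
    by (rule comp_inj_on) (auto simp: fstd g(2) intro: inj_onI)
  then have 1: "inj_on (\<lambda>z. p (- cnj z)) (f ` std_triangle)" by (simp add: comp_def)
  have 2: "C = (\<lambda>z. p (- cnj z)) ` f ` std_triangle"
    unfolding g(3) fstd[symmetric] by (simp only: image_image)
  have 3: "range ((\<lambda>z. p (- cnj z)) \<circ> f \<circ> imag_axis) = range (p \<circ> g \<circ> tri_rot \<circ> imag_axis)"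
    "range ((\<lambda>z. p (- cnj z)) \<circ> f \<circ> tri_rot \<circ> imag_axis) = range (p \<circ> g \<circ> imag_axis)"
    "range ((\<lambda>z. p (- cnj z)) \<circ> f \<circ> tri_rot \<circ> tri_rot \<circ> imag_axis) =
      range (p \<circ> g \<circ> tri_rot \<circ> tri_rot \<circ> imag_axis)"
    using range_shift(2)[of "p \<circ> g \<circ> tri_rot \<circ> imag_axis" 0] range_shift(2)[of "p \<circ> g \<circ> imag_axis" 0]
      range_shift(2)[of "p \<circ> g \<circ> tri_rot \<circ> tri_rot \<circ> imag_axis" 0]
    by (simp_all only: comp_def pf reflection_imag_axis)
  show "\<exists>g\<in>hyp_isometries. inj_on (\<lambda>z. p (- cnj z)) (g ` std_triangle) \<and>
      C = (\<lambda>z. p (- cnj z)) ` g ` std_triangle \<and>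
      range ((\<lambda>z. p (- cnj z)) \<circ> g \<circ> imag_axis) \<in> T \<and>
      range ((\<lambda>z. p (- cnj z)) \<circ> g \<circ> tri_rot \<circ> imag_axis) \<in> T \<and>
      range ((\<lambda>z. p (- cnj z)) \<circ> g \<circ> tri_rot \<circ> tri_rot \<circ> imag_axis) \<in> T"
    using f 1 2 3 g(4-6) by (intro bexI[of _ f]) simp_all
qed (use assms in \<open>auto simp: ideal_triangulation_def\<close>)


lemma (in cusped_surface_with_horocycle) mirror:
  "cusped_surface_with_horocycle S x0 d (\<lambda>z. p (- cnj z)) h t"
proof (unfold_locales)
  show "hyperbolic_universal_cover (S - {x0}) d (\<lambda>z. p (- cnj z))"
    by (rule hyperbolic_universal_cover_mirror[OF cover])
  show "\<exists>t>0. \<forall>z\<in>upper_half_plane. p (- cnj (z + of_real t)) = p (- cnj z)"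
  proof (intro exI[of _ t] conjI t_pos ballI)
    fix z assume "z \<in> upper_half_plane"
    then have "p (- cnj (z + of_real t) + of_real t) = p (- cnj (z + of_real t))" by (intro p_translate_t) simp
    then show "p (- cnj (z + of_real t)) = p (- cnj z)" by simp
  qed
  have "filterlim (\<lambda>z. - cnj z) (filtercomap Im at_top) (filtercomap Im at_top)"
    unfolding filterlim_filtercomap_iff by (simp add: comp_def filterlim_filtercomap)
  then show "((\<lambda>z. p (- cnj z)) \<longlongrightarrow> x0) (filtercomap Im at_top)"
    by (rule filterlim_compose[OF cusp_limit])
  show "embedded_horocycle (\<lambda>z. p (- cnj z)) h t"
    unfolding embedded_horocycle_def
  proof (intro conjI allI h_pos t_pos)
    show "horocycle (\<lambda>z. p (- cnj z)) h (x + t) = horocycle (\<lambda>z. p (- cnj z)) h x" for x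
      using horocycle_periodic[of "- x" "- 1"] unfolding horocycle_mirror by simp
    \<comment> \<open>The reflection turns the half-open period \<open>{0..<t}\<close> into
      \<open>{- t<..0}\<close>, so injectivity is derived from the description of the
      fibres.\<close>
    show "inj_on (horocycle (\<lambda>z. p (- cnj z)) h) {0..<t}"
    proof (rule inj_onI)
      fix x y assume xy: "x \<in> {0..<t}" "y \<in> {0..<t}"
        "horocycle (\<lambda>z. p (- cnj z)) h x = horocycle (\<lambda>z. p (- cnj z)) h y"
      then have "p (Complex (- x) h) = p (Complex (- y) h)" unfolding horocycle_mirror by (simp add: horocycle_def)
      then obtain n :: int where n: "- y = - x + of_int n * t" by (rule horocycle_eqD)
      moreover have "0 \<le> x" "x < t" "0 \<le> y" "y < t" using xy(1,2) by auto
      ultimately have "- 1 * t < of_int n * t" "of_int n * t < 1 * t" by linarith+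
      then have "of_int n > (- 1 :: real)" "of_int n < (1 :: real)"
        unfolding mult_less_cancel_right_pos[OF t_pos] .
      then have "n = 0" by linarith
      then show "x = y" using n by simp
    qed
  qed
qed (use surface marked_point metric in auto)

text \<open>The two sums differ by a factor of two: an edge of \<open>T0\<close> has an old gap on
  either side, whereas the edge created by a flip has an interval that is one old gap. So the value
  1 belongs to the labels \<open>(T0, e)\<close> and the value 1/2 to the labels obtained by
  flipping.\<close>

theorem proposition7p3p1:
  fixes S :: "'a::t2_space set" and x0 :: 'a
    and d :: "'a \<Rightarrow> 'a \<Rightarrow> real" and p :: "complex \<Rightarrow> 'a"
    and h t :: real and T0 :: "'a set set"
  assumes "cusped_hyperbolic_surface S x0 d p"
    and "embedded_horocycle p h t"
    and "ideal_triangulation p S x0 T0"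
  shows "(\<forall>T e. ideal_triangulation p S x0 T \<longrightarrow> e \<in> oriented_edges p x0 T \<longrightarrow>
            Phi p d x0 h t (right_move p S x0 T e) + Phi p d x0 h t (left_move p S x0 T e)
              = Phi p d x0 h t (T, e))
       \<and> (\<Sum>e\<in>oriented_edges p x0 T0. Phi p d x0 h t (T0, e)) = 1
       \<and> boundary_Phi p S d x0 h t T0 = 1 / 2"
proof -
  interpret R: cusped_surface_with_horocycle S x0 d p h t
    by (intro cusped_surface_with_horocycle.intro cusped_surface_with_horocycle_axioms.intro assms)
  define r where "r = (\<lambda>z. p (- cnj z))"
  interpret L: cusped_surface_with_horocycle S x0 d r h t
    unfolding r_def by (rule R.mirror)
  have points_r: "horocycle r h x = horocycle p h (- x)" "edge_point r h e = edge_point p h e"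
    "edge_points r x0 h T = edge_points p x0 h T" "oriented_edges r x0 T = oriented_edges p x0 T" for x e T
    unfolding r_def by (fact horocycle_mirror edge_point_mirror edge_points_mirror oriented_edges_mirror)+
  have right: "Phi p d x0 h t (right_move p S x0 T (oriented_class (\<lambda>s. p (down x s)))) = k / (2 * t)"
    if frame: "ideal_triangulation p S x0 T" "0 < k" "R.frame T (\<lambda>z. of_real x - of_real k / z)" for T x k
  proof -
    obtain y T' e' where *: "right_move p S x0 T (oriented_class (\<lambda>s. p (down x s))) = (T', e')"
      "x - k < y" "y < x" "edge_point p h e' = horocycle p h y"
      "horocycle p h x \<in> edge_points p x0 h T'" "horocycle p h (x - k) \<in> edge_points p x0 h T'"
      "\<And>z. x - k < z \<Longrightarrow> z < x \<Longrightarrow> z \<noteq> y \<Longrightarrow> horocycle p h z \<notin> edge_points p x0 h T'"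
      by (rule R.right_move_points[OF frame]) (rule that)
    show ?thesis unfolding *(1) using R.Phi_eq[OF *(4,2,3,6,5,7)] by simp
  qed
  \<comment> \<open>The left move is by definition the right move for \<open>r\<close>; its gap is
    carried back by \<open>x \<mapsto> - x\<close>, which exchanges the two ends.\<close>
  have left: "Phi p d x0 h t (left_move p S x0 T (oriented_class (\<lambda>s. r (down x s)))) = k / (2 * t)"
    if frame: "ideal_triangulation r S x0 T" "0 < k" "L.frame T (\<lambda>z. of_real x - of_real k / z)" for T x k
  proof -
    obtain y T' e' where *: "right_move r S x0 T (oriented_class (\<lambda>s. r (down x s))) = (T', e')"
      "x - k < y" "y < x" "edge_point r h e' = horocycle r h y"
      "horocycle r h x \<in> edge_points r x0 h T'" "horocycle r h (x - k) \<in> edge_points r x0 h T'"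
      "\<And>z. x - k < z \<Longrightarrow> z < x \<Longrightarrow> z \<noteq> y \<Longrightarrow> horocycle r h z \<notin> edge_points r x0 h T'"
      by (rule L.right_move_points[OF frame]) (rule that)
    note ** = *[unfolded points_r]
    have gap: "horocycle p h z \<notin> edge_points p x0 h T'" if "- x < z" "z < - (x - k)" "z \<noteq> - y" for z
      using **(7)[of "- z"] that by simp
    have "- x < - y" "- y < - (x - k)" using *(2,3) by auto
    then have "Phi p d x0 h t (T', e') = k / (2 * t)"
      using R.Phi_eq[OF **(4) _ _ **(5,6) gap] by simp
    then show ?thesis unfolding left_move_def r_def[symmetric] *(1) .
  qed
  \<comment> \<open>\<open>k e\<close> and \<open>k' e\<close> are the widths of the gaps on the two
    sides of the point of \<open>e\<close>, one from a frame for \<open>p\<close> and one from a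
    frame for \<open>r\<close>.\<close>
  have total: "\<exists>k k'. (\<forall>e\<in>oriented_edges p x0 T.
        Phi p d x0 h t (right_move p S x0 T e) = k e / (2 * t) \<and>
        Phi p d x0 h t (left_move p S x0 T e) = k' e / (2 * t) \<and>
        Phi p d x0 h t (T, e) = (k e + k' e) / (2 * t)) \<and>
      (\<Sum>e\<in>oriented_edges p x0 T. k e) = t \<and> (\<Sum>e\<in>oriented_edges p x0 T. k' e) = t"
    if T: "ideal_triangulation p S x0 T" for T
  proof -
    have Tr: "ideal_triangulation r S x0 T" unfolding r_def by (rule ideal_triangulation_mirror[OF T])
    have "\<forall>e\<in>oriented_edges p x0 T. \<exists>k x. 0 < k \<and> e = oriented_class (\<lambda>s. p (down x s)) \<and>
        R.frame T (\<lambda>z. of_real x - of_real k / z)"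
      using R.vertical_frame_exists[OF T] by metis
    then obtain k x where k: "\<And>e. e \<in> oriented_edges p x0 T \<Longrightarrow> 0 < k e \<and>
        e = oriented_class (\<lambda>s. p (down (x e) s)) \<and> R.frame T (\<lambda>z. of_real (x e) - of_real (k e) / z)"
      by metis
    have "\<forall>e\<in>oriented_edges r x0 T. \<exists>k x. 0 < k \<and> e = oriented_class (\<lambda>s. r (down x s)) \<and>
        L.frame T (\<lambda>z. of_real x - of_real k / z)"
      using L.vertical_frame_exists[OF Tr] by metis
    then obtain k' x' where k': "\<And>e. e \<in> oriented_edges r x0 T \<Longrightarrow> 0 < k' e \<and>
        e = oriented_class (\<lambda>s. r (down (x' e) s)) \<and> L.frame T (\<lambda>z. of_real (x' e) - of_real (k' e) / z)"
      by metis
    have sums: "(\<Sum>e\<in>oriented_edges p x0 T. k e) = t" "(\<Sum>e\<in>oriented_edges r x0 T. k' e) = t"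
      using k k' by (blast intro: R.sum_vertical_gaps[OF T] L.sum_vertical_gaps[OF Tr])+
    have "Phi p d x0 h t (right_move p S x0 T e) = k e / (2 * t) \<and>
        Phi p d x0 h t (left_move p S x0 T e) = k' e / (2 * t) \<and>
        Phi p d x0 h t (T, e) = (k e + k' e) / (2 * t)" if e: "e \<in> oriented_edges p x0 T" for e
    proof -
      have ke: "0 < k e" "e = oriented_class (\<lambda>s. p (down (x e) s))"
        "R.frame T (\<lambda>z. of_real (x e) - of_real (k e) / z)" using k[OF e] by auto
      have ke': "0 < k' e" "e = oriented_class (\<lambda>s. r (down (x' e) s))"
        "L.frame T (\<lambda>z. of_real (x' e) - of_real (k' e) / z)" using k'[of e] e by (auto simp: points_r)
      have 1: "Phi p d x0 h t (right_move p S x0 T e) = k e / (2 * t)"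
        using right[OF T ke(1,3)] ke(2) by simp
      have 2: "Phi p d x0 h t (left_move p S x0 T e) = k' e / (2 * t)"
        using left[OF Tr ke'(1,3)] ke'(2) by simp
      have ep: "edge_point p h e = horocycle p h (x e)" using R.edge_point_down[of "x e"] ke(2) by simp
      have "edge_point p h e = horocycle p h (- x' e)"
        using L.edge_point_down[of "x' e"] ke'(2) by (simp add: points_r)
      then have "p (Complex (- x' e) h) = p (Complex (x e) h)" using ep by (simp add: horocycle_def)
      then obtain n :: int where n: "x e = - x' e + of_int n * t" by (rule R.horocycle_eqD)
      \<comment> \<open>The feet found for \<open>p\<close> and for \<open>r\<close> are negatives
        of each other only up to a multiple of the period; this places the second gap directly above
        \<open>x e\<close>.\<close>
      have shift: "horocycle r h z = horocycle p h (of_int n * t - z)" for z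
        using R.horocycle_periodic[of "- z" n] by (simp add: points_r)
      have K: "horocycle p h (x e - k e) \<in> edge_points p x0 h T"
        "\<And>z. x e - k e < z \<Longrightarrow> z < x e \<Longrightarrow> horocycle p h z \<notin> edge_points p x0 h T"
        using R.vertical_frame_points[OF T ke(1,3)] by auto
      have K': "horocycle p h (x e + k' e) \<in> edge_points p x0 h T"
        using L.vertical_frame_points(2)[OF Tr ke'(1,3)] unfolding points_r(3) shift n by (simp add: algebra_simps)
      have K'': "horocycle p h z \<notin> edge_points p x0 h T" if "x e < z" "z < x e + k' e" for z
        using L.vertical_frame_points(3)[OF Tr ke'(1,3), of "of_int n * t - z"] that n
        unfolding points_r(3) shift by simp
      have "Phi p d x0 h t (T, e) = ((x e + k' e) - (x e - k e)) / (2 * t)"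
        using ke(1) ke'(1) K(2) K'' by (intro R.Phi_eq[OF ep _ _ K(1) K']) (auto simp: neq_iff)
      then show ?thesis using 1 2 by (simp add: algebra_simps)
    qed
    then show ?thesis using sums unfolding points_r(4) by blast
  qed
  have harmonic: "Phi p d x0 h t (right_move p S x0 T e) + Phi p d x0 h t (left_move p S x0 T e) = Phi p d x0 h t (T, e)"
    if "ideal_triangulation p S x0 T" "e \<in> oriented_edges p x0 T" for T e
    using total[OF that(1)] that(2) by (auto simp: add_divide_distrib)
  obtain k k' where k: "\<forall>e\<in>oriented_edges p x0 T0.
        Phi p d x0 h t (right_move p S x0 T0 e) = k e / (2 * t) \<and>
        Phi p d x0 h t (left_move p S x0 T0 e) = k' e / (2 * t) \<and>
        Phi p d x0 h t (T0, e) = (k e + k' e) / (2 * t)"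
      and sums: "(\<Sum>e\<in>oriented_edges p x0 T0. k e) = t" "(\<Sum>e\<in>oriented_edges p x0 T0. k' e) = t"
    using total[OF assms(3)] by metis
  have "(\<Sum>e\<in>oriented_edges p x0 T0. Phi p d x0 h t (T0, e)) = (\<Sum>e\<in>oriented_edges p x0 T0. (k e + k' e) / (2 * t))"
    using k by (intro sum.cong) auto
  also have "\<dots> = ((\<Sum>e\<in>oriented_edges p x0 T0. k e) + (\<Sum>e\<in>oriented_edges p x0 T0. k' e)) / (2 * t)"
    by (simp only: sum_divide_distrib sum.distrib add_divide_distrib)
  also have "\<dots> = 1" using R.t_pos by (simp add: sums)
  finally have sum1: "(\<Sum>e\<in>oriented_edges p x0 T0. Phi p d x0 h t (T0, e)) = 1" .
  \<comment> \<open>Reindexing by the permutation \<open>next_edge\<close> turns the flips at all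
    oriented edges into right moves, whose values are single gaps.\<close>
  have "boundary_Phi p S d x0 h t T0 = (\<Sum>e\<in>oriented_edges p x0 T0. Phi p d x0 h t (right_move p S x0 T0 e))"
    unfolding boundary_Phi_def right_move_def
    using sum.reindex_bij_betw[OF R.next_edge_bij[OF assms(3)], of "\<lambda>e. Phi p d x0 h t (flip p S x0 T0 e)"] by simp
  also have "\<dots> = (\<Sum>e\<in>oriented_edges p x0 T0. k e / (2 * t))" using k by (intro sum.cong) auto
  also have "\<dots> = (\<Sum>e\<in>oriented_edges p x0 T0. k e) / (2 * t)" by (simp only: sum_divide_distrib)
  also have "\<dots> = 1 / 2" using R.t_pos by (simp add: sums)
  finally show ?thesis using harmonic sum1 by blast
qed

end
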